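(* Let $(X_n)_{n\in\mathbb{N}_0}$ and $\Phi=(\phi_n)_{n\in\mathbb{N}_0}$ be as in the standing setting. If $J(\Phi)$ is subprojective and the quotient map $\hat J(\Phi)\to\hat J(\Phi)/J(\Phi)$ is strictly singular, then $\hat J(\Phi)$ is subprojective.
   Context: Standing setting. Let $\mathbb{N}_0=\mathbb{N}\cup\{0\}$ and let $\wp$ be the set of all non-empty finite subsets of $\mathbb{N}_0$. Let $(X_n,\|\cdot\|_n)_{n\in\mathbb{N}_0}$ be a sequence of Banach spaces with $\dim X_0=0$, and let $\Phi=(\phi_n)_{n\in\mathbb{N}_0}$ be a sequence of operators (bounded linear maps) $\phi_n\colon X_n\to X_{n+1}$ with $\|\phi_n\|\le 1$. For $n\le m$ put $\phi_n^m=\phi_{m-1}\circ\cdots\circ\phi_n\colon X_n\to X_m$, with $\phi_n^n=I_{X_n}$. Let $\Pi=\prod_{n\in\mathbb{N}_0}X_n$. For $x=(x_n)_{n\in\mathbb{N}_0}\in\Pi$ and $S=\{p_0<\cdots<p_k\}\in\wp$ define $$\rho(x,S)=\Bigl(\sum_{i=1}^k\bigl\|\phi_{p_{i-1}}^{p_i}(x_{p_{i-1}})-x_{p_i}\bigr\|_{p_i}^2+\|x_{p_k}\|_{p_k}^2\Bigr)^{1/2},$$ and $\|x\|_J=\frac{1}{\sqrt2}\sup_{S\in\wp}\rho(x,S)$. Let $\hat J(\Phi)=\{x\in\Pi:\|x\|_J<\infty\}$, a Banach space with norm $\|\cdot\|_J$, and let $J(\Phi)=\{(x_n)_{n\in\mathbb{N}_0}\in\hat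 J(\Phi):\lim_n\|x_n\|_n=0\}$, a closed subspace of $\hat J(\Phi)$ (equivalently, the closure of the finitely non-zero sequences of $\Pi$ in $\|\cdot\|_J$). A Banach space $X$ is subprojective if every closed infinite-dimensional subspace of $X$ contains an infinite-dimensional subspace complemented in $X$ (i.e. the range of a bounded linear projection on $X$); finite-dimensional spaces are trivially subprojective. An operator $T\colon X\to Y$ between Banach spaces is strictly singular if there is no closed infinite-dimensional subspace $M$ of $X$ such that the restriction $T|_M$ is an isomorphism (onto its image). *)

theory Defs
  imports "HOL-Analysis.Analysis"
begin

section \<open>Normed and Banach spaces as objects\<close>

text \<open>
  The spaces \<open>X n\<close> vary with \<open>n\<close>, so a normed space is a record with an explicit carrier, all
  carriers being subsets of one type. The operations and the norm are meaningful on the carrier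
  only. The scalar field is any type in \<open>{real_normed_field, banach}\<close>; both \<open>real\<close> and
  \<open>complex\<close> are instances.
\<close>

record ('k, 'a) nspace =
  carr :: "'a set"
  zer :: 'a
  add :: "'a \<Rightarrow> 'a \<Rightarrow> 'a"
  scl :: "'k \<Rightarrow> 'a \<Rightarrow> 'a"
  nrm :: "'a \<Rightarrow> real"

definition vdiff :: "('k::{real_normed_field,banach}, 'a) nspace \<Rightarrow> 'a \<Rightarrow> 'a \<Rightarrow> 'a" where
  "vdiff E x y = add E x (scl E (-1) y)"

text \<open>The value 0 off the carrier is there because \<open>Metric_space\<close> asks for a distance function
  that is non-negative and symmetric on the whole type.\<close>

definition ndist :: "('k::{real_normed_field,banach}, 'a) nspace \<Rightarrow> 'a \<Rightarrow> 'a \<Rightarrow> real" where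
  "ndist E x y = (if x \<in> carr E \<and> y \<in> carr E then nrm E (vdiff E x y) else 0)"

locale normed_space =
  fixes E :: "('k::{real_normed_field,banach}, 'a) nspace"
  assumes zer_closed: "zer E \<in> carr E"
    and add_closed: "\<lbrakk>x \<in> carr E; y \<in> carr E\<rbrakk> \<Longrightarrow> add E x y \<in> carr E"
    and scl_closed: "x \<in> carr E \<Longrightarrow> scl E a x \<in> carr E"
    and add_assoc: "\<lbrakk>x \<in> carr E; y \<in> carr E; z \<in> carr E\<rbrakk>
                      \<Longrightarrow> add E (add E x y) z = add E x (add E y z)"
    and add_commute: "\<lbrakk>x \<in> carr E; y \<in> carr E\<rbrakk> \<Longrightarrow> add E x y = add E y x"
    and add_zer: "x \<in> carr E \<Longrightarrow> add E x (zer E) = x"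
    and add_neg: "x \<in> carr E \<Longrightarrow> add E x (scl E (-1) x) = zer E"
    and scl_one: "x \<in> carr E \<Longrightarrow> scl E 1 x = x"
    and scl_scl: "x \<in> carr E \<Longrightarrow> scl E a (scl E b x) = scl E (a * b) x"
    and scl_add_left: "x \<in> carr E \<Longrightarrow> scl E (a + b) x = add E (scl E a x) (scl E b x)"
    and scl_add_right: "\<lbrakk>x \<in> carr E; y \<in> carr E\<rbrakk>
                          \<Longrightarrow> scl E a (add E x y) = add E (scl E a x) (scl E a y)"
    and nrm_nonneg: "x \<in> carr E \<Longrightarrow> 0 \<le> nrm E x"
    and nrm_eq_0: "x \<in> carr E \<Longrightarrow> nrm E x = 0 \<longleftrightarrow> x = zer E"
    and nrm_scl: "x \<in> carr E \<Longrightarrow> nrm E (scl E a x) = norm a * nrm E x"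
    and nrm_triangle: "\<lbrakk>x \<in> carr E; y \<in> carr E\<rbrakk> \<Longrightarrow> nrm E (add E x y) \<le> nrm E x + nrm E y"
begin

lemma vdiff_closed: "\<lbrakk>x \<in> carr E; y \<in> carr E\<rbrakk> \<Longrightarrow> vdiff E x y \<in> carr E"
  by (simp add: vdiff_def add_closed scl_closed)

lemma vdiff_add:
  assumes "x \<in> carr E" "y \<in> carr E" "z \<in> carr E"
  shows "add E (vdiff E x y) (vdiff E y z) = vdiff E x z"
proof -
  have "add E (scl E (-1) y) (add E y (scl E (-1) z)) = scl E (-1) z"
    using assms by (metis add_assoc add_commute add_neg add_zer scl_closed zer_closed)
  then show ?thesis
    unfolding vdiff_def using assms by (simp add: add_assoc add_closed scl_closed)
qed

lemma vdiff_swap: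
  assumes "x \<in> carr E" "y \<in> carr E"
  shows "vdiff E x y = scl E (-1) (vdiff E y x)"
  unfolding vdiff_def using assms
  by (simp add: scl_add_right scl_closed scl_scl scl_one add_commute)

lemma vdiff_eq_zer:
  assumes "x \<in> carr E" "y \<in> carr E"
  shows "vdiff E x y = zer E \<longleftrightarrow> x = y"
proof
  assume "vdiff E x y = zer E"
  moreover have "add E (vdiff E x y) y = x"
    unfolding vdiff_def using assms
    by (metis add_assoc add_commute add_neg add_zer scl_closed)
  ultimately show "x = y"
    using assms by (metis add_commute add_zer zer_closed)
next
  assume "x = y"
  then show "vdiff E x y = zer E"
    using assms by (simp add: vdiff_def add_neg)
qed

sublocale Metric_space "carr E" "ndist E"
proof
  show "0 \<le> ndist E x y" for x y
    by (simp add: ndist_def nrm_nonneg vdiff_closed)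
  show "ndist E x y = ndist E y x" for x y
    using vdiff_swap[of x y] by (auto simp: ndist_def nrm_scl vdiff_closed)
  show "ndist E x y = 0 \<longleftrightarrow> x = y" if "x \<in> carr E" "y \<in> carr E" for x y
    using that by (simp add: ndist_def nrm_eq_0 vdiff_closed vdiff_eq_zer)
  show "ndist E x z \<le> ndist E x y + ndist E y z"
    if "x \<in> carr E" "y \<in> carr E" "z \<in> carr E" for x y z
    using that nrm_triangle[of "vdiff E x y" "vdiff E y z"]
    by (simp add: ndist_def vdiff_closed vdiff_add)
qed

end

locale banach_space = normed_space +
  assumes complete: "mcomplete"

section \<open>Subspaces and dimension\<close>

definition lin_subspace :: "('k::{real_normed_field,banach}, 'a) nspace \<Rightarrow> 'a set \<Rightarrow> bool" where
  "lin_subspace E M \<longleftrightarrow> M \<subseteq> carr E \<and> zer E \<in> M \<and> (\<forall>x\<in>M. \<forall>y\<in>M. add E x y \<in> M) \<and>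
     (\<forall>a. \<forall>x\<in>M. scl E a x \<in> M)"

definition closed_subspace :: "('k::{real_normed_field,banach}, 'a) nspace \<Rightarrow> 'a set \<Rightarrow> bool" where
  "closed_subspace E M \<longleftrightarrow>
     lin_subspace E M \<and> closedin (Metric_space.mtopology (carr E) (ndist E)) M"

definition subsp :: "('k::{real_normed_field,banach}, 'a) nspace \<Rightarrow> 'a set \<Rightarrow> ('k, 'a) nspace" where
  "subsp E M = E\<lparr>carr := M\<rparr>"

definition lspan :: "('k::{real_normed_field,banach}, 'a) nspace \<Rightarrow> 'a set \<Rightarrow> 'a set" where
  "lspan E B = \<Inter>{M. lin_subspace E M \<and> B \<subseteq> M}"

definition finite_dim :: "('k::{real_normed_field,banach}, 'a) nspace \<Rightarrow> bool" where
  "finite_dim E \<longleftrightarrow> (\<exists>B. finite B \<and> B \<subseteq> carr E \<and> lspan E B = carr E)"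

section \<open>Operators\<close>

definition operator ::
  "('k::{real_normed_field,banach}, 'a) nspace \<Rightarrow> ('k, 'b) nspace \<Rightarrow> ('a \<Rightarrow> 'b) \<Rightarrow> bool" where
  "operator E F T \<longleftrightarrow>
     (\<forall>x\<in>carr E. T x \<in> carr F) \<and>
     (\<forall>x\<in>carr E. \<forall>y\<in>carr E. T (add E x y) = add F (T x) (T y)) \<and>
     (\<forall>a. \<forall>x\<in>carr E. T (scl E a x) = scl F a (T x)) \<and>
     (\<exists>C. \<forall>x\<in>carr E. nrm F (T x) \<le> C * nrm E x)"

definition op_norm ::
  "('k::{real_normed_field,banach}, 'a) nspace \<Rightarrow> ('k, 'b) nspace \<Rightarrow> ('a \<Rightarrow> 'b) \<Rightarrow> real" where
  "op_norm E F T = Inf {C. 0 \<le> C \<and> (\<forall>x\<in>carr E. nrm F (T x) \<le> C * nrm E x)}"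

definition isomorphism ::
  "('k::{real_normed_field,banach}, 'a) nspace \<Rightarrow> ('k, 'b) nspace \<Rightarrow> ('a \<Rightarrow> 'b) \<Rightarrow> bool" where
  "isomorphism E F T \<longleftrightarrow> operator E F T \<and> bij_betw T (carr E) (carr F) \<and>
     operator F E (inv_into (carr E) T)"

definition complemented :: "('k::{real_normed_field,banach}, 'a) nspace \<Rightarrow> 'a set \<Rightarrow> bool" where
  "complemented E N \<longleftrightarrow>
     (\<exists>P. operator E E P \<and> (\<forall>x\<in>carr E. P (P x) = P x) \<and> P ` carr E = N)"

definition subprojective :: "('k::{real_normed_field,banach}, 'a) nspace \<Rightarrow> bool" where
  "subprojective E \<longleftrightarrow>
     (\<forall>M. closed_subspace E M \<and> \<not> finite_dim (subsp E M) \<longrightarrow>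
        (\<exists>N\<subseteq>M. lin_subspace E N \<and> \<not> finite_dim (subsp E N) \<and> complemented E N))"

definition strictly_singular ::
  "('k::{real_normed_field,banach}, 'a) nspace \<Rightarrow> ('k, 'b) nspace \<Rightarrow> ('a \<Rightarrow> 'b) \<Rightarrow> bool" where
  "strictly_singular E F T \<longleftrightarrow> operator E F T \<and>
     \<not> (\<exists>M. closed_subspace E M \<and> \<not> finite_dim (subsp E M) \<and>
            isomorphism (subsp E M) (subsp F (T ` M)) T)"

section \<open>Quotients\<close>

definition qmap :: "('k::{real_normed_field,banach}, 'a) nspace \<Rightarrow> 'a set \<Rightarrow> 'a \<Rightarrow> 'a set" where
  "qmap E M x = {add E x m |m. m \<in> M}"

text \<open>In the scalar multiplication, adding \<open>M\<close> matters only for the scalar 0, where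
  \<open>{scl E 0 a |a. a \<in> A}\<close> is not a coset.\<close>

definition quotient_space ::
  "('k::{real_normed_field,banach}, 'a) nspace \<Rightarrow> 'a set \<Rightarrow> ('k, 'a set) nspace" where
  "quotient_space E M =
     \<lparr>carr = qmap E M ` carr E,
      zer = M,
      add = (\<lambda>A B. {add E a b |a b. a \<in> A \<and> b \<in> B}),
      scl = (\<lambda>c A. {add E (scl E c a) m |a m. a \<in> A \<and> m \<in> M}),
      nrm = (\<lambda>A. Inf (nrm E ` A))\<rparr>"

section \<open>The J-sum of a sequence of spaces\<close>

primrec phi_comp :: "(nat \<Rightarrow> 'a \<Rightarrow> 'a) \<Rightarrow> nat \<Rightarrow> nat \<Rightarrow> 'a \<Rightarrow> 'a" where
  "phi_comp \<phi> n 0 = id"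
| "phi_comp \<phi> n (Suc m) = (if n \<le> m then \<phi> m \<circ> phi_comp \<phi> n m else id)"

text \<open>\<open>phi_comp \<phi> n m\<close> is \<open>\<phi> (m - 1) \<circ> \<dots> \<circ> \<phi> n\<close> for \<open>n \<le> m\<close>; its value for \<open>n > m\<close>
  is never used.\<close>

definition rho ::
  "(nat \<Rightarrow> ('k::{real_normed_field,banach}, 'a) nspace) \<Rightarrow> (nat \<Rightarrow> 'a \<Rightarrow> 'a)
     \<Rightarrow> (nat \<Rightarrow> 'a) \<Rightarrow> nat set \<Rightarrow> real" where
  "rho X \<phi> x S =
     (let p = (\<lambda>i. sorted_list_of_set S ! i); k = card S - 1 in
      sqrt ((\<Sum>i=1..k. (nrm (X (p i))
                (vdiff (X (p i)) (phi_comp \<phi> (p (i - 1)) (p i) (x (p (i - 1)))) (x (p i))))\<^sup>2)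
            + (nrm (X (p k)) (x (p k)))\<^sup>2))"

definition fin_sets :: "nat set set" where
  "fin_sets = {S. finite S \<and> S \<noteq> {}}"

text \<open>\<open>SUP\<close> is the supremum in \<open>real\<close>, so \<open>Jnorm\<close> is the J-norm only where the set of values is
  bounded; boundedness is the condition that the J-norm is finite, imposed in \<open>Jhat\<close>.\<close>

definition Jnorm ::
  "(nat \<Rightarrow> ('k::{real_normed_field,banach}, 'a) nspace) \<Rightarrow> (nat \<Rightarrow> 'a \<Rightarrow> 'a)
     \<Rightarrow> (nat \<Rightarrow> 'a) \<Rightarrow> real" where
  "Jnorm X \<phi> x = 1 / sqrt 2 * (SUP S\<in>fin_sets. rho X \<phi> x S)"

definition Jhat ::
  "(nat \<Rightarrow> ('k::{real_normed_field,banach}, 'a) nspace) \<Rightarrow> (nat \<Rightarrow> 'a \<Rightarrow> 'a)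
     \<Rightarrow> ('k, nat \<Rightarrow> 'a) nspace" where
  "Jhat X \<phi> =
     \<lparr>carr = {x. (\<forall>n. x n \<in> carr (X n)) \<and> bdd_above (rho X \<phi> x ` fin_sets)},
      zer = (\<lambda>n. zer (X n)),
      add = (\<lambda>x y n. add (X n) (x n) (y n)),
      scl = (\<lambda>a x n. scl (X n) a (x n)),
      nrm = Jnorm X \<phi>\<rparr>"

definition Jset ::
  "(nat \<Rightarrow> ('k::{real_normed_field,banach}, 'a) nspace) \<Rightarrow> (nat \<Rightarrow> 'a \<Rightarrow> 'a)
     \<Rightarrow> (nat \<Rightarrow> 'a) set" where
  "Jset X \<phi> = {x \<in> carr (Jhat X \<phi>). (\<lambda>n. nrm (X n) (x n)) \<longlonglongrightarrow> 0}"

definition Jsum ::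
  "(nat \<Rightarrow> ('k::{real_normed_field,banach}, 'a) nspace) \<Rightarrow> (nat \<Rightarrow> 'a \<Rightarrow> 'a)
     \<Rightarrow> ('k, nat \<Rightarrow> 'a) nspace" where
  "Jsum X \<phi> = subsp (Jhat X \<phi>) (Jset X \<phi>)"

end

theory Submission
  imports Defs
begin

text \<open>
  Write \<open>J\<close> for the closed subspace of null sequences in \<open>E = Jhat X \<phi>\<close>, and let \<open>trunc m\<close> be the
  projection that keeps the coordinates up to \<open>m\<close>. It is a contraction of \<open>E\<close> with values in \<open>J\<close>.
  Let \<open>M\<close> be a closed infinite-dimensional subspace of \<open>E\<close>.

  If some \<open>trunc m\<close> is bounded below on \<open>M\<close>, then \<open>trunc m ` M\<close> is a closed infinite-dimensional
  subspace of \<open>J\<close>, so it contains the infinite-dimensional range of a projection \<open>Q\<close> on \<open>J\<close>. Then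
  \<open>V \<circ> Q \<circ> trunc m\<close>, with \<open>V\<close> the inverse of \<open>trunc m\<close> on \<open>M\<close>, is a projection defined on
  all of \<open>E\<close> whose range lies in \<open>M\<close> (\<open>complemented_of_bounded_below\<close>). It matters that
  \<open>trunc m\<close> is defined on \<open>E\<close>: in general \<open>J\<close> itself is not complemented in \<open>E\<close>.

  Otherwise \<open>M\<close> contains unit vectors with arbitrarily small truncations. A gliding hump
  yields a sequence of such vectors whose closed span \<open>W\<close> is infinite-dimensional and consists
  of vectors with small truncation. Since the quotient map is strictly singular it is not bounded
  below on \<open>W\<close>; hence \<open>M\<close> contains unit vectors that have a small truncation and are close to
  \<open>J\<close> at the same time (\<open>small_vectors_near_Jset\<close>). A vector of \<open>J\<close> is the limit of its
  truncations, so such a unit vector is close to a vector supported in a finite interval that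
  starts as far out as desired. This gives \<open>w k \<in> M\<close> that are close to vectors \<open>z k\<close> supported
  in successive intervals.

  The norm of \<open>E\<close> is an \<open>\<ell>\<^sup>2\<close>-norm of increments, which makes \<open>\<Sum> a k z k\<close> bounded for square
  summable \<open>a\<close> (\<open>synth_Jh\<close>). The coordinates \<open>a k\<close> are recovered by functionals that see only
  increments inside the interval of \<open>z k\<close> (\<open>normalized_chain_functional\<close>). Functionals of the
  coordinates themselves would not do: on a sequence that does not tend to 0 their values need
  not be square summable, whereas the increments of any element of \<open>E\<close> are. The result is a
  projection of \<open>E\<close> onto the closed span of the \<open>z k\<close>, and a small perturbation of the
  identity carries that span into \<open>M\<close> (\<open>complemented_of_blocks\<close>).

  The functionals come from the Hahn-Banach theorem in the spaces \<open>X n\<close>. Over a general scalar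
  field of class \<open>real_normed_field\<close> it rests on the fact that this field is \<open>\<real>\<close> or is of
  degree 2 over \<open>\<real>\<close> (\<open>real_normed_field_cases\<close>), a form of the Gelfand-Mazur theorem.
\<close>

section \<open>Real normed fields\<close>

text \<open>This is \<open>(a - z) (a - cnj z)\<close>, multiplied out so that only real multiples of powers of
  \<open>a\<close> occur; it has a meaning in a field that need not contain \<open>z\<close>.\<close>

definition quad :: "'k::real_normed_field \<Rightarrow> complex \<Rightarrow> 'k" where
  "quad a z = (a - of_real (Re z))\<^sup>2 + of_real (Im z) ^ 2"

lemma quad_of_real: "quad a (of_real r) = (a - of_real r)\<^sup>2"
  by (simp add: quad_def power2_eq_square algebra_simps)

lemma quad_shift: "quad (a + of_real r) c = quad a (c - of_real r)"
  by (simp add: quad_def algebra_simps)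

lemma quad_expand: "quad a z = a\<^sup>2 - of_real (2 * Re z) * a + of_real ((cmod z)\<^sup>2)"
  by (simp add: quad_def cmod_power2) (simp add: power2_eq_square algebra_simps)

text \<open>With \<open>z = d\<^sup>2\<close>, the factorisation \<open>a\<^sup>2 - d\<^sup>2 = (a - d) (a + d)\<close> together with its
  conjugate.\<close>

lemma quad_mult: "quad a d * quad a (- d) = quad (a\<^sup>2) (d\<^sup>2)"
proof -
  obtain x y where d: "d = Complex x y" by (cases d)
  show ?thesis
    by (simp add: d quad_def Re_power2 Im_power2) (simp add: power2_eq_square algebra_simps)
qed

lemma quad_lower_bound_square:
  assumes "\<And>c. \<mu> \<le> norm (quad y c)" "0 \<le> \<mu>"
  shows "\<mu>\<^sup>2 \<le> norm (quad (y\<^sup>2) c)"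
proof -
  have "quad (y\<^sup>2) c = quad y (csqrt c) * quad y (- csqrt c)"
    by (simp add: quad_mult)
  then show ?thesis
    using assms by (simp add: norm_mult power2_eq_square mult_mono)
qed

lemma quad_lower_bound_power:
  assumes "\<And>c. m\<^sup>2 \<le> norm (quad b c)" "0 \<le> m"
  shows "(m ^ 2 ^ k)\<^sup>2 \<le> norm (quad (b ^ 2 ^ k) c)"
proof (induction k arbitrary: c)
  case (Suc k)
  have "((m ^ 2 ^ k)\<^sup>2)\<^sup>2 \<le> norm (quad ((b ^ 2 ^ k)\<^sup>2) c)"
    by (rule quad_lower_bound_square) (use Suc in auto)
  then show ?case by (simp add: mult.commute flip: power_mult)
qed (use assms in simp)

text \<open>For real \<open>r\<close> the quadratic \<open>quad y r\<close> is the square \<open>(y - r)\<^sup>2\<close>, so the lower bound on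
  quadratics becomes a bound on \<open>norm (y - r)\<close>.\<close>

lemma norm_add_power_lower_bound:
  assumes "\<And>c. m\<^sup>2 \<le> norm (quad b c)" "0 \<le> m"
  shows "m ^ 2 ^ k \<le> norm (b ^ 2 ^ k - of_real r)"
proof -
  have "(m ^ 2 ^ k)\<^sup>2 \<le> (norm (b ^ 2 ^ k - of_real r))\<^sup>2"
    using quad_lower_bound_power[of m b k "of_real r"] assms by (simp add: quad_of_real norm_power)
  then show ?thesis by (rule power2_le_imp_le) simp
qed

text \<open>The number \<open>b ^ 2 ^ k - e ^ 2 ^ k\<close> factors into \<open>b + e\<close>, \<open>b - e\<close> and the sums
  \<open>b ^ 2 ^ j + e ^ 2 ^ j\<close> with \<open>1 \<le> j < k\<close>. All factors except \<open>b + e\<close> are as large in norm as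
  the powers of \<open>m\<close> of the same degree, and the product has norm at most
  \<open>m ^ 2 ^ k + e ^ 2 ^ k\<close>; since \<open>e < m\<close>, letting \<open>k\<close> grow forces \<open>norm (b + e) \<le> m\<close>.\<close>

lemma norm_add_le_of_quad_lower_bound:
  fixes b :: "'k::real_normed_field"
  assumes G: "\<And>c. m\<^sup>2 \<le> norm (quad b c)" and b: "norm b = m" and e: "0 < e" "e < m"
  shows "norm (b + of_real e) = m"
proof (rule antisym)
  have m: "0 < m" using e by simp
  have lower: "norm (b + of_real e) * m ^ (2 ^ Suc k - 1)
      \<le> norm (b ^ 2 ^ Suc k - of_real (e ^ 2 ^ Suc k))" for k
  proof (induction k)
    case 0
    have "b\<^sup>2 - of_real (e\<^sup>2) = (b + of_real e) * (b - of_real e)"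
      by (simp add: power2_eq_square algebra_simps)
    moreover have "m \<le> norm (b - of_real e)"
      using norm_add_power_lower_bound[of m b 0 e] G m by simp
    ultimately show ?case by (simp add: norm_mult mult_left_mono)
  next
    case (Suc k)
    define n where "n = (2 ^ Suc k :: nat)"
    have n: "2 ^ Suc (Suc k) = n + n" "n \<ge> 1" by (simp_all add: n_def)
    have "b ^ (n + n) - of_real (e ^ (n + n))
        = (b ^ n - of_real (e ^ n)) * (b ^ n - of_real (- (e ^ n)))"
      unfolding power_add by (simp add: algebra_simps)
    moreover have "m ^ n \<le> norm (b ^ n - of_real (- (e ^ n)))"
      unfolding n_def by (rule norm_add_power_lower_bound) (use G m in auto)
    moreover have "norm (b + of_real e) * m ^ (n - 1) \<le> norm (b ^ n - of_real (e ^ n))"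
      using Suc by (simp only: n_def)
    ultimately have "norm (b + of_real e) * m ^ (n - 1) * m ^ n
       \<le> norm (b ^ (n + n) - of_real (e ^ (n + n)))"
      using m by (simp only: norm_mult) (rule mult_mono, auto)
    moreover have "m ^ (n - 1) * m ^ n = m ^ (n + n - 1)"
    proof -
      have "n - 1 + n = n + n - 1" using n(2) by linarith
      then show ?thesis by (simp only: flip: power_add)
    qed
    ultimately show ?case unfolding n(1) by (simp only: mult.assoc)
  qed
  have up: "norm (b + of_real e) \<le> m * (1 + (e / m) ^ 2 ^ Suc k)" for k
  proof -
    define n where "n = (2 ^ Suc k :: nat)"
    have "norm (b ^ n - of_real (e ^ n)) \<le> m ^ n + e ^ n"
      using norm_triangle_ineq4[of "b ^ n" "of_real (e ^ n)"] b e
      by (simp add: norm_power)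
    with lower[of k] have "norm (b + of_real e) * m ^ (n - 1) \<le> m ^ n + e ^ n"
      unfolding n_def by (rule order_trans)
    then have "norm (b + of_real e) * m ^ (n - 1) * m \<le> (m ^ n + e ^ n) * m"
      by (rule mult_right_mono) (use m in simp)
    moreover have "m ^ (n - 1) * m = m ^ n"
      by (rule power_minus_mult) (simp add: n_def)
    ultimately have le: "norm (b + of_real e) * m ^ n \<le> (m ^ n + e ^ n) * m"
      by (simp only: mult.assoc)
    have "norm (b + of_real e) * m ^ n \<le> m * (1 + (e / m) ^ n) * m ^ n"
    proof -
      have "m * (1 + (e / m) ^ n) * m ^ n = (m ^ n + e ^ n) * m"
        using m by (simp add: power_divide field_simps)
      with le show ?thesis by (simp only:)
    qed
    then show ?thesis using m unfolding n_def by (subst (asm) mult_le_cancel_right_pos) auto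
  qed
  have "(\<lambda>k. (e / m) ^ 2 ^ Suc k) \<longlonglongrightarrow> 0"
  proof -
    have "strict_mono (\<lambda>k. 2 ^ Suc k :: nat)" by (simp add: strict_mono_Suc_iff)
    moreover have "(\<lambda>n. (e / m) ^ n) \<longlonglongrightarrow> 0"
      by (rule LIMSEQ_realpow_zero) (use e in auto)
    ultimately show ?thesis
      using LIMSEQ_subseq_LIMSEQ[of "\<lambda>n. (e / m) ^ n" 0 "\<lambda>k. 2 ^ Suc k"] by (simp only: o_def)
  qed
  then have "(\<lambda>k. m * (1 + (e / m) ^ 2 ^ Suc k)) \<longlonglongrightarrow> m * (1 + 0)"
    by (intro tendsto_intros)
  then show "norm (b + of_real e) \<le> m"
    using up by (intro LIMSEQ_le_const) auto
  show "m \<le> norm (b + of_real e)"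
    using norm_add_power_lower_bound[of m b 0 "-e"] G m by simp
qed

text \<open>If no quadratic vanished at \<open>a\<close>, its norm would attain a minimum \<open>m > 0\<close> over
  \<open>z\<close>. Adding a small positive real to the minimal value gives another value of the same form,
  again of norm exactly \<open>m\<close> by the previous lemma. After five steps of size \<open>m / 2\<close> the triangle
  inequality is violated.\<close>

lemma quad_root:
  fixes a :: "'k::real_normed_field"
  shows "\<exists>z. quad a z = 0"
proof -
  \<comment> \<open>Outside the ball of radius \<open>3 * norm a\<close> the values are at least \<open>(norm a)\<^sup>2\<close>, the value
    at \<open>z = 0\<close>; so a minimum over the ball is a global one.\<close>
  have cont: "continuous_on A (\<lambda>z. norm (quad a z))" for A
    unfolding quad_def by (intro continuous_intros)
  have "\<exists>z0\<in>cball 0 (3 * norm a). \<forall>z\<in>cball 0 (3 * norm a). norm (quad a z0) \<le> norm (quad a z)"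
    by (rule continuous_attains_inf[OF compact_cball _ cont]) auto
  then obtain z0 where z0: "\<And>z. z \<in> cball 0 (3 * norm a) \<Longrightarrow> norm (quad a z0) \<le> norm (quad a z)"
    by blast
  have min: "norm (quad a z0) \<le> norm (quad a z)" for z
  proof (cases "z \<in> cball 0 (3 * norm a)")
    case False
    then have z: "3 * norm a < cmod z" by simp
    have "norm (quad a z0) \<le> (norm a)\<^sup>2"
      using z0[of 0] by (simp add: quad_def norm_power)
    also have "(norm a)\<^sup>2 \<le> (cmod z)\<^sup>2 - 2 * cmod z * norm a - (norm a)\<^sup>2"
    proof -
      have "3 * norm a * norm a \<le> cmod z * (cmod z - 2 * norm a)"
        by (rule mult_mono) (use z in auto)
      then show ?thesis
        using zero_le_square[of "norm a"] unfolding power2_eq_square right_diff_distrib by linarith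
    qed
    also have "\<dots> \<le> norm (of_real ((cmod z)\<^sup>2) :: 'k) - norm (of_real (2 * Re z) * a) - norm (a\<^sup>2)"
      using abs_Re_le_cmod[of z] by (simp add: norm_mult norm_power mult_right_mono)
    also have "\<dots> \<le> norm (quad a z)"
      unfolding quad_expand
      using norm_triangle_ineq2[of "of_real ((cmod z)\<^sup>2)" "of_real (2 * Re z) * a - a\<^sup>2"]
        norm_triangle_ineq4[of "of_real (2 * Re z) * a" "a\<^sup>2"]
      by (simp add: algebra_simps)
    finally show ?thesis .
  qed (use z0 in auto)
  define m where "m = norm (quad a z0)"
  have "m = 0"
  proof (rule ccontr)
    assume "m \<noteq> 0"
    then have m: "m > 0" by (simp add: m_def)
    define b where "b = quad a z0"
    define s \<tau> where "s = Re z0" and "\<tau> = (Im z0)\<^sup>2"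
    have b_eq: "b = (a + of_real (- s))\<^sup>2 + of_real \<tau>"
      by (simp add: b_def quad_def s_def \<tau>_def)
    have "m\<^sup>2 \<le> norm (quad ((a + of_real (- s))\<^sup>2) c)" for c
      by (rule quad_lower_bound_square) (use min m in \<open>auto simp: m_def quad_shift simp del: of_real_minus\<close>)
    then have G: "m\<^sup>2 \<le> norm (quad (b + of_real r) c)" for r c
      unfolding b_eq quad_shift by blast
    have "norm (b + of_real (real k * (m / 2))) = m" for k
    proof (induction k)
      case (Suc k)
      have "norm (b + of_real (real k * (m / 2)) + of_real (m / 2)) = m"
        by (rule norm_add_le_of_quad_lower_bound[OF G Suc]) (use m in auto)
      then show ?case by (simp add: algebra_simps add_divide_distrib)
    qed (simp add: b_def m_def)
    from this[of 5] have "norm (of_real (5 * (m / 2)) :: 'k) \<le> m + norm b"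
      using norm_triangle_ineq4[of "b + of_real (5 * (m / 2))" b] by simp
    then show False using m by (simp add: b_def flip: m_def)
  qed
  then show ?thesis by (auto simp: m_def)
qed

text \<open>Every element satisfies a real quadratic equation without two different real roots, so up
  to a real shift its square is \<open>- r\<^sup>2\<close>. If some \<open>r\<close> is non-zero there is a square root of \<open>-1\<close>,
  and its real multiples are the only square roots of the numbers \<open>- r\<^sup>2\<close>.\<close>

lemma real_normed_field_cases:
  obtains (real) "\<And>a :: 'k::real_normed_field. a \<in> \<real>"
  | (complex) j :: "'k::real_normed_field" where "j\<^sup>2 = -1" "\<And>a. \<exists>x y. a = of_real x + of_real y * j"
proof -
  have square: "\<exists>s r. (a - of_real s)\<^sup>2 = - (of_real r)\<^sup>2" for a :: 'k
  proof -
    obtain z where "quad a z = 0" using quad_root by blast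
    then have "(a - of_real (Re z))\<^sup>2 = - (of_real (Im z))\<^sup>2"
      by (simp add: quad_def eq_neg_iff_add_eq_0)
    then show ?thesis by blast
  qed
  show ?thesis
  proof (cases "\<exists>j::'k. j\<^sup>2 = -1")
    case True
    then obtain j :: 'k where j: "j\<^sup>2 = -1" by blast
    have "\<exists>x y. a = of_real x + of_real y * j" for a
    proof -
      obtain s r where "(a - of_real s)\<^sup>2 = - (of_real r)\<^sup>2" using square by blast
      also have "\<dots> = (of_real r * j)\<^sup>2" by (simp add: power_mult_distrib j)
      finally have "a - of_real s = of_real r * j \<or> a - of_real s = - (of_real r * j)"
        by (simp add: power2_eq_iff)
      then have "a = of_real s + of_real r * j \<or> a = of_real s + of_real (- r) * j"
        by (auto simp: algebra_simps)
      then show ?thesis by blast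
    qed
    with j show ?thesis by (rule complex)
  next
    case False
    have "a \<in> \<real>" for a :: 'k
    proof -
      obtain s r where sr: "(a - of_real s)\<^sup>2 = - (of_real r)\<^sup>2" using square by blast
      have "r = 0"
      proof (rule ccontr)
        assume "r \<noteq> 0"
        with sr have "((a - of_real s) / of_real r)\<^sup>2 = -1" by (simp add: power_divide)
        with False show False by blast
      qed
      with sr have "a = of_real s" by simp
      then show ?thesis by simp
    qed
    then show ?thesis by (rule real)
  qed
qed

context normed_space
begin

section \<open>The Hahn-Banach theorem\<close>

lemmas closed [simp] = zer_closed add_closed scl_closed vdiff_closed

lemma scl_0 [simp]: "x \<in> carr E \<Longrightarrow> scl E 0 x = zer E"
  using scl_add_left[of x 1 "-1"] by (simp add: add_neg scl_one)

lemma scl_zer [simp]: "scl E a (zer E) = zer E"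
  using scl_scl[of "zer E" a 0] by simp

lemma zer_add [simp]: "x \<in> carr E \<Longrightarrow> add E (zer E) x = x"
  by (metis add_commute add_zer zer_closed)

lemma add_left_commute:
  "\<lbrakk>x \<in> carr E; y \<in> carr E; z \<in> carr E\<rbrakk> \<Longrightarrow> add E x (add E y z) = add E y (add E x z)"
  by (metis add_assoc add_commute)

lemma add_neg_cancel [simp]:
  "\<lbrakk>x \<in> carr E; y \<in> carr E\<rbrakk> \<Longrightarrow> add E x (add E (scl E (- 1) x) y) = y"
  "\<lbrakk>x \<in> carr E; y \<in> carr E\<rbrakk> \<Longrightarrow> add E (scl E (- 1) x) (add E x y) = y"
  by (metis add_assoc add_neg scl_closed zer_add, metis add_assoc add_commute add_neg scl_closed zer_add)

lemmas vec = vdiff_def add_assoc add_commute add_left_commute scl_add_right scl_scl scl_one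

lemma vdiff_self [simp]: "x \<in> carr E \<Longrightarrow> vdiff E x x = zer E"
  by (simp add: vdiff_eq_zer)

lemma vdiff_zer [simp]: "x \<in> carr E \<Longrightarrow> vdiff E x (zer E) = x"
  by (simp add: vdiff_def add_zer)

lemma vdiff_add_cancel [simp]:
  "\<lbrakk>x \<in> carr E; y \<in> carr E\<rbrakk> \<Longrightarrow> add E (vdiff E x y) y = x"
  "\<lbrakk>x \<in> carr E; y \<in> carr E\<rbrakk> \<Longrightarrow> add E y (vdiff E x y) = x"
  "\<lbrakk>x \<in> carr E; y \<in> carr E\<rbrakk> \<Longrightarrow> vdiff E (add E x y) y = x"
  "\<lbrakk>x \<in> carr E; y \<in> carr E\<rbrakk> \<Longrightarrow> vdiff E (add E y x) y = x"
  by (simp_all add: vec add_neg add_zer)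

lemma vdiff_vdiff_cancel [simp]: "\<lbrakk>x \<in> carr E; y \<in> carr E\<rbrakk> \<Longrightarrow> vdiff E x (vdiff E x y) = y"
  using vdiff_add_cancel(4)[of y "vdiff E x y"] by simp

lemma scl_vdiff:
  "\<lbrakk>x \<in> carr E; y \<in> carr E\<rbrakk> \<Longrightarrow> scl E a (vdiff E x y) = vdiff E (scl E a x) (scl E a y)"
  by (simp add: vec)

lemma vdiff_add_add:
  "\<lbrakk>x \<in> carr E; y \<in> carr E; u \<in> carr E; v \<in> carr E\<rbrakk> \<Longrightarrow>
    vdiff E (add E x y) (add E u v) = add E (vdiff E x u) (vdiff E y v)"
  by (simp add: vec)

lemma nrm_zer [simp]: "nrm E (zer E) = 0"
  by (simp add: nrm_eq_0)

lemma nrm_vdiff_commute: "\<lbrakk>x \<in> carr E; y \<in> carr E\<rbrakk> \<Longrightarrow> nrm E (vdiff E x y) = nrm E (vdiff E y x)"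
  by (subst vdiff_swap) (simp_all add: nrm_scl)

lemma nrm_vdiff_triangle:
  "\<lbrakk>x \<in> carr E; y \<in> carr E; z \<in> carr E\<rbrakk> \<Longrightarrow>
    nrm E (vdiff E x z) \<le> nrm E (vdiff E x y) + nrm E (vdiff E y z)"
  by (metis nrm_triangle vdiff_add vdiff_closed)

lemma nrm_le_vdiff:
  "\<lbrakk>x \<in> carr E; y \<in> carr E\<rbrakk> \<Longrightarrow> nrm E x \<le> nrm E y + nrm E (vdiff E x y)"
  by (metis add.commute nrm_triangle vdiff_add_cancel(1) vdiff_closed)

lemma nrm_vdiff_le:
  "\<lbrakk>x \<in> carr E; y \<in> carr E\<rbrakk> \<Longrightarrow> nrm E (vdiff E x y) \<le> nrm E x + nrm E y"
  using nrm_triangle[of x "scl E (-1) y"] by (simp add: vdiff_def nrm_scl)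

text \<open>Domination by the norm is part of the definition because it is what bounds chains of
  sublinear functionals from below.\<close>

definition sublinear :: "('a \<Rightarrow> real) \<Rightarrow> bool" where
  "sublinear p \<longleftrightarrow> (\<forall>x\<in>carr E. \<forall>y\<in>carr E. p (add E x y) \<le> p x + p y) \<and>
     (\<forall>x\<in>carr E. \<forall>r\<ge>0. p (scl E (of_real r) x) \<le> r * p x) \<and> (\<forall>x\<in>carr E. p x \<le> nrm E x)"

lemma sublinear_scl:
  "\<lbrakk>sublinear p; x \<in> carr E; 0 \<le> r\<rbrakk> \<Longrightarrow> p (scl E (of_real r) x) \<le> r * p x"
  by (simp add: sublinear_def)

lemma sublinear_zer: "sublinear p \<Longrightarrow> p (zer E) = 0"
  unfolding sublinear_def
  by (metis add_zer antisym le_add_same_cancel1 mult_zero_left order_refl of_real_0 scl_zer zer_closed)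

lemma sublinear_ge: "\<lbrakk>sublinear p; x \<in> carr E\<rbrakk> \<Longrightarrow> - p (scl E (-1) x) \<le> p x"
  using sublinear_zer[of p] unfolding sublinear_def
  by (metis add_neg add.commute neg_le_iff_le diff_0 diff_le_eq scl_closed)

lemma sublinear_ge_nrm: "\<lbrakk>sublinear p; x \<in> carr E\<rbrakk> \<Longrightarrow> - nrm E x \<le> p x"
proof -
  assume p: "sublinear p" "x \<in> carr E"
  then have "p (scl E (-1) x) \<le> nrm E (scl E (-1) x)" unfolding sublinear_def by simp
  with sublinear_ge[OF p] p show ?thesis by (simp add: nrm_scl)
qed

text \<open>A real-linear \<open>f \<le> p\<close> with \<open>f y = p y\<close> satisfies \<open>f x = f (x + t y) - t f y \<le> p (x + t y) - t p y\<close>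
  for all \<open>t \<ge> 0\<close>; \<open>tilt p y x\<close> is the best of these bounds. A minimal sublinear functional is its
  own tilt in every direction, and this is what makes it additive.\<close>

definition tilt :: "('a \<Rightarrow> real) \<Rightarrow> 'a \<Rightarrow> 'a \<Rightarrow> real" where
  "tilt p y x = (INF t\<in>{0..}. p (add E x (scl E (of_real t) y)) - t * p y)"

lemma tilt_le:
  assumes "sublinear p" "x \<in> carr E" "y \<in> carr E" "0 \<le> t"
  shows "tilt p y x \<le> p (add E x (scl E (of_real t) y)) - t * p y"
  unfolding tilt_def
proof (rule cINF_lower)
  show "bdd_below ((\<lambda>t. p (add E x (scl E (of_real t) y)) - t * p y) ` {0..})"
  proof (rule bdd_belowI2[where m = "- p (scl E (-1) x)"])
    fix t :: real assume "t \<in> {0..}"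
    then have t: "0 \<le> t" by simp
    \<comment> \<open>For \<open>t > 0\<close>, subadditivity is applied to \<open>t y = (x + t y) + (- x)\<close>.\<close>
    have "- p (scl E (-1) x) \<le> p (add E x (scl E (of_real t) y)) - t * p y" if "t = 0"
      using sublinear_ge[OF assms(1,2)] assms that by (simp add: add_zer)
    moreover have "- p (scl E (-1) x) \<le> p (add E x (scl E (of_real t) y)) - t * p y" if "t > 0"
    proof -
      have "p (scl E (of_real (1/t)) (scl E (of_real t) y)) \<le> 1/t * p (scl E (of_real t) y)"
        by (rule sublinear_scl) (use assms that in auto)
      then have "t * p y \<le> p (scl E (of_real t) y)"
        using assms that by (simp add: scl_scl scl_one field_simps flip: of_real_mult)
      also have "scl E (of_real t) y = add E (add E x (scl E (of_real t) y)) (scl E (-1) x)"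
        using assms by (simp add: add_commute[of x] add_assoc add_neg add_zer)
      also have "p \<dots> \<le> p (add E x (scl E (of_real t) y)) + p (scl E (-1) x)"
        using assms unfolding sublinear_def by simp
      finally show ?thesis by simp
    qed
    ultimately show "- p (scl E (-1) x) \<le> p (add E x (scl E (of_real t) y)) - t * p y"
      using t by force
  qed
qed (use assms in simp)

lemma tilt_greatest:
  "(\<And>t. 0 \<le> t \<Longrightarrow> c \<le> p (add E x (scl E (of_real t) y)) - t * p y) \<Longrightarrow> c \<le> tilt p y x"
  unfolding tilt_def by (rule cINF_greatest) auto

lemma sublinear_tilt:
  assumes p: "sublinear p" and y: "y \<in> carr E"
  shows "sublinear (tilt p y)"
  unfolding sublinear_def
proof (intro conjI ballI allI impI)
  fix x x' assume x: "x \<in> carr E" "x' \<in> carr E"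
  have "tilt p y (add E x x') - (p (add E x' (scl E (of_real t') y)) - t' * p y) \<le> tilt p y x"
    if t': "0 \<le> t'" for t'
  proof (rule tilt_greatest)
    fix t :: real assume t: "0 \<le> t"
    have "tilt p y (add E x x') \<le> p (add E (add E x x') (scl E (of_real (t + t')) y)) - (t + t') * p y"
      by (rule tilt_le) (use assms x t t' in auto)
    also have "add E (add E x x') (scl E (of_real (t + t')) y)
        = add E (add E x (scl E (of_real t) y)) (add E x' (scl E (of_real t') y))"
      using x y by (simp add: scl_add_left add_assoc add_left_commute)
    also have "p \<dots> \<le> p (add E x (scl E (of_real t) y)) + p (add E x' (scl E (of_real t') y))"
      using p x y unfolding sublinear_def by simp
    finally show "tilt p y (add E x x') - (p (add E x' (scl E (of_real t') y)) - t' * p y)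
       \<le> p (add E x (scl E (of_real t) y)) - t * p y" by (simp add: algebra_simps)
  qed
  then have "tilt p y (add E x x') - tilt p y x \<le> tilt p y x'"
    by (intro tilt_greatest) force
  then show "tilt p y (add E x x') \<le> tilt p y x + tilt p y x'" by simp
next
  fix x and r :: real assume x: "x \<in> carr E" and r: "0 \<le> r"
  show "tilt p y (scl E (of_real r) x) \<le> r * tilt p y x"
  proof (cases "r = 0")
    case True
    then show ?thesis
      using tilt_le[of p "zer E" y 0] sublinear_zer[OF p] p x y by simp
  next
    case False
    have "tilt p y (scl E (of_real r) x) / r \<le> tilt p y x"
    proof (rule tilt_greatest)
      fix t :: real assume t: "0 \<le> t"
      have "tilt p y (scl E (of_real r) x)
          \<le> p (add E (scl E (of_real r) x) (scl E (of_real (r * t)) y)) - r * t * p y"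
        by (rule tilt_le) (use assms x t r in auto)
      also have "add E (scl E (of_real r) x) (scl E (of_real (r * t)) y)
          = scl E (of_real r) (add E x (scl E (of_real t) y))"
        using x y by (simp add: scl_add_right scl_scl)
      also have "p \<dots> \<le> r * p (add E x (scl E (of_real t) y))"
        using p x y r unfolding sublinear_def by simp
      finally show "tilt p y (scl E (of_real r) x) / r \<le> p (add E x (scl E (of_real t) y)) - t * p y"
        using False r by (simp add: field_simps)
    qed
    then show ?thesis using False r by (simp add: field_simps)
  qed
next
  fix x assume x: "x \<in> carr E"
  show "tilt p y x \<le> nrm E x"
    using tilt_le[of p x y 0] p x y unfolding sublinear_def by (fastforce simp: add_zer)
qed

lemma sublinear_Inf_chain:
  assumes C: "C \<noteq> {}" "\<And>p. p \<in> C \<Longrightarrow> sublinear p"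
    and chain: "\<And>p q. \<lbrakk>p \<in> C; q \<in> C\<rbrakk> \<Longrightarrow> (\<forall>x. p x \<le> q x) \<or> (\<forall>x. q x \<le> p x)"
  shows "sublinear (\<lambda>x. INF p\<in>C. p x)" (is "sublinear ?u")
    and "\<And>p x. \<lbrakk>p \<in> C; x \<in> carr E\<rbrakk> \<Longrightarrow> (INF p\<in>C. p x) \<le> p x"
proof -
  show le: "?u x \<le> p x" if "p \<in> C" "x \<in> carr E" for p x
    by (rule cINF_lower[OF bdd_belowI2[where m = "- nrm E x"]]) (use that C sublinear_ge_nrm in auto)
  show "sublinear ?u"
    unfolding sublinear_def
  proof (intro conjI ballI allI impI)
    fix x y assume x: "x \<in> carr E" "y \<in> carr E"
    have *: "?u (add E x y) \<le> p x + q y" if pq: "p \<in> C" "q \<in> C" for p q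
    proof -
      obtain r where r: "r \<in> C" "r x \<le> p x" "r y \<le> q y"
        using chain[OF pq] pq by blast
      have "?u (add E x y) \<le> r (add E x y)" by (rule le) (use r x in auto)
      also have "\<dots> \<le> r x + r y" using C r x unfolding sublinear_def by simp
      finally show ?thesis using r by simp
    qed
    have "?u (add E x y) - q y \<le> ?u x" if "q \<in> C" for q
      by (rule cINF_greatest[OF C(1)]) (use *[OF _ that] in \<open>simp add: algebra_simps\<close>)
    then have "?u (add E x y) - ?u x \<le> ?u y"
      by (intro cINF_greatest[OF C(1)]) (force simp: algebra_simps)
    then show "?u (add E x y) \<le> ?u x + ?u y" by simp
  next
    fix x and r :: real assume x: "x \<in> carr E" and r: "0 \<le> r"
    have *: "?u (scl E (of_real r) x) \<le> r * p x" if p: "p \<in> C" for p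
    proof -
      have "?u (scl E (of_real r) x) \<le> p (scl E (of_real r) x)" by (rule le) (use p x in auto)
      also have "\<dots> \<le> r * p x" using C p x r unfolding sublinear_def by simp
      finally show ?thesis .
    qed
    show "?u (scl E (of_real r) x) \<le> r * ?u x"
    proof (cases "r = 0")
      case True
      with * C(1) show ?thesis by fastforce
    next
      case False
      have "?u (scl E (of_real r) x) / r \<le> ?u x"
        by (rule cINF_greatest[OF C(1)]) (use * False r in \<open>simp add: field_simps\<close>)
      then show ?thesis using False r by (simp add: field_simps)
    qed
  next
    fix x assume x: "x \<in> carr E"
    obtain p where "p \<in> C" using C by blast
    then show "?u x \<le> nrm E x" using le[of p x] C x unfolding sublinear_def by force
  qed
qed

text \<open>By Zorn's lemma there is a minimal sublinear functional among those that take a value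
  of at most \<open>- nrm E d\<close> at \<open>- d\<close>; the norm tilted in the direction \<open>d\<close> is one of them. Minimality
  gives additivity, hence real linearity.\<close>

theorem real_Hahn_Banach:
  assumes d: "d \<in> carr E"
  obtains f where "\<And>x y. \<lbrakk>x \<in> carr E; y \<in> carr E\<rbrakk> \<Longrightarrow> f (add E x y) = f x + f y"
    "\<And>r x. x \<in> carr E \<Longrightarrow> f (scl E (of_real r) x) = r * f x"
    "\<And>x. x \<in> carr E \<Longrightarrow> \<bar>f x\<bar> \<le> nrm E x" "f d = nrm E d"
proof -
  define A where "A = {p. sublinear p \<and> p (scl E (-1) d) \<le> - nrm E d \<and> (\<forall>x. x \<notin> carr E \<longrightarrow> p x = 0)}"
  define P where "P = (\<lambda>p q :: 'a \<Rightarrow> real. \<forall>x. q x \<le> p x)"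
  \<comment> \<open>The pointwise order is antisymmetric only if the values off the carrier are fixed.\<close>
  let ?cut = "\<lambda>p x. if x \<in> carr E then p x else 0 :: real"
  have cut: "?cut p \<in> A" if "sublinear p" "p (scl E (-1) d) \<le> - nrm E d" for p
    using that d by (simp add: A_def sublinear_def)
  have nrm: "sublinear (nrm E)"
    by (simp add: sublinear_def nrm_triangle nrm_scl)
  have start: "?cut (tilt (nrm E) d) \<in> A"
    by (rule cut[OF sublinear_tilt[OF nrm d]])
      (use tilt_le[OF nrm _ d, of "scl E (-1) d" 1] d in \<open>simp add: scl_one add_neg add_commute\<close>)
  have "\<exists>m\<in>A. \<forall>a\<in>A. P m a \<longrightarrow> a = m"
  proof (rule predicate_Zorn)
    show "partial_order_on A (relation_of P A)"
      by (rule partial_order_on_relation_ofI) (auto simp: P_def fun_eq_iff intro: order_trans antisym)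
    fix C assume "C \<in> Chains (relation_of P A)"
    then have C: "C \<subseteq> A" "\<And>p q. \<lbrakk>p \<in> C; q \<in> C\<rbrakk> \<Longrightarrow> P p q \<or> P q p"
      by (auto simp: Chains_def relation_of_def)
    show "\<exists>u\<in>A. \<forall>a\<in>C. P a u"
    proof (cases "C = {}")
      case True
      with start show ?thesis by blast
    next
      case False
      have sub: "sublinear p" if "p \<in> C" for p using C that by (auto simp: A_def)
      have ch: "(\<forall>x. p x \<le> q x) \<or> (\<forall>x. q x \<le> p x)" if "p \<in> C" "q \<in> C" for p q
        using C(2)[OF that] by (auto simp: P_def)
      have u1: "sublinear (\<lambda>x. INF p\<in>C. p x)"
        by (rule sublinear_Inf_chain(1)[OF False]) (erule sub, erule (1) ch)
      have u2: "(INF p\<in>C. p x) \<le> p x" if "p \<in> C" "x \<in> carr E" for p x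
        by (rule sublinear_Inf_chain(2)[OF False _ _ that]) (erule sub, erule (1) ch)
      obtain p where p: "p \<in> C" using False by blast
      have "(INF p\<in>C. p (scl E (-1) d)) \<le> - nrm E d"
      proof (rule order_trans)
        show "(INF p\<in>C. p (scl E (-1) d)) \<le> p (scl E (-1) d)" by (rule u2[OF p]) (use d in simp)
        show "p (scl E (-1) d) \<le> - nrm E d" using p C(1) unfolding A_def by blast
      qed
      then have "?cut (\<lambda>x. INF p\<in>C. p x) \<in> A" by (rule cut[OF u1])
      moreover have "P p (?cut (\<lambda>x. INF p\<in>C. p x))" if "p \<in> C" for p
        unfolding P_def
      proof
        fix x
        show "?cut (\<lambda>x. INF p\<in>C. p x) x \<le> p x"
        proof (cases "x \<in> carr E")
          case True
          then show ?thesis using u2[OF that True] by simp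
        next
          case False
          then have "p x = 0" using C(1) that unfolding A_def by blast
          with False show ?thesis by simp
        qed
      qed
      ultimately show ?thesis by blast
    qed
  qed
  then obtain f where f: "f \<in> A" and min: "\<And>p. \<lbrakk>p \<in> A; P f p\<rbrakk> \<Longrightarrow> p = f" by blast
  have sub: "sublinear f" using f by (simp add: A_def)
  have ge: "f x + f y \<le> f (add E x y)" if x: "x \<in> carr E" "y \<in> carr E" for x y
  proof -
    let ?g = "?cut (tilt f y)"
    have le: "tilt f y z \<le> f z" if "z \<in> carr E" for z
      using tilt_le[OF sub that x(2), of 0] that x by (simp add: add_zer)
    have "?g = f"
    proof (rule min)
      show "?g \<in> A"
        by (rule cut[OF sublinear_tilt[OF sub x(2)]]) (use le[of "scl E (-1) d"] f d in \<open>auto simp: A_def\<close>)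
      show "P f ?g" using le f by (auto simp: P_def A_def)
    qed
    from fun_cong[OF this, of x] have "f x = tilt f y x" using x by simp
    with tilt_le[OF sub x, of 1] x show ?thesis by (simp add: scl_one)
  qed
  have add: "f (add E x y) = f x + f y" if "x \<in> carr E" "y \<in> carr E" for x y
  proof (rule antisym)
    show "f (add E x y) \<le> f x + f y" using sub that unfolding sublinear_def by blast
  qed (rule ge[OF that])
  have neg: "f (scl E (-1) x) = - f x" if "x \<in> carr E" for x
    using add[of x "scl E (-1) x"] that sublinear_zer[OF sub] by (simp add: add_neg)
  have pos: "f (scl E (of_real r) x) = r * f x" if x: "x \<in> carr E" and r: "0 \<le> r" for r x
  proof -
    have le: "f (scl E (of_real r) y) \<le> r * f y" if "y \<in> carr E" for y
      using sub that r unfolding sublinear_def by simp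
    have "scl E (of_real r) (scl E (-1) x) = scl E (-1) (scl E (of_real r) x)"
      using x by (simp add: scl_scl)
    with le[of "scl E (-1) x"] le[OF x] x show ?thesis by (simp add: neg)
  qed
  show ?thesis
  proof
    show "f (scl E (of_real r) x) = r * f x" if x: "x \<in> carr E" for r x
    proof (cases "0 \<le> r")
      case False
      have "scl E (of_real r) x = scl E (-1) (scl E (of_real (- r)) x)"
        using x by (simp add: scl_scl)
      with False x show ?thesis using pos[of x "- r"] by (simp add: neg)
    qed (use pos x in simp)
    show "\<bar>f x\<bar> \<le> nrm E x" if "x \<in> carr E" for x
      using sub that sublinear_ge_nrm[OF sub that] unfolding sublinear_def by (auto simp: abs_le_iff)
    have "nrm E d \<le> f d" using f neg[OF d] by (simp add: A_def)
    moreover have "f d \<le> nrm E d" using sub d by (simp add: sublinear_def)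
    ultimately show "f d = nrm E d" by simp
  qed (use add in auto)
qed

text \<open>If the scalars have a square root \<open>j\<close> of \<open>-1\<close>, the real functional \<open>u\<close> is made linear
  over them by \<open>F x = u x - j u (j x)\<close>. The norm of the scalar field is multiplicative but is not
  known to be the Euclidean one, so \<open>norm (F d)\<close> is only known to be at least half of \<open>nrm E d\<close>;
  rescaling \<open>F\<close> accounts for the factor 4.\<close>

lemma Hahn_Banach:
  assumes d: "d \<in> carr E"
  obtains f :: "'a \<Rightarrow> 'k" where
    "\<And>x y. \<lbrakk>x \<in> carr E; y \<in> carr E\<rbrakk> \<Longrightarrow> f (add E x y) = f x + f y"
    "\<And>a x. x \<in> carr E \<Longrightarrow> f (scl E a x) = a * f x"
    "\<And>x. x \<in> carr E \<Longrightarrow> norm (f x) \<le> 4 * nrm E x" "f d = of_real (nrm E d)"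
proof -
  obtain u where u: "\<And>x y. \<lbrakk>x \<in> carr E; y \<in> carr E\<rbrakk> \<Longrightarrow> u (add E x y) = u x + u y"
    "\<And>r x. x \<in> carr E \<Longrightarrow> u (scl E (of_real r) x) = r * u x"
    "\<And>x. x \<in> carr E \<Longrightarrow> \<bar>u x\<bar> \<le> nrm E x" "u d = nrm E d"
    using real_Hahn_Banach[OF d] by metis
  show ?thesis
  proof (cases rule: real_normed_field_cases[where 'k = 'k])
    case real
    show ?thesis
    proof (rule that[of "\<lambda>x. of_real (u x)"])
      fix a :: 'k and x assume x: "x \<in> carr E"
      obtain r where "a = of_real r" using real[of a] by (rule Reals_cases)
      with x show "of_real (u (scl E a x)) = a * of_real (u x)" by (simp add: u)
    next
      fix x assume x: "x \<in> carr E"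
      show "norm (of_real (u x) :: 'k) \<le> 4 * nrm E x" using u(3)[OF x] nrm_nonneg[OF x] by simp
    qed (simp_all add: u)
  next
    case (complex j)
    have j: "norm j = 1"
    proof -
      have "(norm j)\<^sup>2 = 1" using complex(1) by (metis norm_minus_cancel norm_one norm_power)
      then show ?thesis by (simp add: abs_square_eq_1)
    qed
    define F :: "'a \<Rightarrow> 'k" where "F x = of_real (u x) - j * of_real (u (scl E j x))" for x
    have F_add: "F (add E x y) = F x + F y" if "x \<in> carr E" "y \<in> carr E" for x y
      using that by (simp add: F_def scl_add_right u algebra_simps)
    have F_real: "F (scl E (of_real r) x) = of_real r * F x" if x: "x \<in> carr E" for r x
    proof -
      have "scl E j (scl E (of_real r) x) = scl E (of_real r) (scl E j x)"
        using x by (simp add: scl_scl mult.commute)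
      then show ?thesis using x by (simp add: F_def u algebra_simps)
    qed
    have F_j: "F (scl E j x) = j * F x" if x: "x \<in> carr E" for x
    proof -
      have jj: "j * j = -1" using complex(1) by (simp add: power2_eq_square)
      have "scl E j (scl E j x) = scl E (of_real (-1)) x" using x jj by (simp add: scl_scl)
      then have "u (scl E j (scl E j x)) = - u x" using u(2)[OF x, of "-1"] by simp
      then show ?thesis using jj by (simp add: F_def right_diff_distrib flip: mult.assoc)
    qed
    have F_scl: "F (scl E a x) = a * F x" if x: "x \<in> carr E" for a x
    proof -
      obtain r s where a: "a = of_real r + of_real s * j" using complex(2) by blast
      have "scl E a x = add E (scl E (of_real r) x) (scl E (of_real s) (scl E j x))"
        using x by (simp add: a scl_add_left scl_scl)
      then show ?thesis using x by (simp add: F_add F_real F_j a algebra_simps)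
    qed
    have F_le: "norm (F x) \<le> 2 * nrm E x" if x: "x \<in> carr E" for x
    proof -
      have "norm (F x) \<le> \<bar>u x\<bar> + \<bar>u (scl E j x)\<bar>"
        unfolding F_def using norm_triangle_ineq4[of "of_real (u x)" "j * of_real (u (scl E j x))"]
        by (simp add: norm_mult j)
      with u(3)[OF x] u(3)[of "scl E j x"] x show ?thesis by (simp add: nrm_scl j)
    qed
    define n s where "n = nrm E d" and "s = u (scl E j d)"
    have n: "0 \<le> n" using d by (simp add: n_def nrm_nonneg)
    have Fd: "F d = of_real n - j * of_real s" by (simp add: F_def u n_def s_def)
    have Fd_ge: "n \<le> 2 * norm (F d)"
    proof (cases "n = 0")
      case False
      have "F d * (of_real n + j * of_real s) = of_real (n\<^sup>2 + s\<^sup>2)"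
      proof -
        have "F d * (of_real n + j * of_real s) = of_real n ^ 2 - j\<^sup>2 * of_real s ^ 2"
          by (simp add: Fd power2_eq_square algebra_simps)
        then show ?thesis by (simp add: complex(1))
      qed
      then have "norm (F d) * norm (of_real n + j * of_real s) = n\<^sup>2 + s\<^sup>2"
        by (metis norm_mult norm_of_real abs_of_nonneg sum_power2_ge_zero)
      moreover have "norm (of_real n + j * of_real s) \<le> n + \<bar>s\<bar>"
        using norm_triangle_ineq[of "of_real n" "j * of_real s"] n by (simp add: norm_mult j)
      ultimately have "n\<^sup>2 + s\<^sup>2 \<le> norm (F d) * (n + \<bar>s\<bar>)"
        by (metis mult_left_mono norm_ge_zero)
      moreover have "n * (n + \<bar>s\<bar>) \<le> 2 * (n\<^sup>2 + s\<^sup>2)"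
      proof -
        have "0 \<le> n * \<bar>s\<bar>" using n by simp
        then have "n * \<bar>s\<bar> \<le> n\<^sup>2 + s\<^sup>2"
          using sum_squares_bound[of n "\<bar>s\<bar>"] unfolding power2_abs by linarith
        then show ?thesis
          using zero_le_power2[of s] unfolding power2_eq_square distrib_left by linarith
      qed
      ultimately have "n * (n + \<bar>s\<bar>) \<le> 2 * norm (F d) * (n + \<bar>s\<bar>)" by simp
      then show ?thesis by (rule mult_right_le_imp_le) (use False n in linarith)
    qed simp
    show ?thesis
    proof (cases "n = 0")
      case True
      have "F d = 0" using F_le[OF d] True by (simp add: n_def)
      then show ?thesis
      proof (intro that[of F])
        fix x assume "x \<in> carr E"
        then show "norm (F x) \<le> 4 * nrm E x" using F_le[of x] nrm_nonneg[of x] by simp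
      qed (use True F_add F_scl in \<open>auto simp: n_def\<close>)
    next
      case False
      then have pos: "0 < norm (F d)" using Fd_ge n by linarith
      show ?thesis
      proof (rule that[of "\<lambda>x. of_real n / F d * F x"])
        fix x assume x: "x \<in> carr E"
        have "n * norm (F x) \<le> (2 * norm (F d)) * (2 * nrm E x)"
          by (rule mult_mono) (use Fd_ge F_le[OF x] n in auto)
        then show "norm (of_real n / F d * F x) \<le> 4 * nrm E x"
          using pos n by (simp add: norm_mult norm_divide field_simps)
      qed (use pos F_add F_scl in \<open>auto simp: n_def algebra_simps add_divide_distrib\<close>)
    qed
  qed
qed

end

section \<open>Limits, series and finite dimension\<close>

definition converges_to :: "('k::{real_normed_field,banach}, 'a) nspace \<Rightarrow> (nat \<Rightarrow> 'a) \<Rightarrow> 'a \<Rightarrow> bool" where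
  "converges_to E s l \<longleftrightarrow> (\<lambda>n. nrm E (vdiff E (s n) l)) \<longlonglongrightarrow> 0"

primrec psum :: "('k::{real_normed_field,banach}, 'a) nspace \<Rightarrow> (nat \<Rightarrow> 'a) \<Rightarrow> nat \<Rightarrow> 'a" where
  "psum E v 0 = zer E"
| "psum E v (Suc n) = add E (psum E v n) (v n)"

lemma subsp_simps [simp]:
  "carr (subsp E M) = M" "zer (subsp E M) = zer E" "add (subsp E M) = add E"
  "scl (subsp E M) = scl E" "nrm (subsp E M) = nrm E"
  by (simp_all add: subsp_def)

lemma vdiff_subsp [simp]: "vdiff (subsp E M) = vdiff E"
  by (simp add: vdiff_def fun_eq_iff)

lemma psum_subsp [simp]: "psum (subsp E M) v n = psum E v n"
  by (induction n) simp_all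

lemma lin_subspaceD:
  assumes "lin_subspace E M"
  shows "x \<in> M \<Longrightarrow> x \<in> carr E" "zer E \<in> M" "\<lbrakk>x \<in> M; y \<in> M\<rbrakk> \<Longrightarrow> add E x y \<in> M"
    "x \<in> M \<Longrightarrow> scl E a x \<in> M" "\<lbrakk>x \<in> M; y \<in> M\<rbrakk> \<Longrightarrow> vdiff E x y \<in> M"
  using assms by (auto simp: lin_subspace_def vdiff_def)

lemma lin_subspace_psum:
  "\<lbrakk>lin_subspace E M; \<And>k. k < n \<Longrightarrow> v k \<in> M\<rbrakk> \<Longrightarrow> psum E v n \<in> M"
  by (induction n) (simp_all add: lin_subspaceD)

lemma lin_subspace_subsp: "\<lbrakk>lin_subspace E M; N \<subseteq> M\<rbrakk> \<Longrightarrow> lin_subspace (subsp E M) N \<longleftrightarrow> lin_subspace E N"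
  by (auto simp: lin_subspace_def)

lemma subsp_subsp [simp]: "subsp (subsp E M) N = subsp E N"
  by (simp add: subsp_def)

lemma operatorD:
  assumes "operator E F T"
  shows "x \<in> carr E \<Longrightarrow> T x \<in> carr F"
    "\<lbrakk>x \<in> carr E; y \<in> carr E\<rbrakk> \<Longrightarrow> T (add E x y) = add F (T x) (T y)"
    "x \<in> carr E \<Longrightarrow> T (scl E a x) = scl F a (T x)"
  using assms by (auto simp: operator_def)

lemma operatorI:
  assumes "\<And>x. x \<in> carr E \<Longrightarrow> T x \<in> carr F"
    "\<And>x y. \<lbrakk>x \<in> carr E; y \<in> carr E\<rbrakk> \<Longrightarrow> T (add E x y) = add F (T x) (T y)"
    "\<And>a x. x \<in> carr E \<Longrightarrow> T (scl E a x) = scl F a (T x)"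
    "\<And>x. x \<in> carr E \<Longrightarrow> nrm F (T x) \<le> C * nrm E x"
  shows "operator E F T"
  using assms unfolding operator_def by blast

lemma operator_bound:
  assumes "normed_space E" "operator E F T"
  obtains C where "0 < C" "\<And>x. x \<in> carr E \<Longrightarrow> nrm F (T x) \<le> C * nrm E x"
proof -
  obtain C where C: "\<And>x. x \<in> carr E \<Longrightarrow> nrm F (T x) \<le> C * nrm E x"
    using assms(2) unfolding operator_def by blast
  have "nrm F (T x) \<le> max 1 C * nrm E x" if "x \<in> carr E" for x
    using C[OF that] mult_right_mono[of C "max 1 C" "nrm E x"] normed_space.nrm_nonneg[OF assms(1) that]
    by simp
  then show ?thesis using that[of "max 1 C"] by simp
qed

lemma operator_comp:
  assumes "normed_space E" "normed_space F" "operator E F T" "operator F G S"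
  shows "operator E G (\<lambda>x. S (T x))"
proof -
  obtain C where C: "0 < C" "\<And>x. x \<in> carr E \<Longrightarrow> nrm F (T x) \<le> C * nrm E x"
    using operator_bound[OF assms(1,3)] by metis
  obtain D where D: "0 < D" "\<And>x. x \<in> carr F \<Longrightarrow> nrm G (S x) \<le> D * nrm F x"
    using operator_bound[OF assms(2,4)] by metis
  show ?thesis
  proof (rule operatorI)
    fix x assume x: "x \<in> carr E"
    have "nrm G (S (T x)) \<le> D * nrm F (T x)" using D operatorD[OF assms(3)] x by simp
    also have "\<dots> \<le> D * (C * nrm E x)" using C x D by simp
    finally show "nrm G (S (T x)) \<le> (D * C) * nrm E x" by simp
  qed (simp_all add: operatorD[OF assms(3)] operatorD[OF assms(4)])
qed

lemma operator_zer:
  assumes "normed_space E" "normed_space F" "operator E F T"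
  shows "T (zer E) = zer F"
proof -
  interpret E: normed_space E by fact
  interpret F: normed_space F by fact
  show ?thesis
    using operatorD(3)[OF assms(3), of "zer E" 0] operatorD(1)[OF assms(3), of "zer E"] by simp
qed

lemma operator_vdiff:
  assumes "normed_space E" "operator E F T" "x \<in> carr E" "y \<in> carr E"
  shows "T (vdiff E x y) = vdiff F (T x) (T y)"
  using assms normed_space.scl_closed[OF assms(1)] by (simp add: vdiff_def operatorD[OF assms(2)])

lemma operator_psum:
  assumes "normed_space E" "normed_space F" "operator E F T" "\<And>k. v k \<in> carr E"
  shows "T (psum E v n) = psum F (\<lambda>k. T (v k)) n"
proof (induction n)
  case (Suc n)
  interpret E: normed_space E by fact
  have "psum E v n \<in> carr E" by (induction n) (use assms(4) in auto)
  with Suc assms show ?case by (simp add: operatorD[OF assms(3)])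
qed (use operator_zer[OF assms(1-3)] in simp)

lemma operator_into_subsp:
  "\<lbrakk>operator E F T; \<And>x. x \<in> carr E \<Longrightarrow> T x \<in> R\<rbrakk> \<Longrightarrow> operator E (subsp F R) T"
  by (simp add: operator_def)

lemma operator_from_subsp:
  "\<lbrakk>operator E (subsp F R) T; R \<subseteq> carr F\<rbrakk> \<Longrightarrow> operator E F T"
  by (auto simp: operator_def)

lemma lin_subspace_image:
  assumes "normed_space E" "normed_space F" "operator E F T" "lin_subspace E M"
  shows "lin_subspace F (T ` M)"
  unfolding lin_subspace_def
proof (intro conjI ballI allI)
  note M = lin_subspaceD[OF assms(4)] and T = operatorD[OF assms(3)]
  show "T ` M \<subseteq> carr F" using M(1) T(1) by auto
  show "zer F \<in> T ` M"
    by (rule image_eqI[of _ _ "zer E"]) (simp_all add: operator_zer[OF assms(1-3)] M(2))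
  fix x assume "x \<in> T ` M"
  then obtain u where u: "u \<in> M" "x = T u" by auto
  show "scl F a x \<in> T ` M" for a
    by (rule image_eqI[of _ _ "scl E a u"]) (simp_all add: u M T)
  fix y assume "y \<in> T ` M"
  then obtain v where v: "v \<in> M" "y = T v" by auto
  show "add F x y \<in> T ` M"
    by (rule image_eqI[of _ _ "add E u v"]) (simp_all add: u v M T)
qed

lemma normed_space_subsp:
  assumes "normed_space E" "lin_subspace E M"
  shows "normed_space (subsp E M)"
proof -
  interpret normed_space E by fact
  note M = lin_subspaceD[OF assms(2)]
  show ?thesis
    by unfold_locales
      (auto simp: M add_zer add_neg scl_one scl_scl scl_add_left scl_add_right nrm_nonneg nrm_eq_0
        nrm_scl nrm_triangle add_assoc add_commute add_left_commute)
qed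

context normed_space
begin

lemma psum_closed [simp]: "(\<And>k. v k \<in> carr E) \<Longrightarrow> psum E v n \<in> carr E"
  by (induction n) auto

lemma psum_cong: "(\<And>k. k < n \<Longrightarrow> v k = w k) \<Longrightarrow> psum E v n = psum E w n"
  by (induction n) auto

lemma psum_add:
  "\<lbrakk>\<And>k. v k \<in> carr E; \<And>k. w k \<in> carr E\<rbrakk> \<Longrightarrow>
    psum E (\<lambda>k. add E (v k) (w k)) n = add E (psum E v n) (psum E w n)"
  by (induction n) (simp_all add: add_zer add_assoc add_left_commute)

lemma psum_scl: "(\<And>k. v k \<in> carr E) \<Longrightarrow> psum E (\<lambda>k. scl E a (v k)) n = scl E a (psum E v n)"
  by (induction n) (simp_all add: scl_add_right)

lemma psum_zer [simp]: "psum E (\<lambda>k. zer E) n = zer E"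
  by (induction n) (simp_all add: add_zer)

lemma nrm_psum_le: "(\<And>k. v k \<in> carr E) \<Longrightarrow> nrm E (psum E v n) \<le> (\<Sum>k<n. nrm E (v k))"
proof (induction n)
  case (Suc n)
  then show ?case using nrm_triangle[of "psum E v n" "v n"] by simp
qed simp

lemma psum_single:
  assumes "\<And>k. v k \<in> carr E" "m < n" "\<And>k. \<lbrakk>k < n; k \<noteq> m\<rbrakk> \<Longrightarrow> v k = zer E"
  shows "psum E v n = v m"
proof -
  have "psum E v k = (if m < k then v m else zer E)" if "k \<le> n" for k
    using that
  proof (induction k)
    case (Suc k)
    then show ?case using assms(1)[of m] assms(3)[of k] by (auto simp: less_Suc_eq add_zer)
  qed simp
  then show ?thesis using assms(2) by simp
qed

lemma nrm_psum_ge: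
  assumes v: "\<And>k. v k \<in> carr E"
  shows "j < n \<Longrightarrow> nrm E (v j) \<le> nrm E (psum E v n) + (\<Sum>k\<in>{..<n} - {j}. nrm E (v k))"
proof (induction n)
  case (Suc n)
  have diff: "vdiff E (psum E v (Suc n)) (v n) = psum E v n"
    "vdiff E (psum E v (Suc n)) (psum E v n) = v n" using v by simp_all
  show ?case
  proof (cases "j = n")
    case True
    have "nrm E (v n) \<le> nrm E (psum E v (Suc n)) + nrm E (psum E v n)"
      using nrm_vdiff_le[of "psum E v (Suc n)" "psum E v n"] diff(2) v by (simp only: psum_closed)
    moreover have "{..<Suc n} - {j} = {..<n}" using True by auto
    ultimately show ?thesis using nrm_psum_le[of v n] v True by simp
  next
    case False
    have "nrm E (psum E v n) \<le> nrm E (psum E v (Suc n)) + nrm E (v n)"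
      using nrm_vdiff_le[of "psum E v (Suc n)" "v n"] diff(1) v by (simp only: psum_closed)
    moreover have "{..<Suc n} - {j} = insert n ({..<n} - {j})" using False by auto
    ultimately show ?thesis using Suc False by simp
  qed
qed simp

lemma psum_pad:
  "\<lbrakk>m \<le> n; \<And>k. v k \<in> carr E\<rbrakk> \<Longrightarrow> psum E (\<lambda>k. if k < m then v k else zer E) n = psum E v m"
proof (induction n)
  case (Suc n)
  show ?case
  proof (cases "m = Suc n")
    case True
    have "psum E (\<lambda>k. if k < Suc n then v k else zer E) (Suc n) = psum E v (Suc n)"
      by (rule psum_cong) simp
    with True show ?thesis by simp
  next
    case False
    with Suc show ?thesis by (simp add: add_zer)
  qed
qed simp

lemma converges_to_unique:
  assumes "converges_to E s l" "converges_to E s l'" "\<And>n. s n \<in> carr E" "l \<in> carr E" "l' \<in> carr E"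
  shows "l = l'"
proof -
  have "(\<lambda>n. nrm E (vdiff E (s n) l) + nrm E (vdiff E (s n) l')) \<longlonglongrightarrow> 0 + 0"
    using assms(1,2) unfolding converges_to_def by (intro tendsto_add)
  moreover have "nrm E (vdiff E l l') \<le> nrm E (vdiff E (s n) l) + nrm E (vdiff E (s n) l')" for n
    using nrm_vdiff_triangle[of l "s n" l'] nrm_vdiff_commute[of l "s n"] assms by simp
  ultimately have "nrm E (vdiff E l l') \<le> 0"
    by (intro LIMSEQ_le_const) auto
  then show ?thesis
    using nrm_nonneg[of "vdiff E l l'"] nrm_eq_0[of "vdiff E l l'"] vdiff_eq_zer[of l l'] assms by simp
qed

lemma converges_to_bound:
  assumes "converges_to E s l" "\<And>n. s n \<in> carr E" "l \<in> carr E" "\<And>n. nrm E (s n) \<le> B"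
  shows "nrm E l \<le> B"
proof (rule LIMSEQ_le_const)
  show "(\<lambda>n. B + nrm E (vdiff E (s n) l)) \<longlonglongrightarrow> B"
    using tendsto_add[OF tendsto_const assms(1)[unfolded converges_to_def], of B] by simp
  have "nrm E l \<le> B + nrm E (vdiff E (s n) l)" for n
    using nrm_le_vdiff[OF assms(3) assms(2)[of n]] nrm_vdiff_commute[OF assms(3) assms(2)[of n]]
      assms(4)[of n] by linarith
  then show "\<exists>N. \<forall>n\<ge>N. nrm E l \<le> B + nrm E (vdiff E (s n) l)" by blast
qed

lemma converges_to_add:
  assumes "converges_to E s l" "converges_to E t m"
    "\<And>n. s n \<in> carr E" "\<And>n. t n \<in> carr E" "l \<in> carr E" "m \<in> carr E"
  shows "converges_to E (\<lambda>n. add E (s n) (t n)) (add E l m)"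
  unfolding converges_to_def
proof (rule Lim_null_comparison)
  show "(\<lambda>n. nrm E (vdiff E (s n) l) + nrm E (vdiff E (t n) m)) \<longlonglongrightarrow> 0"
    using tendsto_add[OF assms(1,2)[unfolded converges_to_def]] by simp
  show "\<forall>\<^sub>F n in sequentially. norm (nrm E (vdiff E (add E (s n) (t n)) (add E l m)))
      \<le> nrm E (vdiff E (s n) l) + nrm E (vdiff E (t n) m)"
    using assms by (intro always_eventually) (simp add: vdiff_add_add nrm_nonneg nrm_triangle)
qed

lemma converges_to_operator:
  assumes F: "normed_space F" and T: "operator E F T"
    and "converges_to E s l" "\<And>n. s n \<in> carr E" "l \<in> carr E"
  shows "converges_to F (\<lambda>n. T (s n)) (T l)"
  unfolding converges_to_def
proof -
  obtain C where C: "0 < C" "\<And>x. x \<in> carr E \<Longrightarrow> nrm F (T x) \<le> C * nrm E x"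
    using operator_bound[OF normed_space_axioms T] by metis
  show "(\<lambda>n. nrm F (vdiff F (T (s n)) (T l))) \<longlonglongrightarrow> 0"
  proof (rule Lim_null_comparison)
    show "(\<lambda>n. C * nrm E (vdiff E (s n) l)) \<longlonglongrightarrow> 0"
      using tendsto_mult_left[OF assms(3)[unfolded converges_to_def], of C] by simp
    have "vdiff F (T (s n)) (T l) = T (vdiff E (s n) l)" for n
      using operator_vdiff[OF normed_space_axioms T] assms by simp
    then show "\<forall>\<^sub>F n in sequentially. norm (nrm F (vdiff F (T (s n)) (T l))) \<le> C * nrm E (vdiff E (s n) l)"
      using C(2) assms normed_space.nrm_nonneg[OF F] operatorD(1)[OF T]
      by (intro always_eventually) simp
  qed
qed

lemma converges_to_iff_limitin:
  assumes "\<And>n. s n \<in> carr E" "l \<in> carr E"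
  shows "converges_to E s l \<longleftrightarrow> limitin mtopology s l sequentially"
  using assms by (simp add: limitin_metric_dist_null converges_to_def ndist_def)

lemma closed_subspaceD:
  assumes "closed_subspace E M"
  shows "lin_subspace E M"
    and "\<lbrakk>converges_to E s l; \<And>n. s n \<in> M; l \<in> carr E\<rbrakk> \<Longrightarrow> l \<in> M"
proof -
  show M: "lin_subspace E M" using assms by (simp add: closed_subspace_def)
  show "l \<in> M" if "converges_to E s l" "\<And>n. s n \<in> M" "l \<in> carr E"
  proof -
    have "limitin mtopology s l sequentially"
      using that converges_to_iff_limitin lin_subspaceD(1)[OF M] by blast
    then show ?thesis
      using assms that(2) unfolding closed_subspace_def metric_closedin_iff_sequentially_closed by blast
  qed
qed

lemma closed_subspaceI:
  assumes M: "lin_subspace E M"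
    and closed: "\<And>s l. \<lbrakk>converges_to E s l; \<And>n. s n \<in> M; l \<in> carr E\<rbrakk> \<Longrightarrow> l \<in> M"
  shows "closed_subspace E M"
  unfolding closed_subspace_def metric_closedin_iff_sequentially_closed
proof (intro conjI allI impI M)
  show "M \<subseteq> carr E" using M by (simp add: lin_subspace_def)
  fix s l assume sl: "range s \<subseteq> M \<and> limitin mtopology s l sequentially"
  then have l: "l \<in> carr E" by (simp add: limitin_metric_dist_null)
  have s: "s n \<in> M" for n using sl by blast
  have "converges_to E s l"
    using converges_to_iff_limitin[of s l] sl l s lin_subspaceD(1)[OF M] by blast
  then show "l \<in> M" by (rule closed[OF _ s l])
qed

lemma closed_subspace_near:
  assumes "closed_subspace E M" "x \<in> carr E" "\<And>e. 0 < e \<Longrightarrow> \<exists>y\<in>M. nrm E (vdiff E x y) < e"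
  shows "x \<in> M"
proof -
  have "\<exists>y. y \<in> M \<and> nrm E (vdiff E x y) < 1 / Suc k" for k
    using assms(3)[of "1 / Suc k"] by auto
  then have "\<exists>y. \<forall>k. y k \<in> M \<and> nrm E (vdiff E x (y k)) < 1 / Suc k"
    by (intro choice allI)
  then obtain y where y: "\<And>k. y k \<in> M" "\<And>k. nrm E (vdiff E x (y k)) < 1 / Suc k" by blast
  have yE: "y k \<in> carr E" for k by (rule lin_subspaceD(1)[OF closed_subspaceD(1)[OF assms(1)] y(1)])
  have "converges_to E y x"
    unfolding converges_to_def
  proof (rule Lim_null_comparison)
    show "(\<lambda>k. 1 / real (Suc k)) \<longlonglongrightarrow> 0" by (rule lim_1_over_real_power[of 1, simplified, THEN LIMSEQ_Suc])
    show "\<forall>\<^sub>F k in sequentially. norm (nrm E (vdiff E (y k) x)) \<le> 1 / real (Suc k)"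
      using y(2) yE assms(2) by (intro always_eventually) (simp add: nrm_nonneg nrm_vdiff_commute less_imp_le)
  qed
  then show ?thesis by (rule closed_subspaceD(2)[OF assms(1)]) (use y assms in auto)
qed

lemma closure_subspace:
  assumes S: "lin_subspace E S"
  obtains W where "closed_subspace E W" "S \<subseteq> W"
    "\<And>x e. \<lbrakk>x \<in> W; 0 < e\<rbrakk> \<Longrightarrow> \<exists>y\<in>S. nrm E (vdiff E x y) < e"
proof -
  define W where "W = {x \<in> carr E. \<forall>e>0. \<exists>y\<in>S. nrm E (vdiff E x y) < e}"
  note S' = lin_subspaceD[OF S]
  have near: "\<exists>y\<in>S. nrm E (vdiff E x y) < e" if "x \<in> W" "0 < e" for x e
    using that by (simp add: W_def)
  have SW: "S \<subseteq> W" using S' by (force simp: W_def)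
  have "closed_subspace E W"
  proof (rule closed_subspaceI)
    show "lin_subspace E W"
      unfolding lin_subspace_def
    proof (intro conjI ballI allI)
      show "zer E \<in> W" using SW S' by blast
      fix x assume x: "x \<in> W"
      show "add E x y \<in> W" if y: "y \<in> W" for y
        unfolding W_def
      proof (intro CollectI conjI allI impI)
        fix e :: real assume e: "0 < e"
        then obtain x' where x': "x' \<in> S" "nrm E (vdiff E x x') < e / 2"
          using near[OF x, of "e / 2"] by auto
        obtain y' where y': "y' \<in> S" "nrm E (vdiff E y y') < e / 2"
          using near[OF y, of "e / 2"] e by auto
        have "nrm E (vdiff E (add E x y) (add E x' y')) < e"
          using nrm_triangle[of "vdiff E x x'" "vdiff E y y'"] x y x' y' S'
          by (simp add: vdiff_add_add W_def)
        then show "\<exists>z\<in>S. nrm E (vdiff E (add E x y) z) < e" using S' x' y' by blast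
      qed (use x y in \<open>simp add: W_def\<close>)
      show "scl E a x \<in> W" for a
        unfolding W_def
      proof (intro CollectI conjI allI impI)
        fix e :: real assume e: "0 < e"
        then have "0 < e / (norm a + 1)" by (simp add: add_nonneg_pos)
        then obtain x' where x': "x' \<in> S" "nrm E (vdiff E x x') < e / (norm a + 1)"
          using near[OF x] by blast
        have "nrm E (vdiff E (scl E a x) (scl E a x')) = norm a * nrm E (vdiff E x x')"
          using x x' S' by (simp add: W_def nrm_scl flip: scl_vdiff)
        also have "\<dots> \<le> (norm a + 1) * nrm E (vdiff E x x')"
          using x x' S' by (simp add: W_def mult_right_mono nrm_nonneg)
        also have "\<dots> < e"
          using x'(2) by (simp add: pos_less_divide_eq add_nonneg_pos mult.commute)
        finally show "\<exists>z\<in>S. nrm E (vdiff E (scl E a x) z) < e" using S' x' by blast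
      qed (use x in \<open>simp add: W_def\<close>)
    qed (auto simp: W_def)
    fix s l assume s: "converges_to E s l" "\<And>n. s n \<in> W" "l \<in> carr E"
    have "\<exists>y\<in>S. nrm E (vdiff E l y) < e" if e: "0 < e" for e
    proof -
      have "\<forall>\<^sub>F n in sequentially. nrm E (vdiff E (s n) l) < e / 2"
        by (rule order_tendstoD(2)[OF s(1)[unfolded converges_to_def]]) (use e in simp)
      then obtain n where n: "nrm E (vdiff E (s n) l) < e / 2"
        by (meson eventually_happens' sequentially_bot)
      obtain y where y: "y \<in> S" "nrm E (vdiff E (s n) y) < e / 2"
        using near[OF s(2)[of n], of "e / 2"] e by auto
      have "nrm E (vdiff E l y) < e"
        using nrm_vdiff_triangle[of l "s n" y] nrm_vdiff_commute[of l "s n"] s(2)[of n] s(3) y n S'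
        by (simp add: W_def)
      with y show ?thesis by blast
    qed
    with s(3) show "l \<in> W" by (simp add: W_def)
  qed
  then show ?thesis using SW near by (rule that)
qed

end

lemma (in normed_space) banach_spaceI:
  assumes "\<And>s. \<lbrakk>\<And>n. s n \<in> carr E; \<And>e. 0 < e \<Longrightarrow> \<exists>N. \<forall>m\<ge>N. \<forall>n\<ge>N. nrm E (vdiff E (s m) (s n)) < e\<rbrakk>
    \<Longrightarrow> \<exists>l\<in>carr E. converges_to E s l"
  shows "banach_space E"
proof
  show mcomplete
    unfolding mcomplete_def
  proof (intro allI impI)
    fix s assume s: "MCauchy s"
    then have sE: "s n \<in> carr E" for n unfolding MCauchy_def by blast
    have "\<exists>N. \<forall>m\<ge>N. \<forall>n\<ge>N. nrm E (vdiff E (s m) (s n)) < e" if "0 < e" for e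
      using s that sE unfolding MCauchy_def by (simp add: ndist_def)
    with assms sE obtain l where "l \<in> carr E" "converges_to E s l" by blast
    with sE show "\<exists>l. limitin mtopology s l sequentially"
      using converges_to_iff_limitin by blast
  qed
qed

context banach_space
begin

lemma Cauchy_converges:
  assumes s: "\<And>n. s n \<in> carr E"
    and "\<And>e. 0 < e \<Longrightarrow> \<exists>N. \<forall>m\<ge>N. \<forall>n\<ge>N. nrm E (vdiff E (s m) (s n)) < e"
  shows "\<exists>l\<in>carr E. converges_to E s l"
proof -
  have "MCauchy s"
    unfolding MCauchy_def using assms by (auto simp: ndist_def)
  then obtain l where "limitin mtopology s l sequentially"
    using complete unfolding mcomplete_def by blast
  moreover from this have "l \<in> carr E" by (simp add: limitin_metric_dist_null)
  ultimately show ?thesis using converges_to_iff_limitin s by blast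
qed

lemma series_converges:
  assumes v: "\<And>k. v k \<in> carr E" "\<And>k. nrm E (v k) \<le> b k" and b: "summable b"
  shows "\<exists>l\<in>carr E. converges_to E (psum E v) l \<and> nrm E l \<le> suminf b"
proof -
  have b0: "0 \<le> b k" for k using v(2)[of k] nrm_nonneg[OF v(1)[of k]] by linarith
  have diff: "nrm E (vdiff E (psum E v (m + k)) (psum E v m)) \<le> (\<Sum>i=m..<m+k. b i)" for m k
  proof (induction k)
    case (Suc k)
    have "nrm E (vdiff E (psum E v (m + Suc k)) (psum E v (m + k))) \<le> b (m + k)"
      using v by simp
    moreover have "nrm E (vdiff E (psum E v (m + Suc k)) (psum E v m)) \<le>
        nrm E (vdiff E (psum E v (m + Suc k)) (psum E v (m + k))) +
        nrm E (vdiff E (psum E v (m + k)) (psum E v m))"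
      by (rule nrm_vdiff_triangle) (simp_all only: psum_closed v(1))
    ultimately show ?case using Suc by simp
  qed (use v in simp)
  have "\<exists>l\<in>carr E. converges_to E (psum E v) l"
  proof (rule Cauchy_converges)
    fix e :: real assume e: "0 < e"
    obtain N where N: "\<And>m n. N \<le> m \<Longrightarrow> norm (sum b {m..<n}) < e"
      using b e unfolding summable_Cauchy by blast
    have *: "nrm E (vdiff E (psum E v n) (psum E v m)) < e" if "N \<le> m" "m \<le> n" for m n
      using diff[of m "n - m"] N[OF that(1), of n] that by simp
    have "nrm E (vdiff E (psum E v m) (psum E v n)) < e" if "N \<le> m" "N \<le> n" for m n
      using *[of m n] *[of n m] that nrm_vdiff_commute[of "psum E v m" "psum E v n"] v(1)
      by (cases "m \<le> n") auto
    then show "\<exists>N. \<forall>m\<ge>N. \<forall>n\<ge>N. nrm E (vdiff E (psum E v m) (psum E v n)) < e" by blast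
  qed (use v in simp)
  then obtain l where l: "l \<in> carr E" "converges_to E (psum E v) l" by blast
  have "nrm E (psum E v n) \<le> suminf b" for n
  proof -
    have "nrm E (psum E v n) \<le> (\<Sum>k<n. b k)"
      using nrm_psum_le[of v n] v sum_mono[of "{..<n}" "\<lambda>k. nrm E (v k)" b] by force
    also have "\<dots> \<le> suminf b" by (rule sum_le_suminf[OF b]) (use b0 in auto)
    finally show ?thesis .
  qed
  then have "nrm E l \<le> suminf b" using converges_to_bound l v by simp
  with l show ?thesis by blast
qed

end

text \<open>Gaussian elimination: if the last equation involves some unknown \<open>p\<close>, solve it for \<open>p\<close> and
  substitute the result into the others.\<close>

lemma homogeneous_system:
  fixes c :: "'j \<Rightarrow> nat \<Rightarrow> 'k::field"
  assumes "finite J" "N < card J"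
  shows "\<exists>a. (\<exists>j\<in>J. a j \<noteq> 0) \<and> (\<forall>i<N. (\<Sum>j\<in>J. a j * c j i) = 0)"
  using assms
proof (induction N arbitrary: J c)
  case 0
  then obtain j where "j \<in> J" by fastforce
  then show ?case by (intro exI[of _ "\<lambda>_. 1"]) auto
next
  case (Suc N)
  show ?case
  proof (cases "\<forall>j\<in>J. c j N = 0")
    case True
    obtain a where "\<exists>j\<in>J. a j \<noteq> 0" "\<forall>i<N. (\<Sum>j\<in>J. a j * c j i) = 0"
      using Suc.IH[of J c] Suc.prems by auto
    with True show ?thesis by (intro exI[of _ a]) (auto simp: less_Suc_eq)
  next
    case False
    then obtain p where p: "p \<in> J" "c p N \<noteq> 0" by blast
    define J' where "J' = J - {p}"
    define c' where "c' j i = c j i - c j N / c p N * c p i" for j i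
    have J': "finite J'" "N < card J'" using Suc.prems p by (auto simp: J'_def)
    obtain a where a: "\<exists>j\<in>J'. a j \<noteq> 0" "\<forall>i<N. (\<Sum>j\<in>J'. a j * c' j i) = 0"
      using Suc.IH[OF J', of c'] by blast
    define a' where "a' j = (if j = p then - (\<Sum>j\<in>J'. a j * c j N) / c p N else a j)" for j
    have sum_a': "(\<Sum>j\<in>J. a' j * c j i) = (\<Sum>j\<in>J'. a j * c' j i)" for i
    proof -
      have "(\<Sum>j\<in>J. a' j * c j i) = a' p * c p i + (\<Sum>j\<in>J'. a' j * c j i)"
        using Suc.prems p by (simp add: J'_def sum.remove)
      also have "(\<Sum>j\<in>J'. a' j * c j i) = (\<Sum>j\<in>J'. a j * c j i)"
        by (rule sum.cong) (auto simp: a'_def J'_def)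
      also have "a' p * c p i = - (\<Sum>j\<in>J'. a j * (c j N / c p N * c p i))"
        by (simp add: a'_def sum_distrib_right sum_divide_distrib mult.assoc)
      finally show ?thesis by (simp add: c'_def right_diff_distrib sum_subtractf)
    qed
    have "c' j N = 0" for j using p by (simp add: c'_def)
    with a(2) have "\<forall>i<Suc N. (\<Sum>j\<in>J. a' j * c j i) = 0"
      by (auto simp: sum_a' less_Suc_eq)
    moreover have "\<exists>j\<in>J. a' j \<noteq> 0" using a(1) by (auto simp: a'_def J'_def)
    ultimately show ?thesis by blast
  qed
qed

text \<open>This is the form in which infinite dimension is verified later: it suffices to exhibit a
  single sequence all of whose finite linear relations are trivial.\<close>

lemma finite_dim_dependent:
  fixes E :: "('k::{real_normed_field,banach}, 'b) nspace"
  assumes E: "normed_space E" and "finite_dim E"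
  obtains n where "\<And>v. (\<And>j. v j \<in> carr E) \<Longrightarrow>
    \<exists>a. (\<exists>j<n. a j \<noteq> 0) \<and> psum E (\<lambda>j. scl E (a j) (v j)) n = zer E"
proof -
  interpret normed_space E by fact
  obtain B where B: "finite B" "B \<subseteq> carr E" "lspan E B = carr E"
    using assms(2) by (auto simp: finite_dim_def)
  obtain b and N :: nat where b: "B = b ` {..<N}"
    using B(1) by (metis finite_imp_nat_seg_image_inj_on lessThan_def)
  define b' where "b' i = (if i < N then b i else zer E)" for i
  have b': "b' i \<in> carr E" for i using B(2) by (auto simp: b'_def b)
  define L where "L = {psum E (\<lambda>i. scl E (c i) (b' i)) N | c. True}"
  have "lin_subspace E L"
    unfolding lin_subspace_def
  proof (intro conjI ballI allI)
    show "L \<subseteq> carr E" by (auto simp: L_def b')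
    have "psum E (\<lambda>i. scl E 0 (b' i)) N \<in> L" unfolding L_def by (intro CollectI exI[of _ "\<lambda>_. 0"]) simp
    then show "zer E \<in> L" by (simp add: b')
    fix x assume "x \<in> L"
    then obtain c where c: "x = psum E (\<lambda>i. scl E (c i) (b' i)) N" by (auto simp: L_def)
    show "scl E a x \<in> L" for a
      unfolding L_def by (intro CollectI exI[of _ "\<lambda>i. a * c i"]) (simp add: c b' scl_scl flip: psum_scl)
    fix y assume "y \<in> L"
    then obtain d where d: "y = psum E (\<lambda>i. scl E (d i) (b' i)) N" by (auto simp: L_def)
    show "add E x y \<in> L"
      unfolding L_def
      by (intro CollectI exI[of _ "\<lambda>i. c i + d i"]) (simp add: c d b' scl_add_left flip: psum_add)
  qed
  moreover have "B \<subseteq> L"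
  proof
    fix x assume "x \<in> B"
    then obtain m where m: "m < N" "x = b' m" by (auto simp: b b'_def)
    have "psum E (\<lambda>i. scl E (of_bool (i = m)) (b' i)) N = x"
      using psum_single[of "\<lambda>i. scl E (of_bool (i = m)) (b' i)" m N] m b' by (simp add: scl_one)
    then show "x \<in> L" by (auto simp: L_def)
  qed
  ultimately have "carr E \<subseteq> L" using B(3) unfolding lspan_def by blast
  then have rep: "\<exists>c. x = psum E (\<lambda>i. scl E (c i) (b' i)) N" if "x \<in> carr E" for x
    using that by (auto simp: L_def)
  show ?thesis
  proof (rule that[of "Suc N"])
    fix v :: "nat \<Rightarrow> 'b" assume "\<And>j. v j \<in> carr E"
    with rep have "\<exists>c. v j = psum E (\<lambda>i. scl E (c i) (b' i)) N" for j by blast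
    then have "\<exists>c. \<forall>j. v j = psum E (\<lambda>i. scl E (c j i) (b' i)) N"
      by (intro choice allI)
    then obtain c where c: "\<And>j. v j = psum E (\<lambda>i. scl E (c j i) (b' i)) N" by blast
    obtain a where a: "\<exists>j\<in>{..<Suc N}. a j \<noteq> 0" "\<forall>i<N. (\<Sum>j<Suc N. a j * c j i) = 0"
      using homogeneous_system[of "{..<Suc N}" N c] by auto
    have "psum E (\<lambda>j. scl E (a j) (v j)) n = psum E (\<lambda>i. scl E (\<Sum>j<n. a j * c j i) (b' i)) N" for n
    proof (induction n)
      case (Suc n)
      have "scl E (a n) (v n) = psum E (\<lambda>i. scl E (a n * c n i) (b' i)) N"
        by (simp add: c b' scl_scl flip: psum_scl)
      with Suc show ?case by (simp add: b' scl_add_left flip: psum_add)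
    qed (simp add: b')
    also have "psum E (\<lambda>i. scl E (\<Sum>j<Suc N. a j * c j i) (b' i)) N = psum E (\<lambda>i. zer E) N"
      by (rule psum_cong) (use a(2) b' in simp)
    finally have "psum E (\<lambda>j. scl E (a j) (v j)) (Suc N) = zer E" by simp
    with a(1) show "\<exists>a. (\<exists>j<Suc N. a j \<noteq> 0) \<and> psum E (\<lambda>j. scl E (a j) (v j)) (Suc N) = zer E"
      by blast
  qed
qed

lemma finite_dim_image:
  assumes "finite_dim E" and F: "normed_space F"
    and T: "\<And>x y. \<lbrakk>x \<in> carr E; y \<in> carr E\<rbrakk> \<Longrightarrow> T (add E x y) = add F (T x) (T y)"
      "\<And>a x. x \<in> carr E \<Longrightarrow> T (scl E a x) = scl F a (T x)"
    and E: "normed_space E" and onto: "T ` carr E = carr F"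
  shows "finite_dim F"
proof -
  interpret E: normed_space E by fact
  interpret F: normed_space F by fact
  obtain B where B: "finite B" "B \<subseteq> carr E" "lspan E B = carr E"
    using assms(1) by (auto simp: finite_dim_def)
  have "carr F \<subseteq> G" if G: "lin_subspace F G" "T ` B \<subseteq> G" for G
  proof -
    note G' = lin_subspaceD[OF G(1)]
    have T0: "T (zer E) = zer F"
    proof -
      have "T (zer E) \<in> carr F" unfolding onto[symmetric] by simp
      then show ?thesis using T(2)[of "zer E" 0] by simp
    qed
    have "lin_subspace E {y \<in> carr E. T y \<in> G}"
      unfolding lin_subspace_def using G' by (auto simp: T T0)
    with G(2) B have "carr E \<subseteq> {y \<in> carr E. T y \<in> G}" unfolding lspan_def by blast
    then show ?thesis unfolding onto[symmetric] by auto
  qed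
  moreover have "lin_subspace F (carr F)" by (simp add: lin_subspace_def)
  moreover have TB: "T ` B \<subseteq> carr F" unfolding onto[symmetric] using B(2) by (rule image_mono)
  ultimately have "lspan F (T ` B) = carr F" unfolding lspan_def by blast
  with B(1) TB show ?thesis unfolding finite_dim_def by blast
qed

section \<open>Isomorphisms, perturbations and complements\<close>

lemma bounded_below_isomorphism:
  assumes E: "normed_space E" and W: "lin_subspace E W" and T: "operator E F T"
    and c: "0 < c" "\<And>x. x \<in> W \<Longrightarrow> c * nrm E x \<le> nrm F (T x)"
  shows "isomorphism (subsp E W) (subsp F (T ` W)) T"
proof -
  interpret normed_space E by fact
  note W' = lin_subspaceD[OF W]
  obtain C where C: "0 < C" "\<And>x. x \<in> carr E \<Longrightarrow> nrm F (T x) \<le> C * nrm E x"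
    using operator_bound[OF E T] by metis
  have inj: "inj_on T W"
  proof (rule inj_onI)
    fix x y assume xy: "x \<in> W" "y \<in> W" "T x = T y"
    have "T (vdiff E x y) = T (zer E)"
      using xy W' operator_vdiff[OF E T, of x y] operator_vdiff[OF E T, of y y] by simp
    then have "c * nrm E (vdiff E x y) \<le> 0"
      using c(2)[of "vdiff E x y"] C(2)[of "zer E"] xy W' by simp
    then have "nrm E (vdiff E x y) \<le> 0" using c(1) by (simp add: mult_le_0_iff)
    then show "x = y" using xy W' nrm_nonneg[of "vdiff E x y"] nrm_eq_0[of "vdiff E x y"] vdiff_eq_zer[of x y]
      by simp
  qed
  have inv: "inv_into W T (T x) = x" if "x \<in> W" for x using inv_into_f_f[OF inj that] .
  have "operator (subsp E W) (subsp F (T ` W)) T"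
    by (rule operatorI[of _ _ _ C]) (use C(2) W' operatorD[OF T] in auto)
  moreover have "operator (subsp F (T ` W)) (subsp E W) (inv_into W T)"
  proof (rule operatorI[of _ _ _ "1 / c"])
    fix y z assume "y \<in> carr (subsp F (T ` W))" "z \<in> carr (subsp F (T ` W))"
    then obtain u v where "u \<in> W" "v \<in> W" "y = T u" "z = T v" by auto
    then show "inv_into W T (add (subsp F (T ` W)) y z) = add (subsp E W) (inv_into W T y) (inv_into W T z)"
      using inv[of "add E u v"] by (simp add: inv W' operatorD(2)[OF T])
  next
    fix a y assume "y \<in> carr (subsp F (T ` W))"
    then obtain u where "u \<in> W" "y = T u" by auto
    then show "inv_into W T (scl (subsp F (T ` W)) a y) = scl (subsp E W) a (inv_into W T y)"
      using inv[of "scl E a u"] by (simp add: inv W' operatorD(3)[OF T])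
  qed (use c inv in \<open>auto simp: field_simps\<close>)
  ultimately show ?thesis
    using inj by (simp add: isomorphism_def bij_betw_def)
qed

lemma strictly_singular_small:
  assumes E: "normed_space E" and T: "strictly_singular E F T"
    and W: "closed_subspace E W" "\<not> finite_dim (subsp E W)" and c: "0 < c"
  obtains x where "x \<in> W" "nrm F (T x) < c * nrm E x"
proof -
  have "\<not> (\<forall>x\<in>W. c * nrm E x \<le> nrm F (T x))"
    using bounded_below_isomorphism[OF E _ _ c, of W F T] W T
    unfolding strictly_singular_def closed_subspace_def by blast
  then show ?thesis using that by force
qed

text \<open>Surjectivity: \<open>x + K x = y\<close> says that \<open>x\<close> is a fixed point of the contraction
  \<open>x \<mapsto> y - K x\<close>.\<close>

lemma (in banach_space) perturbation_of_identity:
  assumes K: "operator E E K" and small: "\<And>x. x \<in> carr E \<Longrightarrow> nrm E (K x) \<le> 1 / 2 * nrm E x"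
  shows "isomorphism E E (\<lambda>x. add E x (K x))"
proof -
  let ?U = "\<lambda>x. add E x (K x)"
  note K' = operatorD[OF K]
  have U: "operator E E ?U"
  proof (rule operatorI)
    show "nrm E (?U x) \<le> (3 / 2) * nrm E x" if "x \<in> carr E" for x
      using nrm_triangle[of x "K x"] small[OF that] K' that by simp
  qed (simp_all add: K' vec)
  have below: "1 / 2 * nrm E x \<le> nrm E (?U x)" if "x \<in> carr E" for x
  proof -
    have "nrm E x \<le> nrm E (?U x) + nrm E (K x)"
      using nrm_vdiff_le[of "?U x" "K x"] that K' by simp
    with small[OF that] show ?thesis by simp
  qed
  have onto: "?U ` carr E = carr E"
  proof (intro equalityI subsetI)
    fix y assume y: "y \<in> carr E"
    obtain x where x: "x \<in> carr E" "vdiff E y (K x) = x"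
    proof (rule Banach_fixedpoint_thm[OF complete, of "\<lambda>x. vdiff E y (K x)" "1 / 2"])
      fix x x' assume x: "x \<in> carr E" "x' \<in> carr E"
      have eq: "vdiff E (vdiff E y (K x)) (vdiff E y (K x')) = vdiff E (K x') (K x)"
        using vdiff_add[of y "K x'" "K x"] vdiff_add_cancel(4)[of "vdiff E (K x') (K x)" "vdiff E y (K x')"]
          x y K' by simp
      have "nrm E (vdiff E (K x') (K x)) = nrm E (K (vdiff E x x'))"
        using x K' operator_vdiff[OF normed_space_axioms K, of x x'] nrm_vdiff_commute[of "K x'" "K x"]
        by simp
      with eq show "ndist E (vdiff E y (K x)) (vdiff E y (K x')) \<le> 1 / 2 * ndist E x x'"
        using x y K' small[of "vdiff E x x'"] by (simp add: ndist_def)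
    qed (use y K' zer_closed in auto)
    then have "?U x = y" using y K' by (metis vdiff_add_cancel(1))
    with x show "y \<in> ?U ` carr E" by blast
  qed (use K' in auto)
  have lin: "lin_subspace E (carr E)" by (simp add: lin_subspace_def)
  have "isomorphism (subsp E (carr E)) (subsp E (?U ` carr E)) ?U"
    by (rule bounded_below_isomorphism[OF normed_space_axioms lin U _ below]) simp_all
  then show ?thesis by (simp add: onto subsp_def)
qed

lemma complemented_isomorphic_image:
  assumes E: "normed_space E" and U: "isomorphism E E U"
    and P: "operator E E P" "\<And>x. x \<in> carr E \<Longrightarrow> P (P x) = P x"
  shows "complemented E (U ` P ` carr E)"
proof -
  let ?V = "inv_into (carr E) U"
  have U': "operator E E U" "bij_betw U (carr E) (carr E)" "operator E E ?V"
    using U by (auto simp: isomorphism_def)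
  have VU: "?V (U x) = x" if "x \<in> carr E" for x using U'(2) that by (simp add: bij_betw_def)
  have V: "?V ` carr E = carr E" using bij_betw_inv_into[OF U'(2)] by (simp add: bij_betw_def)
  have "operator E E (\<lambda>x. U (P (?V x)))"
    by (intro operator_comp[OF E E _ U'(1)] operator_comp[OF E E U'(3) P(1)])
  moreover have "U (P (?V (U (P (?V x))))) = U (P (?V x))" if "x \<in> carr E" for x
    using that by (simp add: VU P operatorD(1)[OF P(1)] operatorD(1)[OF U'(3)])
  moreover have "(\<lambda>x. U (P (?V x))) ` carr E = U ` P ` carr E"
  proof -
    have "U ` P ` carr E = U ` P ` ?V ` carr E" by (simp only: V)
    then show ?thesis by (simp only: image_image)
  qed
  ultimately show ?thesis unfolding complemented_def by blast
qed

section \<open>The norm of the J-sum as a supremum over lists\<close>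

locale jsum =
  fixes X :: "nat \<Rightarrow> ('k::{real_normed_field,banach}, 'a) nspace" and \<phi> :: "nat \<Rightarrow> 'a \<Rightarrow> 'a"
  assumes banach: "\<And>n. banach_space (X n)"
    and oper: "\<And>n. operator (X n) (X (Suc n)) (\<phi> n)"
    and contraction: "\<And>n x. x \<in> carr (X n) \<Longrightarrow> nrm (X (Suc n)) (\<phi> n x) \<le> nrm (X n) x"
begin

sublocale X: banach_space "X n" for n
  by (rule banach)

abbreviation Jh where "Jh \<equiv> Jhat X \<phi>"

text \<open>The product of the spaces \<open>X n\<close>. Linear facts about single coordinates hold on all of it,
  without any finiteness of the norm.\<close>

definition fam :: "(nat \<Rightarrow> 'a) set" where "fam = {x. \<forall>n. x n \<in> carr (X n)}"

lemma famD [simp]: "x \<in> fam \<Longrightarrow> x n \<in> carr (X n)"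
  by (simp add: fam_def)

lemma Jh_app:
  "zer Jh n = zer (X n)" "add Jh x y n = add (X n) (x n) (y n)" "scl Jh a x n = scl (X n) a (x n)"
  "vdiff Jh x y n = vdiff (X n) (x n) (y n)"
  by (simp_all add: Jhat_def vdiff_def)

lemma fam_closed [simp]:
  "zer Jh \<in> fam" "\<lbrakk>x \<in> fam; y \<in> fam\<rbrakk> \<Longrightarrow> add Jh x y \<in> fam" "x \<in> fam \<Longrightarrow> scl Jh a x \<in> fam"
  "\<lbrakk>x \<in> fam; y \<in> fam\<rbrakk> \<Longrightarrow> vdiff Jh x y \<in> fam"
  by (simp_all add: fam_def Jh_app del: famD)

lemma phi_comp_self [simp]: "phi_comp \<phi> n n = id"
  by (cases n) simp_all

lemma phi_comp_operator:
  "p \<le> q \<Longrightarrow> operator (X p) (X q) (phi_comp \<phi> p q) \<and>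
    (\<forall>x\<in>carr (X p). nrm (X q) (phi_comp \<phi> p q x) \<le> nrm (X p) x)"
proof (induction q)
  case 0
  then show ?case by (auto simp: operator_def intro: exI[of _ 1])
next
  case (Suc q)
  show ?case
  proof (cases "p \<le> q")
    case True
    with Suc have IH: "operator (X p) (X q) (phi_comp \<phi> p q)"
      "\<And>x. x \<in> carr (X p) \<Longrightarrow> nrm (X q) (phi_comp \<phi> p q x) \<le> nrm (X p) x" by auto
    have "operator (X p) (X (Suc q)) (\<lambda>x. \<phi> q (phi_comp \<phi> p q x))"
      by (rule operator_comp[OF X.normed_space_axioms X.normed_space_axioms IH(1) oper])
    moreover have "nrm (X (Suc q)) (\<phi> q (phi_comp \<phi> p q x)) \<le> nrm (X p) x" if "x \<in> carr (X p)" for x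
      using contraction[of "phi_comp \<phi> p q x" q] IH that operatorD(1)[OF IH(1)] by fastforce
    ultimately show ?thesis using True by (simp add: o_def)
  next
    case False
    with Suc.prems have "p = Suc q" by simp
    then show ?thesis by (auto simp: operator_def intro: exI[of _ 1])
  qed
qed

definition jump :: "nat \<Rightarrow> nat \<Rightarrow> (nat \<Rightarrow> 'a) \<Rightarrow> 'a" where
  "jump p q x = vdiff (X q) (phi_comp \<phi> p q (x p)) (x q)"

lemma phi_comp_simps:
  assumes "p \<le> q" "u \<in> carr (X p)"
  shows phi_comp_closed: "phi_comp \<phi> p q u \<in> carr (X q)"
    and phi_comp_scl: "phi_comp \<phi> p q (scl (X p) a u) = scl (X q) a (phi_comp \<phi> p q u)"
    and phi_comp_zer: "phi_comp \<phi> p q (zer (X p)) = zer (X q)"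
    and phi_comp_le: "nrm (X q) (phi_comp \<phi> p q u) \<le> nrm (X p) u"
  using phi_comp_operator[OF assms(1)] assms(2) operatorD
    operator_zer[OF X.normed_space_axioms X.normed_space_axioms]
  by metis+

lemma phi_comp_add:
  "\<lbrakk>p \<le> q; u \<in> carr (X p); v \<in> carr (X p)\<rbrakk> \<Longrightarrow>
    phi_comp \<phi> p q (add (X p) u v) = add (X q) (phi_comp \<phi> p q u) (phi_comp \<phi> p q v)"
  using phi_comp_operator[of p q] operatorD(2) by metis

lemma jump_closed [simp]: "\<lbrakk>p \<le> q; x \<in> fam\<rbrakk> \<Longrightarrow> jump p q x \<in> carr (X q)"
  by (simp add: jump_def phi_comp_closed)

lemma jump_add:
  "\<lbrakk>p \<le> q; x \<in> fam; y \<in> fam\<rbrakk> \<Longrightarrow> jump p q (add Jh x y) = add (X q) (jump p q x) (jump p q y)"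
  by (simp add: jump_def Jh_app phi_comp_add phi_comp_closed X.vdiff_add_add)

lemma jump_scl: "\<lbrakk>p \<le> q; x \<in> fam\<rbrakk> \<Longrightarrow> jump p q (scl Jh a x) = scl (X q) a (jump p q x)"
  by (simp add: jump_def Jh_app phi_comp_scl phi_comp_closed X.scl_vdiff)

lemma jump_cong: "\<lbrakk>x p = y p; x q = y q\<rbrakk> \<Longrightarrow> jump p q x = jump p q y"
  by (simp add: jump_def)

lemma nrm_jump_from_zer:
  "\<lbrakk>p \<le> q; x \<in> fam; x p = zer (X p)\<rbrakk> \<Longrightarrow> nrm (X q) (jump p q x) = nrm (X q) (x q)"
  using X.nrm_vdiff_commute[of "zer (X q)" q "x q"] phi_comp_zer[of p q "zer (X p)"]
  by (simp add: jump_def)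

lemma jump_to_zer:
  "\<lbrakk>p \<le> q; x \<in> fam; x q = zer (X q)\<rbrakk> \<Longrightarrow> jump p q x = phi_comp \<phi> p q (x p)"
  by (simp add: jump_def phi_comp_closed)

lemma nrm_jump_le:
  "\<lbrakk>p \<le> q; x \<in> fam\<rbrakk> \<Longrightarrow> nrm (X q) (jump p q x) \<le> nrm (X p) (x p) + nrm (X q) (x q)"
  using X.nrm_vdiff_le[of "phi_comp \<phi> p q (x p)" q "x q"] phi_comp_le[of p q "x p"] phi_comp_closed[of p q "x p"]
  by (simp add: jump_def)

text \<open>The sets of indices in \<open>rho\<close> are handled as strictly increasing lists: \<open>chain\<close> is
  the sum of squared increments along the list, and \<open>full\<close> adds the squared norm of the last
  coordinate, so that it is the square of \<open>rho\<close>.\<close>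

fun chain :: "(nat \<Rightarrow> 'a) \<Rightarrow> nat list \<Rightarrow> real" where
  "chain x (p # q # ps) = (nrm (X q) (jump p q x))\<^sup>2 + chain x (q # ps)"
| "chain x _ = 0"

definition full :: "(nat \<Rightarrow> 'a) \<Rightarrow> nat list \<Rightarrow> real" where
  "full x ps = chain x ps + (nrm (X (last ps)) (x (last ps)))\<^sup>2"

abbreviation index_list :: "nat list \<Rightarrow> bool" where
  "index_list ps \<equiv> sorted_wrt (<) ps"

lemma full_simps [simp]:
  "full x [p] = (nrm (X p) (x p))\<^sup>2"
  "full x (p # q # ps) = (nrm (X q) (jump p q x))\<^sup>2 + full x (q # ps)"
  by (simp_all add: full_def)

lemma chain_nonneg [simp]: "0 \<le> chain x ps"
  by (induction x ps rule: chain.induct) simp_all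

lemma full_nonneg [simp]: "0 \<le> full x ps"
  by (simp add: full_def)

lemma chain_le_full: "chain x ps \<le> full x ps"
  by (simp add: full_def)

lemma chain_cong: "(\<And>n. n \<in> set ps \<Longrightarrow> x n = y n) \<Longrightarrow> chain x ps = chain y ps"
proof (induction x ps rule: chain.induct)
  case (1 x p q ps)
  then have "chain x (q # ps) = chain y (q # ps)" by simp
  with 1(2) show ?case using jump_cong[of x p y q] by simp
qed simp_all

lemma full_cong: "\<lbrakk>ps \<noteq> []; \<And>n. n \<in> set ps \<Longrightarrow> x n = y n\<rbrakk> \<Longrightarrow> full x ps = full y ps"
  by (simp add: full_def chain_cong[of ps x y])

lemma chain_scl:
  "\<lbrakk>index_list ps; x \<in> fam\<rbrakk> \<Longrightarrow> chain (scl Jh a x) ps = (norm a)\<^sup>2 * chain x ps"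
proof (induction x ps rule: chain.induct)
  case (1 x p q ps)
  then show ?case by (simp add: jump_scl X.nrm_scl power_mult_distrib algebra_simps)
qed simp_all

lemma full_scl:
  "\<lbrakk>index_list ps; x \<in> fam\<rbrakk> \<Longrightarrow> full (scl Jh a x) ps = (norm a)\<^sup>2 * full x ps"
  by (simp add: full_def chain_scl Jh_app X.nrm_scl power_mult_distrib algebra_simps)

lemma full_triangle:
  "\<lbrakk>index_list ps; ps \<noteq> []; x \<in> fam; y \<in> fam\<rbrakk> \<Longrightarrow>
    sqrt (full (add Jh x y) ps) \<le> sqrt (full x ps) + sqrt (full y ps)"
proof (induction x ps rule: chain.induct)
  case (1 x p q ps)
  define a b where "a = nrm (X q) (jump p q x)" and "b = nrm (X q) (jump p q y)"
  have pq: "p \<le> q" using 1 by simp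
  have ab: "0 \<le> a" "0 \<le> b" "nrm (X q) (jump p q (add Jh x y)) \<le> a + b"
    using 1(4,5) pq by (simp_all add: a_def b_def X.nrm_nonneg jump_add X.nrm_triangle)
  have IH: "sqrt (full (add Jh x y) (q # ps)) \<le> sqrt (full x (q # ps)) + sqrt (full y (q # ps))"
    using 1 by simp
  have "full (add Jh x y) (p # q # ps)
      \<le> (a + b)\<^sup>2 + (sqrt (full x (q # ps)) + sqrt (full y (q # ps)))\<^sup>2"
  proof -
    have "(nrm (X q) (jump p q (add Jh x y)))\<^sup>2 \<le> (a + b)\<^sup>2"
      using ab 1(4,5) pq by (intro power_mono) (simp_all add: X.nrm_nonneg)
    moreover have "(sqrt (full (add Jh x y) (q # ps)))\<^sup>2
        \<le> (sqrt (full x (q # ps)) + sqrt (full y (q # ps)))\<^sup>2"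
      by (rule power_mono[OF IH]) simp
    ultimately show ?thesis by simp
  qed
  then have "sqrt (full (add Jh x y) (p # q # ps))
      \<le> sqrt ((a + b)\<^sup>2 + (sqrt (full x (q # ps)) + sqrt (full y (q # ps)))\<^sup>2)" by simp
  also have "\<dots> \<le> sqrt (a\<^sup>2 + (sqrt (full x (q # ps)))\<^sup>2) + sqrt (b\<^sup>2 + (sqrt (full y (q # ps)))\<^sup>2)"
    by (rule real_sqrt_sum_squares_triangle_ineq)
  finally show ?case by (simp add: a_def b_def)
next
  case ("2_2" x p)
  then show ?case by (simp add: Jh_app X.nrm_triangle X.nrm_nonneg)
qed simp

lemma full_tendsto_0:
  assumes "\<And>k. y k \<in> fam" "\<And>n. (\<lambda>k. nrm (X n) (y k n)) \<longlonglongrightarrow> 0"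
  shows "\<lbrakk>index_list ps; ps \<noteq> []\<rbrakk> \<Longrightarrow> (\<lambda>k. full (y k) ps) \<longlonglongrightarrow> 0"
proof (induction ps)
  case (Cons p ps)
  show ?case
  proof (cases ps)
    case Nil
    then show ?thesis using tendsto_power[OF assms(2)[of p], of 2] by simp
  next
    case (Cons q qs)
    have pq: "p \<le> q" using Cons.prems Cons by simp
    have "(\<lambda>k. nrm (X q) (jump p q (y k))) \<longlonglongrightarrow> 0"
    proof (rule Lim_null_comparison)
      show "(\<lambda>k. nrm (X p) (y k p) + nrm (X q) (y k q)) \<longlonglongrightarrow> 0"
        using tendsto_add[OF assms(2)[of p] assms(2)[of q]] by simp
      show "\<forall>\<^sub>F k in sequentially. norm (nrm (X q) (jump p q (y k))) \<le> nrm (X p) (y k p) + nrm (X q) (y k q)"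
        using nrm_jump_le[OF pq assms(1)] assms(1) pq by (simp add: X.nrm_nonneg)
    qed
    from tendsto_add[OF tendsto_power[OF this, of 2]] Cons.IH Cons.prems Cons show ?thesis
      by fastforce
  qed
qed simp

lemma rho_eq:
  assumes "index_list ps" "ps \<noteq> []"
  shows "rho X \<phi> x (set ps) = sqrt (full x ps)"
proof -
  have eq: "sorted_list_of_set (set ps) = ps" "card (set ps) = length ps"
    using assms(1) by (simp_all add: strict_sorted_iff distinct_card sorted_list_of_set.idem_if_sorted_distinct)
  have "(\<Sum>i<length ps - 1. (nrm (X (ps ! Suc i)) (jump (ps ! i) (ps ! Suc i) x))\<^sup>2) = chain x ps"
  proof (induction x ps rule: chain.induct)
    case (1 x p q ps)
    then show ?case by (simp add: sum.lessThan_Suc_shift del: sum.lessThan_Suc)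
  qed simp_all
  then show ?thesis
    unfolding rho_def Let_def eq
    by (simp add: full_def last_conv_nth[OF assms(2)] jump_def sum.atLeast1_atMost_eq)
qed

lemma carr_Jh: "x \<in> carr Jh \<longleftrightarrow> x \<in> fam \<and> bdd_above (rho X \<phi> x ` fin_sets)"
  by (simp add: Jhat_def fam_def del: famD)

lemma nrm_Jh: "sqrt 2 * nrm Jh x = (SUP S\<in>fin_sets. rho X \<phi> x S)"
  by (simp add: Jhat_def Jnorm_def)

lemma Jh_fam [simp]: "x \<in> carr Jh \<Longrightarrow> x \<in> fam"
  by (simp add: carr_Jh)

lemma fin_sets_iff: "S \<in> fin_sets \<longleftrightarrow> (\<exists>ps. index_list ps \<and> ps \<noteq> [] \<and> S = set ps)"
proof
  assume "S \<in> fin_sets"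
  then show "\<exists>ps. index_list ps \<and> ps \<noteq> [] \<and> S = set ps"
    by (intro exI[of _ "sorted_list_of_set S"]) (auto simp: fin_sets_def)
qed (auto simp: fin_sets_def)

lemma Jh_I:
  assumes "x \<in> fam" "0 \<le> B" "\<And>ps. \<lbrakk>index_list ps; ps \<noteq> []\<rbrakk> \<Longrightarrow> full x ps \<le> 2 * B\<^sup>2"
  shows "x \<in> carr Jh" "nrm Jh x \<le> B"
proof -
  have *: "rho X \<phi> x S \<le> sqrt 2 * B" if S: "S \<in> fin_sets" for S
  proof -
    obtain ps where ps: "index_list ps" "ps \<noteq> []" "S = set ps" using S fin_sets_iff by blast
    have "sqrt (full x ps) \<le> sqrt (2 * B\<^sup>2)" using assms(3) ps by simp
    then show ?thesis using assms(2) ps by (simp add: rho_eq real_sqrt_mult)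
  qed
  then show "x \<in> carr Jh" using assms(1) by (auto simp: carr_Jh intro!: bdd_aboveI2)
  have "{0} \<in> fin_sets" by (simp add: fin_sets_def)
  then have "(SUP S\<in>fin_sets. rho X \<phi> x S) \<le> sqrt 2 * B"
    by (intro cSUP_least) (use * in auto)
  then have "sqrt 2 * nrm Jh x \<le> sqrt 2 * B" by (simp only: nrm_Jh)
  then show "nrm Jh x \<le> B" by (simp only: mult_le_cancel_left_pos real_sqrt_gt_0_iff zero_less_numeral)
qed

lemma full_le:
  assumes "x \<in> carr Jh" "index_list ps" "ps \<noteq> []"
  shows "full x ps \<le> 2 * (nrm Jh x)\<^sup>2"
proof -
  have "set ps \<in> fin_sets" using assms(2,3) fin_sets_iff by blast
  then have "rho X \<phi> x (set ps) \<le> (SUP S\<in>fin_sets. rho X \<phi> x S)"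
    using assms(1) by (intro cSUP_upper) (auto simp: carr_Jh)
  also have "\<dots> = sqrt 2 * nrm Jh x" by (simp only: nrm_Jh)
  finally have "sqrt (full x ps) \<le> sqrt 2 * nrm Jh x" using assms(2,3) by (simp add: rho_eq)
  then have "(sqrt (full x ps))\<^sup>2 \<le> (sqrt 2 * nrm Jh x)\<^sup>2" by (rule power_mono) simp
  then show ?thesis by (simp add: power_mult_distrib)
qed

lemma norming_list:
  assumes "x \<in> carr Jh" "0 \<le> b" "b < nrm Jh x"
  obtains ps where "index_list ps" "ps \<noteq> []" "2 * b\<^sup>2 < full x ps"
proof -
  have "\<not> (\<forall>ps. index_list ps \<and> ps \<noteq> [] \<longrightarrow> full x ps \<le> 2 * b\<^sup>2)"
    using Jh_I(2)[of x b] assms by auto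
  then show ?thesis using that by force
qed

lemma sqrt_full_le: "\<lbrakk>x \<in> carr Jh; index_list ps; ps \<noteq> []; 0 \<le> nrm Jh x\<rbrakk> \<Longrightarrow> sqrt (full x ps) \<le> sqrt 2 * nrm Jh x"
  using real_sqrt_le_mono[OF full_le, of x ps] by (simp add: real_sqrt_mult)

lemma nrm_Jh_nonneg: "x \<in> carr Jh \<Longrightarrow> 0 \<le> nrm Jh x"
proof -
  assume x: "x \<in> carr Jh"
  have "{0} \<in> fin_sets" by (simp add: fin_sets_def)
  then have "rho X \<phi> x {0} \<le> (SUP S\<in>fin_sets. rho X \<phi> x S)"
    using x by (intro cSUP_upper) (auto simp: carr_Jh)
  moreover have "0 \<le> rho X \<phi> x {0}" using rho_eq[of "[0]" x] by simp
  ultimately have "0 \<le> sqrt 2 * nrm Jh x" unfolding nrm_Jh by (rule order_trans[rotated])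
  then show ?thesis by (simp add: zero_le_mult_iff)
qed

lemma nrm_coord_le: "x \<in> carr Jh \<Longrightarrow> nrm (X n) (x n) \<le> 2 * nrm Jh x"
proof -
  assume x: "x \<in> carr Jh"
  have "(nrm (X n) (x n))\<^sup>2 \<le> 2 * (nrm Jh x)\<^sup>2" using full_le[OF x, of "[n]"] by simp
  also have "\<dots> \<le> (2 * nrm Jh x)\<^sup>2" by (simp add: power_mult_distrib)
  finally show ?thesis by (rule power2_le_imp_le) (use nrm_Jh_nonneg[OF x] in simp)
qed

lemma Jh_add:
  assumes "x \<in> carr Jh" "y \<in> carr Jh"
  shows "add Jh x y \<in> carr Jh" "nrm Jh (add Jh x y) \<le> nrm Jh x + nrm Jh y"
proof -
  have "full (add Jh x y) ps \<le> 2 * (nrm Jh x + nrm Jh y)\<^sup>2" if "index_list ps" "ps \<noteq> []" for ps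
  proof -
    have "sqrt (full (add Jh x y) ps) \<le> sqrt (full x ps) + sqrt (full y ps)"
      using full_triangle that assms by simp
    also have "\<dots> \<le> sqrt 2 * (nrm Jh x + nrm Jh y)"
      using sqrt_full_le[of x ps] sqrt_full_le[of y ps] that assms by (simp add: nrm_Jh_nonneg distrib_left)
    finally have "(sqrt (full (add Jh x y) ps))\<^sup>2 \<le> (sqrt 2 * (nrm Jh x + nrm Jh y))\<^sup>2"
      by (rule power_mono) simp
    then show ?thesis by (simp add: power_mult_distrib)
  qed
  then show "add Jh x y \<in> carr Jh" "nrm Jh (add Jh x y) \<le> nrm Jh x + nrm Jh y"
    using Jh_I[of "add Jh x y" "nrm Jh x + nrm Jh y"] assms by (auto simp: nrm_Jh_nonneg)
qed

lemma Jh_scl_le: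
  assumes "x \<in> carr Jh"
  shows "scl Jh a x \<in> carr Jh" "nrm Jh (scl Jh a x) \<le> norm a * nrm Jh x"
proof -
  have "full (scl Jh a x) ps \<le> 2 * (norm a * nrm Jh x)\<^sup>2" if "index_list ps" "ps \<noteq> []" for ps
    using mult_left_mono[OF full_le[OF assms that], of "(norm a)\<^sup>2"] that assms
    by (simp add: full_scl power_mult_distrib algebra_simps)
  then show "scl Jh a x \<in> carr Jh" "nrm Jh (scl Jh a x) \<le> norm a * nrm Jh x"
    using Jh_I[of "scl Jh a x" "norm a * nrm Jh x"] assms by (auto simp: nrm_Jh_nonneg)
qed

lemma zer_Jh: "zer Jh \<in> carr Jh" "nrm Jh (zer Jh) = 0"
proof -
  have "scl Jh 0 (zer Jh) = zer Jh" by (rule ext) (simp add: Jh_app)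
  then have "full (zer Jh) ps \<le> 0" if "index_list ps" "ps \<noteq> []" for ps
    using full_scl[of ps "zer Jh" 0] that by simp
  then show "zer Jh \<in> carr Jh" "nrm Jh (zer Jh) = 0"
    using Jh_I[of "zer Jh" 0] nrm_Jh_nonneg[of "zer Jh"] by auto
qed

lemma normed_space_Jh: "normed_space Jh"
proof
  fix x :: "nat \<Rightarrow> 'a" and a b assume x: "x \<in> carr Jh"
  show "scl Jh a x \<in> carr Jh" using Jh_scl_le x by simp
  show "add Jh x (zer Jh) = x" "add Jh x (scl Jh (-1) x) = zer Jh" "scl Jh 1 x = x"
    "scl Jh a (scl Jh b x) = scl Jh (a * b) x" "scl Jh (a + b) x = add Jh (scl Jh a x) (scl Jh b x)"
    using x by (auto intro!: ext simp: Jh_app X.add_zer X.add_neg X.scl_one X.scl_scl X.scl_add_left)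
  show "0 \<le> nrm Jh x" using x by (rule nrm_Jh_nonneg)
  show "nrm Jh x = 0 \<longleftrightarrow> x = zer Jh"
  proof
    assume "nrm Jh x = 0"
    then have "nrm (X n) (x n) = 0" for n
      using nrm_coord_le[OF x, of n] x X.nrm_nonneg[of "x n" n] by simp
    then show "x = zer Jh" using x by (auto intro!: ext simp: Jh_app X.nrm_eq_0)
  qed (simp add: zer_Jh)
  show "nrm Jh (scl Jh a x) = norm a * nrm Jh x"
  proof (cases "a = 0")
    case True
    then have "scl Jh a x = zer Jh" using x by (auto intro!: ext simp: Jh_app)
    with True show ?thesis by (simp add: zer_Jh)
  next
    case False
    have "scl Jh (inverse a) (scl Jh a x) = x" using x False by (auto intro!: ext simp: Jh_app X.scl_scl X.scl_one)
    then have "nrm Jh x \<le> inverse (norm a) * nrm Jh (scl Jh a x)"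
      using Jh_scl_le(2)[of "scl Jh a x" "inverse a"] Jh_scl_le(1)[OF x, of a] by (simp add: norm_inverse)
    then have "norm a * nrm Jh x \<le> nrm Jh (scl Jh a x)" using False by (simp add: field_simps)
    with Jh_scl_le(2)[OF x, of a] show ?thesis by simp
  qed
next
  fix x y :: "nat \<Rightarrow> 'a" assume xy: "x \<in> carr Jh" "y \<in> carr Jh"
  show "add Jh x y \<in> carr Jh" "nrm Jh (add Jh x y) \<le> nrm Jh x + nrm Jh y" using Jh_add xy by auto
  show "add Jh x y = add Jh y x" using xy by (auto intro!: ext simp: Jh_app X.add_commute)
  show "scl Jh a (add Jh x y) = add Jh (scl Jh a x) (scl Jh a y)" for a
    using xy by (auto intro!: ext simp: Jh_app X.scl_add_right)
  show "add Jh (add Jh x y) z = add Jh x (add Jh y z)" if "z \<in> carr Jh" for z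
    using xy that by (auto intro!: ext simp: Jh_app X.add_assoc)
qed (rule zer_Jh)

end

sublocale jsum \<subseteq> J: normed_space "Jhat X \<phi>"
  by (rule normed_space_Jh)

context jsum
begin

text \<open>A Cauchy sequence converges coordinatewise, and for a fixed list the value of \<open>full\<close>
  depends continuously on finitely many coordinates; so the Cauchy estimate passes to the limit
  list by list.\<close>

lemma banach_space_Jh: "banach_space Jh"
proof (rule J.banach_spaceI)
  fix s :: "nat \<Rightarrow> nat \<Rightarrow> 'a" assume s: "\<And>n. s n \<in> carr Jh"
    and cauchy: "\<And>e. 0 < e \<Longrightarrow> \<exists>N. \<forall>m\<ge>N. \<forall>n\<ge>N. nrm Jh (vdiff Jh (s m) (s n)) < e"
  have "\<exists>l\<in>carr (X i). converges_to (X i) (\<lambda>n. s n i) l" for i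
  proof (rule X.Cauchy_converges)
    fix e :: real assume "0 < e"
    then obtain N where N: "\<forall>m\<ge>N. \<forall>n\<ge>N. nrm Jh (vdiff Jh (s m) (s n)) < e / 2"
      using cauchy[of "e / 2"] by auto
    have "nrm (X i) (vdiff (X i) (s m i) (s n i)) < e" if "N \<le> m" "N \<le> n" for m n
      using nrm_coord_le[of "vdiff Jh (s m) (s n)" i] N that s by (fastforce simp: Jh_app)
    then show "\<exists>N. \<forall>m\<ge>N. \<forall>n\<ge>N. nrm (X i) (vdiff (X i) (s m i) (s n i)) < e" by blast
  qed (use s in simp)
  then have "\<exists>l. \<forall>i. l i \<in> carr (X i) \<and> converges_to (X i) (\<lambda>n. s n i) (l i)"
    by (intro choice allI) blast
  then obtain l where l: "\<And>i. l i \<in> carr (X i)" "\<And>i. converges_to (X i) (\<lambda>n. s n i) (l i)" by blast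
  then have lf: "l \<in> fam" by (simp add: fam_def del: famD)
  have near: "vdiff Jh (s m) l \<in> carr Jh \<and> nrm Jh (vdiff Jh (s m) l) \<le> e"
    if e: "0 < e" and N: "\<forall>m\<ge>N. \<forall>n\<ge>N. nrm Jh (vdiff Jh (s m) (s n)) < e" and m: "N \<le> m" for e N m
  proof -
    have "full (vdiff Jh (s m) l) ps \<le> 2 * e\<^sup>2" if ps: "index_list ps" "ps \<noteq> []" for ps
    proof -
      have "sqrt (full (vdiff Jh (s m) l) ps) \<le> sqrt 2 * e"
      proof (rule LIMSEQ_le_const)
        have "(\<lambda>k. full (vdiff Jh (s k) l) ps) \<longlonglongrightarrow> 0"
          by (rule full_tendsto_0[OF _ _ ps]) (use l s lf in \<open>auto simp: converges_to_def Jh_app\<close>)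
        from tendsto_add[OF tendsto_const tendsto_real_sqrt[OF this]]
        show "(\<lambda>k. sqrt 2 * e + sqrt (full (vdiff Jh (s k) l) ps)) \<longlonglongrightarrow> sqrt 2 * e" by simp
        have "sqrt (full (vdiff Jh (s m) l) ps) \<le> sqrt 2 * e + sqrt (full (vdiff Jh (s k) l) ps)"
          if k: "N \<le> k" for k
        proof -
          have "vdiff Jh (s m) l = add Jh (vdiff Jh (s m) (s k)) (vdiff Jh (s k) l)"
            using s lf by (auto intro!: ext simp: Jh_app X.vdiff_add)
          then have "sqrt (full (vdiff Jh (s m) l) ps)
              \<le> sqrt (full (vdiff Jh (s m) (s k)) ps) + sqrt (full (vdiff Jh (s k) l) ps)"
            using full_triangle[OF ps] s lf by simp
          moreover have "sqrt (full (vdiff Jh (s m) (s k)) ps) \<le> sqrt 2 * nrm Jh (vdiff Jh (s m) (s k))"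
            by (rule sqrt_full_le[OF _ ps]) (use s in \<open>simp_all add: nrm_Jh_nonneg\<close>)
          moreover have "sqrt 2 * nrm Jh (vdiff Jh (s m) (s k)) \<le> sqrt 2 * e"
            using N m k by (simp add: less_imp_le)
          ultimately show ?thesis by linarith
        qed
        then show "\<exists>N. \<forall>k\<ge>N. sqrt (full (vdiff Jh (s m) l) ps)
            \<le> sqrt 2 * e + sqrt (full (vdiff Jh (s k) l) ps)" by blast
      qed
      then have "(sqrt (full (vdiff Jh (s m) l) ps))\<^sup>2 \<le> (sqrt 2 * e)\<^sup>2"
        by (rule power_mono) simp
      then show ?thesis by (simp add: power_mult_distrib)
    qed
    then show ?thesis using Jh_I[of "vdiff Jh (s m) l" e] e s lf by simp
  qed
  have lJ: "l \<in> carr Jh"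
  proof -
    obtain N where "\<forall>m\<ge>N. \<forall>n\<ge>N. nrm Jh (vdiff Jh (s m) (s n)) < 1" using cauchy[of 1] by auto
    from near[OF _ this, of N] have d: "vdiff Jh (s N) l \<in> carr Jh" by simp
    have "l = vdiff Jh (s N) (vdiff Jh (s N) l)"
    proof (rule ext)
      fix n
      have "add (X n) (vdiff (X n) (s N n) (l n)) (l n) = s N n" using s lf by simp
      then show "l n = vdiff Jh (s N) (vdiff Jh (s N) l) n"
        using X.vdiff_add_cancel(4)[of "l n" n "vdiff (X n) (s N n) (l n)"] s lf
        by (simp add: Jh_app)
    qed
    with J.vdiff_closed[OF s[of N] d] show ?thesis by metis
  qed
  moreover have "converges_to Jh s l"
    unfolding converges_to_def
  proof (rule LIMSEQ_I)
    fix e :: real assume e: "0 < e"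
    then obtain N where N: "\<forall>m\<ge>N. \<forall>n\<ge>N. nrm Jh (vdiff Jh (s m) (s n)) < e / 2"
      using cauchy[of "e / 2"] by auto
    have "norm (nrm Jh (vdiff Jh (s m) l) - 0) < e" if "N \<le> m" for m
      using near[OF _ N that] e nrm_Jh_nonneg[of "vdiff Jh (s m) l"] by simp
    then show "\<exists>N. \<forall>m\<ge>N. norm (nrm Jh (vdiff Jh (s m) l) - 0) < e" by blast
  qed
  ultimately show "\<exists>l\<in>carr Jh. converges_to Jh s l" by blast
qed

end

sublocale jsum \<subseteq> J: banach_space "Jhat X \<phi>"
  by (rule banach_space_Jh)

context jsum
begin

section \<open>Truncations\<close>

definition trunc :: "nat \<Rightarrow> (nat \<Rightarrow> 'a) \<Rightarrow> nat \<Rightarrow> 'a" where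
  "trunc m x n = (if n \<le> m then x n else zer (X n))"

lemma trunc_fam [simp]: "x \<in> fam \<Longrightarrow> trunc m x \<in> fam"
  by (simp add: fam_def trunc_def del: famD)

text \<open>Along a list that crosses \<open>m\<close>, the only new increment is the jump to 0, and by contractivity
  it is at most the norm of the last coordinate before \<open>m\<close>; the latter is the final term of
  \<open>full\<close> for the shortened list.\<close>

lemma full_trunc_le:
  "\<lbrakk>index_list ps; ps \<noteq> []; x \<in> fam\<rbrakk> \<Longrightarrow>
    full (trunc m x) ps \<le> (if filter (\<lambda>n. n \<le> m) ps = [] then 0 else full x (filter (\<lambda>n. n \<le> m) ps))"
proof (induction ps)
  case (Cons p ps)
  show ?case
  proof (cases ps)
    case Nil
    then show ?thesis by (simp add: trunc_def)
  next
    case (Cons q qs)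
    have pq: "p < q" using Cons.prems Cons by simp
    have IH: "full (trunc m x) (q # qs)
      \<le> (if filter (\<lambda>n. n \<le> m) (q # qs) = [] then 0 else full x (filter (\<lambda>n. n \<le> m) (q # qs)))"
      using Cons.IH Cons.prems unfolding Cons by simp
    consider "q \<le> m" | "p \<le> m" "m < q" | "m < p" by linarith
    then show ?thesis
    proof cases
      case 1
      then have "jump p q (trunc m x) = jump p q x"
        using pq by (intro jump_cong) (simp_all add: trunc_def)
      then show ?thesis using IH 1 pq by (simp add: Cons)
    next
      case 2
      have gt: "\<forall>n\<in>set (q # qs). \<not> n \<le> m" using Cons.prems 2 Cons by auto
      then have none: "filter (\<lambda>n. n \<le> m) (q # qs) = []" by (simp only: filter_False)
      have "jump p q (trunc m x) = phi_comp \<phi> p q (x p)"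
        using jump_to_zer[of p q "trunc m x"] 2 pq Cons.prems by (simp add: trunc_def)
      then have "(nrm (X q) (jump p q (trunc m x)))\<^sup>2 \<le> (nrm (X p) (x p))\<^sup>2"
        using phi_comp_le[of p q "x p"] phi_comp_closed[of p q "x p"] pq Cons.prems
        by (simp add: power_mono X.nrm_nonneg)
      moreover have "filter (\<lambda>n. n \<le> m) (p # q # qs) = [p]" using none 2 by simp
      ultimately show ?thesis using IH none by (simp add: Cons)
    next
      case 3
      have gt: "\<forall>n\<in>set (p # q # qs). \<not> n \<le> m" using Cons.prems 3 Cons by auto
      then have none: "filter (\<lambda>n. n \<le> m) (p # q # qs) = []" by (simp only: filter_False)
      have "jump p q (trunc m x) = zer (X q)"
        using jump_to_zer[of p q "trunc m x"] 3 pq Cons.prems phi_comp_zer[of p q "x p"]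
        by (simp add: trunc_def)
      moreover have "filter (\<lambda>n. n \<le> m) (q # qs) = []" using gt by (intro filter_False) simp
      ultimately show ?thesis using IH none by (simp add: Cons)
    qed
  qed
qed simp

lemma trunc_Jh:
  assumes x: "x \<in> carr Jh"
  shows "trunc m x \<in> carr Jh" "nrm Jh (trunc m x) \<le> nrm Jh x"
proof -
  have "full (trunc m x) ps \<le> 2 * (nrm Jh x)\<^sup>2" if ps: "index_list ps" "ps \<noteq> []" for ps
    using full_trunc_le[of ps x m] full_le[OF x, of "filter (\<lambda>n. n \<le> m) ps"] ps x
    by (auto simp: sorted_wrt_filter split: if_splits intro: order_trans)
  then show "trunc m x \<in> carr Jh" "nrm Jh (trunc m x) \<le> nrm Jh x"
    using Jh_I[of "trunc m x" "nrm Jh x"] x by (auto simp: J.nrm_nonneg)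
qed

lemma trunc_add: "trunc m (add Jh x y) = add Jh (trunc m x) (trunc m y)"
  by (rule ext) (simp add: trunc_def Jh_app X.add_zer)

lemma trunc_scl: "trunc m (scl Jh a x) = scl Jh a (trunc m x)"
  by (rule ext) (simp add: trunc_def Jh_app)

lemma trunc_vdiff: "trunc m (vdiff Jh x y) = vdiff Jh (trunc m x) (trunc m y)"
  by (simp add: vdiff_def trunc_add trunc_scl)

lemma trunc_trunc: "m \<le> m' \<Longrightarrow> trunc m (trunc m' x) = trunc m x"
  by (rule ext) (simp add: trunc_def)

lemma nrm_trunc_mono: "\<lbrakk>m \<le> m'; x \<in> carr Jh\<rbrakk> \<Longrightarrow> nrm Jh (trunc m x) \<le> nrm Jh (trunc m' x)"
  by (metis trunc_Jh trunc_trunc)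

lemma trunc_operator: "operator Jh Jh (trunc m)"
  by (rule operatorI[of _ _ _ 1]) (simp_all add: trunc_Jh trunc_add trunc_scl)

lemma nrm_trunc_large:
  assumes x: "x \<in> carr Jh" and b: "0 \<le> b" "b < nrm Jh x"
  obtains m where "m0 \<le> m" "b < nrm Jh (trunc m x)"
proof -
  obtain ps where ps: "index_list ps" "ps \<noteq> []" "2 * b\<^sup>2 < full x ps"
    by (rule norming_list[OF x b])
  define m where "m = max m0 (Max (set ps))"
  have "n \<le> m" if "n \<in> set ps" for n
    using that unfolding m_def by (simp add: max.coboundedI2)
  then have "full (trunc m x) ps = full x ps"
    by (intro full_cong[OF ps(2)]) (simp add: trunc_def)
  then have "b\<^sup>2 < (nrm Jh (trunc m x))\<^sup>2"
    using full_le[OF trunc_Jh(1)[OF x] ps(1,2), of m] ps(3) by simp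
  then have "b < nrm Jh (trunc m x)"
    by (rule power2_less_imp_less) (use trunc_Jh(1)[OF x] in \<open>simp add: J.nrm_nonneg\<close>)
  then show ?thesis using that[of m] by (simp add: m_def)
qed

lemma Jset_subspace: "lin_subspace Jh (Jset X \<phi>)"
  unfolding lin_subspace_def
proof (intro conjI ballI allI)
  show "zer Jh \<in> Jset X \<phi>" by (simp add: Jset_def Jh_app J.zer_closed)
  fix x assume "x \<in> Jset X \<phi>"
  then have x: "x \<in> carr Jh" "(\<lambda>n. nrm (X n) (x n)) \<longlonglongrightarrow> 0" by (auto simp: Jset_def)
  show "scl Jh a x \<in> Jset X \<phi>" for a
    using tendsto_mult_left[OF x(2), of "norm a"] x(1)
    by (simp add: Jset_def Jh_app J.scl_closed X.nrm_scl)
  fix y assume "y \<in> Jset X \<phi>"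
  then have y: "y \<in> carr Jh" "(\<lambda>n. nrm (X n) (y n)) \<longlonglongrightarrow> 0" by (auto simp: Jset_def)
  have "(\<lambda>n. nrm (X n) (add Jh x y n)) \<longlonglongrightarrow> 0"
  proof (rule Lim_null_comparison)
    show "(\<lambda>n. nrm (X n) (x n) + nrm (X n) (y n)) \<longlonglongrightarrow> 0" using tendsto_add[OF x(2) y(2)] by simp
    show "\<forall>\<^sub>F n in sequentially. norm (nrm (X n) (add Jh x y n)) \<le> nrm (X n) (x n) + nrm (X n) (y n)"
      using x y by (intro always_eventually) (simp add: Jh_app X.nrm_nonneg X.nrm_triangle)
  qed
  with x y show "add Jh x y \<in> Jset X \<phi>" by (simp add: Jset_def J.add_closed)
qed (auto simp: Jset_def)

lemma trunc_Jset:
  assumes x: "x \<in> carr Jh"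
  shows "trunc m x \<in> Jset X \<phi>"
proof -
  have "\<forall>\<^sub>F n in sequentially. nrm (X n) (trunc m x n) = 0"
    using eventually_gt_at_top[of m] by eventually_elim (simp add: trunc_def)
  then have "(\<lambda>n. nrm (X n) (trunc m x n)) \<longlonglongrightarrow> 0" by (rule tendsto_eventually)
  with trunc_Jh(1)[OF x] show ?thesis by (simp add: Jset_def)
qed

lemma chain_append: "chain x ps + chain x qs \<le> chain x (ps @ qs)"
proof (induction x ps rule: chain.induct)
  case ("2_2" x p)
  then show ?case by (cases qs) simp_all
qed simp_all

text \<open>Between indices up to \<open>g\<close> the increments are 0, and the jump out of this range has the same
  norm from every starting index; so the single index \<open>g\<close> can replace them all.\<close>

lemma chain_prefix_zer:
  assumes "z \<in> fam" "\<And>n. n \<le> g \<Longrightarrow> z n = zer (X n)"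
  shows "index_list ps \<Longrightarrow> chain z ps \<le> chain z (g # filter (\<lambda>n. g < n) ps)"
proof (induction ps)
  case (Cons p ps)
  show ?case
  proof (cases ps)
    case (Cons q qs)
    have pq: "p < q" using Cons.prems Cons by simp
    have IH: "chain z (q # qs) \<le> chain z (g # filter (\<lambda>n. g < n) (q # qs))"
      using Cons.IH Cons.prems unfolding Cons by simp
    consider "g < p" | "p \<le> g" "g < q" | "q \<le> g" by linarith
    then show ?thesis
    proof cases
      case 1
      then have "\<forall>n\<in>set (p # ps). g < n" using Cons.prems by auto
      then have "filter (\<lambda>n. g < n) (p # ps) = p # ps" by (simp only: filter_True)
      then show ?thesis by simp
    next
      case 2
      have "\<forall>n\<in>set (q # qs). g < n" using Cons.prems Cons 2 by auto
      then have "filter (\<lambda>n. g < n) (q # qs) = q # qs" by (simp only: filter_True)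
      moreover have "nrm (X q) (jump p q z) = nrm (X q) (jump g q z)"
        using 2 pq assms by (simp add: nrm_jump_from_zer)
      ultimately show ?thesis using 2 by (simp add: Cons)
    next
      case 3
      have "nrm (X q) (jump p q z) = 0"
        using 3 pq assms by (simp add: nrm_jump_from_zer)
      then show ?thesis using IH 3 pq by (simp add: Cons)
    qed
  qed simp
qed simp

text \<open>Choose a list whose chain is almost as large as the supremum of all chains. Lists further
  out can be appended to it, so their chains are small. Only chains can be used for this: the value
  of \<open>full\<close> may drop when a list is extended. The remaining terms of \<open>full\<close> are squares of
  single coordinates, and these tend to 0.\<close>

lemma Jset_trunc_tendsto:
  assumes x: "x \<in> Jset X \<phi>" and e: "0 < e"
  obtains m where "g < m" "nrm Jh (vdiff Jh x (trunc m x)) \<le> e"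
proof -
  have xJ: "x \<in> carr Jh" and x0: "(\<lambda>n. nrm (X n) (x n)) \<longlonglongrightarrow> 0" using x by (auto simp: Jset_def)
  define d where "d = 2 * e\<^sup>2 / 3"
  have d: "0 < d" using e by (simp add: d_def)
  define L where "L = {ps. index_list ps \<and> ps \<noteq> []}"
  have bdd: "bdd_above (chain x ` L)"
    using order_trans[OF chain_le_full full_le[OF xJ]] by (intro bdd_aboveI2) (auto simp: L_def)
  have "[0] \<in> L" by (simp add: L_def)
  then have "\<exists>ps0\<in>L. (SUP ps\<in>L. chain x ps) - d < chain x ps0"
    using less_cSUP_iff[OF _ bdd, of "(SUP ps\<in>L. chain x ps) - d"] d by auto
  then obtain ps0 where ps0: "index_list ps0" "(SUP ps\<in>L. chain x ps) - d < chain x ps0" "ps0 \<noteq> []"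
    by (auto simp: L_def)
  have "\<forall>\<^sub>F n in sequentially. nrm (X n) (x n) < sqrt d"
    by (rule order_tendstoD(2)[OF x0]) (use d in simp)
  then obtain m1 where m1: "\<And>n. m1 \<le> n \<Longrightarrow> nrm (X n) (x n) < sqrt d"
    by (auto simp: eventually_sequentially)
  have small: "(nrm (X n) (x n))\<^sup>2 \<le> d" if "m1 \<le> n" for n
    using power_mono[OF less_imp_le[OF m1[OF that]], of 2] xJ d by (simp add: X.nrm_nonneg)
  define m where "m = max (Suc g) (max m1 (Max (set ps0)))"
  have m: "g < m" "m1 \<le> m" "\<And>n. n \<in> set ps0 \<Longrightarrow> n \<le> m"
    by (auto simp: m_def max.coboundedI2)
  define z where "z = vdiff Jh x (trunc m x)"
  have z_app: "z n = (if n \<le> m then zer (X n) else x n)" for n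
    using xJ by (simp add: z_def Jh_app trunc_def)
  have zf: "z \<in> fam" using xJ by (simp add: z_def)
  have "full z ps \<le> 2 * e\<^sup>2" if ps: "index_list ps" "ps \<noteq> []" for ps
  proof -
    define T where "T = filter (\<lambda>n. m < n) ps"
    have T: "index_list T" "\<And>n. n \<in> set T \<Longrightarrow> m < n"
      using ps by (auto simp: T_def sorted_wrt_filter)
    have chainT: "chain z T = chain x T" by (rule chain_cong) (use T(2) in \<open>force simp: z_app\<close>)
    have "chain x T \<le> d"
    proof (cases "T = []")
      case False
      have "index_list (ps0 @ T)"
        using T ps0(1) m(3) by (auto simp: sorted_wrt_append intro: le_less_trans)
      then have "chain x (ps0 @ T) \<le> (SUP ps\<in>L. chain x ps)"
        using bdd ps0(3) by (intro cSUP_upper) (simp_all add: L_def)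
      with chain_append[of x ps0 T] ps0(2) show ?thesis by simp
    qed (use d in simp)
    moreover have "chain z (m # T) \<le> d + chain z T"
    proof (cases T)
      case (Cons q qs)
      then have q: "m < q" using T(2) by simp
      then have "nrm (X q) (jump m q z) = nrm (X q) (x q)"
        using zf by (simp add: nrm_jump_from_zer z_app)
      with small[of q] q m(2) Cons show ?thesis by simp
    qed (use d in simp)
    moreover have "chain z ps \<le> chain z (m # T)"
      unfolding T_def by (rule chain_prefix_zer[OF zf _ ps(1)]) (simp add: z_app)
    moreover have "(nrm (X (last ps)) (z (last ps)))\<^sup>2 \<le> d"
      using small[of "last ps"] m(2) d by (simp add: z_app)
    ultimately have "full z ps \<le> 3 * d" using chainT by (simp add: full_def)
    then show ?thesis by (simp add: d_def)
  qed
  then have "nrm Jh z \<le> e" using Jh_I(2)[OF zf] e by simp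
  then show ?thesis using that[of m] m(1) by (simp add: z_def)
qed

section \<open>Sequences with disjoint supports\<close>

text \<open>The sum \<open>\<Sum> a j z j\<close> of vectors with disjoint supports, where \<open>\<kappa> n\<close> is the only \<open>j\<close> for which
  the coordinate \<open>n\<close> of \<open>z j\<close> may be non-zero. Defined coordinatewise, it involves no
  limit.\<close>

definition synth :: "(nat \<Rightarrow> nat) \<Rightarrow> (nat \<Rightarrow> nat \<Rightarrow> 'a) \<Rightarrow> (nat \<Rightarrow> 'k) \<Rightarrow> nat \<Rightarrow> 'a" where
  "synth \<kappa> z a n = scl (X n) (a (\<kappa> n)) (z (\<kappa> n) n)"

lemma synth_fam [simp]: "(\<And>j. z j \<in> fam) \<Longrightarrow> synth \<kappa> z a \<in> fam"
  by (simp add: fam_def synth_def del: famD)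

text \<open>An increment from \<open>p\<close> to \<open>q\<close> involves at most the two vectors that live at \<open>p\<close> and at \<open>q\<close>.
  If these differ, each of them vanishes at the other index, so the increment of the sum is the
  sum of their increments, and the factor 2 comes from \<open>(s + t)\<^sup>2 \<le> 2 (s\<^sup>2 + t\<^sup>2)\<close>.\<close>

lemma jump_synth_le:
  assumes z: "\<And>j. z j \<in> fam" and disj: "\<And>j n. \<kappa> n \<noteq> j \<Longrightarrow> z j n = zer (X n)"
    and pq: "p < q" "\<kappa> p < K" "\<kappa> q < K"
  shows "(nrm (X q) (jump p q (synth \<kappa> z a)))\<^sup>2
    \<le> 2 * (\<Sum>j<K. (norm (a j))\<^sup>2 * (nrm (X q) (jump p q (z j)))\<^sup>2)"
proof -
  let ?t = "\<lambda>j. norm (a j) * nrm (X q) (jump p q (z j))"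
  have sum: "(\<Sum>j<K. (norm (a j))\<^sup>2 * (nrm (X q) (jump p q (z j)))\<^sup>2) = (\<Sum>j<K. (?t j)\<^sup>2)"
    by (simp add: power_mult_distrib)
  show ?thesis
  proof (cases "\<kappa> p = \<kappa> q")
    case True
    have "jump p q (synth \<kappa> z a) = jump p q (scl Jh (a (\<kappa> q)) (z (\<kappa> q)))"
      by (rule jump_cong) (simp_all add: synth_def Jh_app True)
    then have "nrm (X q) (jump p q (synth \<kappa> z a)) = ?t (\<kappa> q)"
      using z pq by (simp add: jump_scl X.nrm_scl)
    moreover have "(?t (\<kappa> q))\<^sup>2 \<le> (\<Sum>j<K. (?t j)\<^sup>2)"
      by (rule member_le_sum) (use pq in auto)
    moreover have "0 \<le> (\<Sum>j<K. (?t j)\<^sup>2)" by (rule sum_nonneg) simp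
    ultimately show ?thesis unfolding sum by simp
  next
    case False
    have "jump p q (synth \<kappa> z a)
        = vdiff (X q) (scl (X q) (a (\<kappa> p)) (phi_comp \<phi> p q (z (\<kappa> p) p))) (scl (X q) (a (\<kappa> q)) (z (\<kappa> q) q))"
      using pq z by (simp add: jump_def synth_def phi_comp_scl)
    then have "nrm (X q) (jump p q (synth \<kappa> z a))
        \<le> norm (a (\<kappa> p)) * nrm (X q) (phi_comp \<phi> p q (z (\<kappa> p) p)) + norm (a (\<kappa> q)) * nrm (X q) (z (\<kappa> q) q)"
      using X.nrm_vdiff_le[of "scl (X q) (a (\<kappa> p)) (phi_comp \<phi> p q (z (\<kappa> p) p))" q
          "scl (X q) (a (\<kappa> q)) (z (\<kappa> q) q)"] pq z
      by (simp add: X.nrm_scl phi_comp_closed)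
    also have "phi_comp \<phi> p q (z (\<kappa> p) p) = jump p q (z (\<kappa> p))"
      using jump_to_zer[of p q "z (\<kappa> p)"] disj[of q "\<kappa> p"] False z pq by simp
    also have "nrm (X q) (z (\<kappa> q) q) = nrm (X q) (jump p q (z (\<kappa> q)))"
      using nrm_jump_from_zer[of p q "z (\<kappa> q)"] disj[of p "\<kappa> q"] False z pq by simp
    finally have "(nrm (X q) (jump p q (synth \<kappa> z a)))\<^sup>2 \<le> (?t (\<kappa> p) + ?t (\<kappa> q))\<^sup>2"
      by (rule power_mono) (use z pq in \<open>simp add: X.nrm_nonneg\<close>)
    also have "\<dots> \<le> 2 * ((?t (\<kappa> p))\<^sup>2 + (?t (\<kappa> q))\<^sup>2)"
      using sum_squares_bound[of "?t (\<kappa> p)" "?t (\<kappa> q)"] by (simp add: power2_sum)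
    also have "(?t (\<kappa> p))\<^sup>2 + (?t (\<kappa> q))\<^sup>2 = (\<Sum>j\<in>{\<kappa> p, \<kappa> q}. (?t j)\<^sup>2)" using False by simp
    also have "\<dots> \<le> (\<Sum>j<K. (?t j)\<^sup>2)" by (rule sum_mono2) (use pq in auto)
    finally show ?thesis unfolding sum by simp
  qed
qed

lemma full_synth_le:
  assumes z: "\<And>j. z j \<in> fam" and disj: "\<And>j n. \<kappa> n \<noteq> j \<Longrightarrow> z j n = zer (X n)"
  shows "\<lbrakk>index_list ps; ps \<noteq> []; \<And>p. p \<in> set ps \<Longrightarrow> \<kappa> p < K\<rbrakk> \<Longrightarrow>
    full (synth \<kappa> z a) ps \<le> 2 * (\<Sum>j<K. (norm (a j))\<^sup>2 * full (z j) ps)"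
proof (induction ps)
  case (Cons p ps)
  show ?case
  proof (cases ps)
    case Nil
    have "(nrm (X p) (synth \<kappa> z a p))\<^sup>2 = (norm (a (\<kappa> p)))\<^sup>2 * (nrm (X p) (z (\<kappa> p) p))\<^sup>2"
      using z by (simp add: synth_def X.nrm_scl power_mult_distrib)
    also have "\<dots> \<le> (\<Sum>j<K. (norm (a j))\<^sup>2 * (nrm (X p) (z j p))\<^sup>2)"
      by (rule member_le_sum[where f = "\<lambda>j. (norm (a j))\<^sup>2 * (nrm (X p) (z j p))\<^sup>2"])
        (use Cons.prems in auto)
    moreover have "0 \<le> (\<Sum>j<K. (norm (a j))\<^sup>2 * (nrm (X p) (z j p))\<^sup>2)" by (rule sum_nonneg) simp
    ultimately show ?thesis by (simp add: Nil)
  next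
    case (Cons q qs)
    have pq: "p < q" "\<kappa> p < K" "\<kappa> q < K" using Cons.prems Cons by auto
    have "full (synth \<kappa> z a) (q # qs) \<le> 2 * (\<Sum>j<K. (norm (a j))\<^sup>2 * full (z j) (q # qs))"
      using Cons.IH Cons.prems unfolding Cons by simp
    with jump_synth_le[where z = z and \<kappa> = \<kappa> and a = a, OF z disj pq] show ?thesis
      by (simp add: Cons distrib_left sum.distrib)
  qed
qed simp

lemma synth_Jh:
  assumes z: "\<And>j. z j \<in> carr Jh" "\<And>j. nrm Jh (z j) \<le> 2"
    and disj: "\<And>j n. \<kappa> n \<noteq> j \<Longrightarrow> z j n = zer (X n)"
    and B: "0 \<le> B" "\<And>K. (\<Sum>j<K. (norm (a j))\<^sup>2) \<le> B\<^sup>2"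
  shows "synth \<kappa> z a \<in> carr Jh" "nrm Jh (synth \<kappa> z a) \<le> 3 * B"
proof -
  have "full (synth \<kappa> z a) ps \<le> 2 * (3 * B)\<^sup>2" if ps: "index_list ps" "ps \<noteq> []" for ps
  proof -
    have zfull: "full (z j) ps \<le> 8" for j
    proof -
      have "full (z j) ps \<le> 2 * (nrm Jh (z j))\<^sup>2" by (rule full_le[OF z(1) ps])
      also have "\<dots> \<le> 2 * 2\<^sup>2" using power_mono[OF z(2)[of j], of 2] z(1) by (simp add: J.nrm_nonneg)
      finally show ?thesis by simp
    qed
    define K where "K = Suc (Max (\<kappa> ` set ps))"
    have K: "\<kappa> p < K" if "p \<in> set ps" for p using that by (simp add: K_def le_imp_less_Suc)
    have "full (synth \<kappa> z a) ps \<le> 2 * (\<Sum>j<K. (norm (a j))\<^sup>2 * full (z j) ps)"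
      by (rule full_synth_le[OF _ disj ps K]) (use z in auto)
    also have "\<dots> \<le> 2 * (\<Sum>j<K. (norm (a j))\<^sup>2 * 8)"
      by (intro mult_left_mono sum_mono) (use zfull in auto)
    also have "\<dots> = 16 * (\<Sum>j<K. (norm (a j))\<^sup>2)" by (simp flip: sum_distrib_right)
    also have "\<dots> \<le> 16 * B\<^sup>2" using B(2) by simp
    also have "\<dots> \<le> 2 * (3 * B)\<^sup>2" by (simp add: power_mult_distrib)
    finally show ?thesis .
  qed
  then show "synth \<kappa> z a \<in> carr Jh" "nrm Jh (synth \<kappa> z a) \<le> 3 * B"
    using Jh_I[of "synth \<kappa> z a" "3 * B"] z B(1) by auto
qed

lemma psum_synth:
  assumes z: "\<And>j. z j \<in> fam" and disj: "\<And>j n. \<kappa> n \<noteq> j \<Longrightarrow> z j n = zer (X n)"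
  shows "psum Jh (\<lambda>k. scl Jh (a k) (z k)) n = synth \<kappa> z (\<lambda>k. if k < n then a k else 0)"
proof (induction n)
  case 0
  show ?case using z by (auto simp: synth_def Jh_app intro!: ext)
next
  case (Suc n)
  show ?case
  proof (rule ext)
    fix p
    have zp: "z k p \<in> carr (X p)" for k using z by simp
    have "scl (X p) (a n) (z n p) = zer (X p)" if "\<kappa> p \<noteq> n" using disj[OF that] by simp
    then show "psum Jh (\<lambda>k. scl Jh (a k) (z k)) (Suc n) p
        = synth \<kappa> z (\<lambda>k. if k < Suc n then a k else 0) p"
      using zp by (auto simp: Suc synth_def Jh_app less_Suc_eq X.add_zer)
  qed
qed

text \<open>Norm the increments of \<open>z\<close> along the list by functionals, apply these to the increments
  of \<open>x\<close>, and use the Cauchy-Schwarz inequality. The bound by \<open>chain x ps\<close> shows in particular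
  that the functional depends only on the coordinates in the list.\<close>

lemma chain_functional:
  assumes z: "z \<in> fam"
  shows "index_list ps \<Longrightarrow> \<exists>f :: (nat \<Rightarrow> 'a) \<Rightarrow> 'k.
    (\<forall>x\<in>fam. \<forall>y\<in>fam. f (add Jh x y) = f x + f y) \<and> (\<forall>a. \<forall>x\<in>fam. f (scl Jh a x) = a * f x) \<and>
    (\<forall>x\<in>fam. norm (f x) \<le> 4 * (sqrt (chain z ps) * sqrt (chain x ps))) \<and> f z = of_real (chain z ps)"
proof (induction ps)
  case Nil
  then show ?case by (intro exI[of _ "\<lambda>x. 0"]) simp
next
  case (Cons p ps)
  show ?case
  proof (cases ps)
    case Nil
    then show ?thesis by (intro exI[of _ "\<lambda>x. 0"]) simp
  next
    case (Cons q qs)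
    have pq: "p \<le> q" using Cons.prems Cons by simp
    obtain f :: "(nat \<Rightarrow> 'a) \<Rightarrow> 'k" where f: "\<And>x y. \<lbrakk>x \<in> fam; y \<in> fam\<rbrakk> \<Longrightarrow> f (add Jh x y) = f x + f y"
      "\<And>a x. x \<in> fam \<Longrightarrow> f (scl Jh a x) = a * f x"
      "\<And>x. x \<in> fam \<Longrightarrow> norm (f x) \<le> 4 * (sqrt (chain z ps) * sqrt (chain x ps))"
      "f z = of_real (chain z ps)"
    proof -
      have "index_list ps" using Cons.prems by simp
      from Cons.IH[OF this] that show ?thesis by blast
    qed
    define d where "d = nrm (X q) (jump p q z)"
    have d: "0 \<le> d" using z pq by (simp add: d_def X.nrm_nonneg)
    obtain h where h: "\<And>x y. \<lbrakk>x \<in> carr (X q); y \<in> carr (X q)\<rbrakk> \<Longrightarrow> h (add (X q) x y) = h x + h y"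
      "\<And>a x. x \<in> carr (X q) \<Longrightarrow> h (scl (X q) a x) = a * h x"
      "\<And>x. x \<in> carr (X q) \<Longrightarrow> norm (h x) \<le> 4 * nrm (X q) x" "h (jump p q z) = of_real d"
    proof -
      have "jump p q z \<in> carr (X q)" using z pq by simp
      from X.Hahn_Banach[OF this, folded d_def] that show ?thesis by blast
    qed
    let ?f = "\<lambda>x. of_real d * h (jump p q x) + f x"
    have "norm (?f x) \<le> 4 * (sqrt (chain z (p # ps)) * sqrt (chain x (p # ps)))" if x: "x \<in> fam" for x
    proof -
      define D where "D = nrm (X q) (jump p q x)"
      have D: "0 \<le> D" using x pq by (simp add: D_def X.nrm_nonneg)
      have "norm (?f x) \<le> d * norm (h (jump p q x)) + norm (f x)"
        using norm_triangle_ineq[of "of_real d * h (jump p q x)" "f x"] d by (simp add: norm_mult)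
      also have "\<dots> \<le> d * (4 * D) + 4 * (sqrt (chain z ps) * sqrt (chain x ps))"
        using h(3)[of "jump p q x"] f(3)[OF x] d x pq by (intro add_mono mult_left_mono) (simp_all add: D_def)
      also have "\<dots> = 4 * (d * D + sqrt (chain z ps) * sqrt (chain x ps))" by simp
      also have "d * D + sqrt (chain z ps) * sqrt (chain x ps)
          \<le> sqrt (d\<^sup>2 + chain z ps) * sqrt (D\<^sup>2 + chain x ps)"
      proof -
        have "(d * D + sqrt (chain z ps) * sqrt (chain x ps))\<^sup>2
            \<le> (d\<^sup>2 + (sqrt (chain z ps))\<^sup>2) * (D\<^sup>2 + (sqrt (chain x ps))\<^sup>2)"
          using zero_le_power2[of "d * sqrt (chain x ps) - sqrt (chain z ps) * D"]
          by (simp add: power2_eq_square algebra_simps)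
        then have "d * D + sqrt (chain z ps) * sqrt (chain x ps)
            \<le> sqrt ((d\<^sup>2 + chain z ps) * (D\<^sup>2 + chain x ps))"
          by (intro real_le_rsqrt) simp
        then show ?thesis by (simp add: real_sqrt_mult)
      qed
      finally show ?thesis by (simp add: Cons d_def D_def)
    qed
    moreover have "?f z = of_real (chain z (p # ps))"
      using f(4) h(4) by (simp add: Cons d_def power2_eq_square)
    ultimately show ?thesis
      by (intro exI[of _ ?f]) (use f(1,2) h(1,2) pq in \<open>simp add: jump_add jump_scl algebra_simps\<close>)
  qed
qed

lemma normalized_chain_functional:
  assumes z: "z \<in> fam" and ps: "index_list ps" and pos: "1 / 8 \<le> chain z ps"
  obtains f :: "(nat \<Rightarrow> 'a) \<Rightarrow> 'k" where
    "\<And>x y. \<lbrakk>x \<in> fam; y \<in> fam\<rbrakk> \<Longrightarrow> f (add Jh x y) = f x + f y"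
    "\<And>a x. x \<in> fam \<Longrightarrow> f (scl Jh a x) = a * f x"
    "\<And>x. x \<in> fam \<Longrightarrow> (norm (f x))\<^sup>2 \<le> 128 * chain x ps" "f z = 1"
proof -
  obtain f :: "(nat \<Rightarrow> 'a) \<Rightarrow> 'k" where f: "\<And>x y. \<lbrakk>x \<in> fam; y \<in> fam\<rbrakk> \<Longrightarrow> f (add Jh x y) = f x + f y"
    "\<And>a x. x \<in> fam \<Longrightarrow> f (scl Jh a x) = a * f x"
    "\<And>x. x \<in> fam \<Longrightarrow> norm (f x) \<le> 4 * (sqrt (chain z ps) * sqrt (chain x ps))"
    "f z = of_real (chain z ps)"
    using chain_functional[OF z ps] by blast
  define c where "c = chain z ps"
  have c: "1 / 8 \<le> c" using pos by (simp add: c_def)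
  have bound: "(norm (f x / of_real c))\<^sup>2 \<le> 128 * chain x ps" if x: "x \<in> fam" for x
  proof -
    have "(norm (f x))\<^sup>2 \<le> (4 * (sqrt c * sqrt (chain x ps)))\<^sup>2"
      using f(3)[OF x] unfolding c_def by (rule power_mono) simp
    also have "\<dots> = 16 * c * chain x ps" using c by (simp add: power_mult_distrib)
    also have "\<dots> \<le> 16 * c * chain x ps * (8 * c)"
      using c mult_left_mono[of 1 "8 * c" "16 * c * chain x ps"] by simp
    finally have "(norm (f x))\<^sup>2 \<le> 128 * chain x ps * c\<^sup>2" by (simp add: power2_eq_square algebra_simps)
    then show ?thesis using c by (simp add: norm_divide power_divide divide_le_eq)
  qed
  show ?thesis
    by (rule that[of "\<lambda>x. f x / of_real c"])
      (use f(1,2,4) bound c in \<open>auto simp: add_divide_distrib c_def[symmetric]\<close>)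
qed

lemma chain_zer: "\<lbrakk>index_list ps; x \<in> fam; \<And>n. n \<in> set ps \<Longrightarrow> x n = zer (X n)\<rbrakk> \<Longrightarrow> chain x ps = 0"
proof (induction x ps rule: chain.induct)
  case (1 x p q ps)
  then show ?case by (simp add: nrm_jump_from_zer)
qed simp_all

end

section \<open>A complemented subspace from a block sequence\<close>

lemma geometric_growth:
  fixes A :: "nat \<Rightarrow> real"
  assumes A: "\<And>j. j < n \<Longrightarrow> A j \<le> 2 * b + 2 * (\<Sum>i<j. A i)" and j: "j < n"
  shows "A j \<le> 2 * 3 ^ j * b"
proof -
  have "k \<le> n \<Longrightarrow> (\<Sum>i<k. A i) \<le> (3 ^ k - 1) * b" for k
  proof (induction k)
    case (Suc k)
    then have "(\<Sum>i<Suc k. A i) \<le> 3 * ((3 ^ k - 1) * b) + 2 * b" using A[of k] by simp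
    then show ?case by (simp add: algebra_simps)
  qed simp
  from this[of j] A[OF j] j show ?thesis by (simp add: algebra_simps)
qed

lemma sum_half_powers_le: "(\<Sum>k<n. (1 / 2 :: real) ^ k) \<le> 2"
proof -
  have "(\<Sum>k<n. (1 / 2 :: real) ^ k) = 2 - 2 * (1 / 2) ^ n" by (induction n) simp_all
  then show ?thesis by simp
qed

context jsum
begin

lemma chain_le: "\<lbrakk>x \<in> carr Jh; index_list ps\<rbrakk> \<Longrightarrow> chain x ps \<le> 2 * (nrm Jh x)\<^sup>2"
  using order_trans[OF chain_le_full full_le, of x ps] by (cases "ps = []") auto

text \<open>Lists in successive intervals can be concatenated.\<close>

lemma sum_chain_le:
  assumes x: "x \<in> carr Jh" and g: "\<And>k. g k < g (Suc k)"
    and S: "\<And>k. index_list (S k)" "\<And>k n. n \<in> set (S k) \<Longrightarrow> g k \<le> n \<and> n < g (Suc k)"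
  shows "(\<Sum>k<K. chain x (S k)) \<le> 2 * (nrm Jh x)\<^sup>2"
proof -
  have "index_list (concat (map S [0..<K])) \<and> (\<forall>n\<in>set (concat (map S [0..<K])). n < g K) \<and>
     (\<Sum>k<K. chain x (S k)) \<le> chain x (concat (map S [0..<K]))"
  proof (induction K)
    case (Suc K)
    have lt: "n < g (Suc K)" if "n \<in> set (concat (map S [0..<K])) \<union> set (S K)" for n
      using that Suc S(2)[of n K] g[of K] by (auto intro: less_trans)
    have "index_list (concat (map S [0..<K]) @ S K)"
      using Suc S(1)[of K] S(2)[of _ K] by (force simp: sorted_wrt_append intro: less_le_trans)
    moreover have "(\<Sum>k<Suc K. chain x (S k)) \<le> chain x (concat (map S [0..<K]) @ S K)"
      using Suc chain_append[of x "concat (map S [0..<K])" "S K"] by simp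
    ultimately show ?case using lt by simp
  qed simp
  with chain_le[OF x] show ?thesis by (meson order_trans)
qed

text \<open>The functionals \<open>f k\<close> give a projection \<open>P x = \<Sum> f k x z k\<close>, bounded because
  \<open>\<Sum> (norm (f k x))\<^sup>2 \<le> (16 nrm x)\<^sup>2\<close>. The operator \<open>U x = x + \<Sum> f k x (w k - z k)\<close> maps \<open>P x\<close>
  to \<open>\<Sum> f k x w k\<close>, which lies in \<open>M\<close>. It is invertible since its distance to the identity is
  at most \<open>\<Sum> 16 (1/2) ^ k / 64 = 1/2\<close>; this is the origin of the constant 64.\<close>

lemma complemented_of_blocks:
  assumes M: "closed_subspace Jh M"
    and g: "\<And>k. g k < g (Suc k)"
    and w: "\<And>k. w k \<in> M"
    and z: "\<And>k. z k \<in> carr Jh" "\<And>k. nrm Jh (z k) \<le> 2"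
    and supp: "\<And>k n. n \<le> g k \<or> g (Suc k) \<le> n \<Longrightarrow> z k n = zer (X n)"
    and S: "\<And>k. index_list (S k)" "\<And>k n. n \<in> set (S k) \<Longrightarrow> g k \<le> n \<and> n < g (Suc k)"
      "\<And>k. 1 / 8 \<le> chain (z k) (S k)"
    and close: "\<And>k. nrm Jh (vdiff Jh (w k) (z k)) \<le> (1 / 2) ^ k / 64"
  shows "\<exists>N\<subseteq>M. lin_subspace Jh N \<and> \<not> finite_dim (subsp Jh N) \<and> complemented Jh N"
proof -
  note M' = J.closed_subspaceD[OF M] and wJ = lin_subspaceD(1)[OF J.closed_subspaceD(1)[OF M] w]
  have mono: "i \<le> j \<Longrightarrow> g i \<le> g j" for i j
    by (rule lift_Suc_mono_le[of g]) (use g in \<open>auto intro: less_imp_le\<close>)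
  \<comment> \<open>Indices before \<open>g 0\<close> are assigned to the block 0, which vanishes there.\<close>
  define \<kappa> where "\<kappa> n = (LEAST k. n < g (Suc k))" for n
  have \<kappa>: "\<kappa> n = k" if "g k \<le> n" "n < g (Suc k)" for n k
    unfolding \<kappa>_def
  proof (rule Least_equality)
    show "k \<le> j" if j: "n < g (Suc j)" for j
      using mono[of "Suc j" k] j \<open>g k \<le> n\<close> by (force simp: not_less_eq_eq[symmetric])
  qed (use that in simp)
  have disj: "z j n = zer (X n)" if "\<kappa> n \<noteq> j" for j n
    using supp[of n j] \<kappa>[of j n] that by (meson less_imp_le not_le)
  have "\<exists>f. \<forall>k. (\<forall>x\<in>fam. \<forall>y\<in>fam. f k (add Jh x y) = f k x + f k y) \<and>
      (\<forall>a. \<forall>x\<in>fam. f k (scl Jh a x) = a * f k x) \<and>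
      (\<forall>x\<in>fam. (norm (f k x))\<^sup>2 \<le> 128 * chain x (S k)) \<and> f k (z k) = (1::'k)"
  proof (intro choice allI)
    fix k
    have "z k \<in> fam" using z by simp
    from normalized_chain_functional[OF this S(1,3)] show "\<exists>f.
      (\<forall>x\<in>fam. \<forall>y\<in>fam. f (add Jh x y) = f x + f y) \<and> (\<forall>a. \<forall>x\<in>fam. f (scl Jh a x) = a * f x) \<and>
      (\<forall>x\<in>fam. (norm (f x))\<^sup>2 \<le> 128 * chain x (S k)) \<and> f (z k) = (1::'k)" by metis
  qed
  then obtain f where f: "\<And>k x y. \<lbrakk>x \<in> fam; y \<in> fam\<rbrakk> \<Longrightarrow> f k (add Jh x y) = f k x + f k y"
    "\<And>k a x. x \<in> fam \<Longrightarrow> f k (scl Jh a x) = a * f k x"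
    "\<And>k x. x \<in> fam \<Longrightarrow> (norm (f k x))\<^sup>2 \<le> 128 * chain x (S k)" "\<And>k. f k (z k) = (1::'k)" by blast
  have f_local: "f k x = f k y"
    if "x \<in> fam" "y \<in> fam" "\<And>n. n \<in> set (S k) \<Longrightarrow> x n = y n" for k x y
  proof -
    have d: "vdiff Jh x y \<in> fam" using that by simp
    have "chain (vdiff Jh x y) (S k) = 0"
      by (rule chain_zer[OF S(1) d]) (use that in \<open>simp add: Jh_app\<close>)
    with f(3)[OF d, of k] have "f k (vdiff Jh x y) = 0" by simp
    moreover have "add Jh (vdiff Jh x y) y = x" using that by (auto intro!: ext simp: Jh_app)
    ultimately show ?thesis using f(1)[OF d that(2), of k] by simp
  qed
  have f_sum: "(\<Sum>k<K. (norm (f k x))\<^sup>2) \<le> (16 * nrm Jh x)\<^sup>2" if x: "x \<in> carr Jh" for K x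
  proof -
    have "(\<Sum>k<K. (norm (f k x))\<^sup>2) \<le> (\<Sum>k<K. 128 * chain x (S k))"
      by (rule sum_mono) (use f(3) x in simp)
    also have "\<dots> \<le> 128 * (2 * (nrm Jh x)\<^sup>2)"
      using sum_chain_le[where S = S and g = g, OF x g S(1,2), of K] by (simp flip: sum_distrib_left)
    finally show ?thesis by (simp add: power_mult_distrib)
  qed
  have f_le: "norm (f k x) \<le> 16 * nrm Jh x" if x: "x \<in> carr Jh" for k x
  proof -
    have "(norm (f k x))\<^sup>2 \<le> (\<Sum>k<Suc k. (norm (f k x))\<^sup>2)"
      by (rule member_le_sum[where f = "\<lambda>k. (norm (f k x))\<^sup>2"]) auto
    also have "\<dots> \<le> (16 * nrm Jh x)\<^sup>2" by (rule f_sum[OF x])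
    finally show ?thesis by (rule power2_le_imp_le) (use x in \<open>simp add: J.nrm_nonneg\<close>)
  qed
  have zf: "z k \<in> fam" for k using z by simp
  have f_synth: "f k (synth \<kappa> z a) = a k" for k a
  proof -
    have "f k (synth \<kappa> z a) = f k (scl Jh (a k) (z k))"
      by (rule f_local) (use zf \<kappa> S(2)[of _ k] in \<open>auto simp: synth_def Jh_app\<close>)
    then show ?thesis using zf f by simp
  qed
  define P where "P x = synth \<kappa> z (\<lambda>k. f k x)" for x
  have P_Jh: "P x \<in> carr Jh" "nrm Jh (P x) \<le> 3 * (16 * nrm Jh x)" if x: "x \<in> carr Jh" for x
    unfolding P_def using synth_Jh[where z = z and \<kappa> = \<kappa>, OF z disj _ f_sum[OF x]] x
    by (auto simp: J.nrm_nonneg)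
  have P: "operator Jh Jh P"
  proof (rule operatorI)
    show "nrm Jh (P x) \<le> 48 * nrm Jh x" if "x \<in> carr Jh" for x using P_Jh(2)[OF that] by simp
  qed (use P_Jh f zf in \<open>auto simp: P_def synth_def Jh_app X.scl_add_left X.scl_scl intro!: ext\<close>)
  have PP: "P (P x) = P x" for x
    by (simp add: P_def f_synth)
  have Pz: "P (z k) = z k" for k
  proof -
    have "f j (z k) = of_bool (j = k)" for j
    proof (cases "j = k")
      case False
      have "f j (z k) = f j (scl Jh 0 (z k))"
      proof (rule f_local)
        fix n assume n: "n \<in> set (S j)"
        then have "\<kappa> n = j" using \<kappa>[of j n] S(2)[of n j] by blast
        then show "z k n = scl Jh 0 (z k) n" using False zf disj[of n k] by (simp add: Jh_app)
      qed (use zf in simp_all)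
      with False zf f show ?thesis by simp
    qed (use f in simp)
    then show ?thesis using zf disj[of _ k] by (auto simp: P_def synth_def X.scl_one intro!: ext)
  qed
  define v where "v k = vdiff Jh (w k) (z k)" for k
  have v: "v k \<in> carr Jh" for k using wJ z by (simp add: v_def)
  define b where "b x k = (16 * nrm Jh x / 64) * (1 / 2) ^ k" for x and k :: nat
  have "\<exists>l. l \<in> carr Jh \<and> converges_to Jh (psum Jh (\<lambda>k. scl Jh (f k x) (v k))) l \<and>
      nrm Jh l \<le> 1 / 2 * nrm Jh x" if x: "x \<in> carr Jh" for x
  proof -
    have "nrm Jh (scl Jh (f k x) (v k)) \<le> b x k" for k
    proof -
      have "nrm Jh (scl Jh (f k x) (v k)) = norm (f k x) * nrm Jh (v k)" using v by (simp add: J.nrm_scl)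
      also have "\<dots> \<le> (16 * nrm Jh x) * ((1 / 2) ^ k / 64)"
        by (rule mult_mono) (use f_le[OF x] close v x in \<open>auto simp: v_def J.nrm_nonneg\<close>)
      finally show ?thesis by (simp add: b_def)
    qed
    moreover have "b x sums (16 * nrm Jh x / 64 * 2)"
      unfolding b_def by (rule sums_mult) (use geometric_sums[of "1 / 2 :: real"] in simp)
    ultimately show ?thesis
      using J.series_converges[of "\<lambda>k. scl Jh (f k x) (v k)" "b x"] v sums_summable[of "b x"] sums_unique[of "b x"]
      by force
  qed
  then have "\<exists>K. \<forall>x. x \<in> carr Jh \<longrightarrow> K x \<in> carr Jh \<and>
      converges_to Jh (psum Jh (\<lambda>k. scl Jh (f k x) (v k))) (K x) \<and> nrm Jh (K x) \<le> 1 / 2 * nrm Jh x"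
    by (intro choice allI) blast
  then obtain K where K: "\<And>x. x \<in> carr Jh \<Longrightarrow> K x \<in> carr Jh"
    "\<And>x. x \<in> carr Jh \<Longrightarrow> converges_to Jh (psum Jh (\<lambda>k. scl Jh (f k x) (v k))) (K x)"
    "\<And>x. x \<in> carr Jh \<Longrightarrow> nrm Jh (K x) \<le> 1 / 2 * nrm Jh x" by blast
  have psum_J: "psum Jh (\<lambda>k. scl Jh (a k) (v k)) n \<in> carr Jh" for a n using v by simp
  have K_op: "operator Jh Jh K"
  proof (rule operatorI[of _ _ _ "1 / 2"])
    fix x y assume xy: "x \<in> carr Jh" "y \<in> carr Jh"
    have "converges_to Jh (\<lambda>n. add Jh (psum Jh (\<lambda>k. scl Jh (f k x) (v k)) n) (psum Jh (\<lambda>k. scl Jh (f k y) (v k)) n))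
       (add Jh (K x) (K y))"
      by (rule J.converges_to_add) (use K xy psum_J in auto)
    moreover have "add Jh (psum Jh (\<lambda>k. scl Jh (f k x) (v k)) n) (psum Jh (\<lambda>k. scl Jh (f k y) (v k)) n)
       = psum Jh (\<lambda>k. scl Jh (f k (add Jh x y)) (v k)) n" for n
      using v xy by (simp add: f J.scl_add_left flip: J.psum_add)
    ultimately have "converges_to Jh (psum Jh (\<lambda>k. scl Jh (f k (add Jh x y)) (v k))) (add Jh (K x) (K y))"
      by simp
    from J.converges_to_unique[OF K(2)[OF J.add_closed[OF xy]] this psum_J]
    show "K (add Jh x y) = add Jh (K x) (K y)" using K(1) xy J.add_closed by simp
  next
    fix a x assume x: "x \<in> carr Jh"
    have "operator Jh Jh (scl Jh a)"
      by (rule operatorI[of _ _ _ "norm a"])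
        (simp_all add: J.scl_add_right J.scl_scl J.nrm_scl mult.commute)
    from J.converges_to_operator[OF J.normed_space_axioms this K(2)[OF x] psum_J K(1)[OF x]]
    have "converges_to Jh (\<lambda>n. scl Jh a (psum Jh (\<lambda>k. scl Jh (f k x) (v k)) n)) (scl Jh a (K x))" .
    moreover have "scl Jh a (psum Jh (\<lambda>k. scl Jh (f k x) (v k)) n)
       = psum Jh (\<lambda>k. scl Jh (f k (scl Jh a x)) (v k)) n" for n
      using v x by (simp add: f J.scl_scl flip: J.psum_scl)
    ultimately have "converges_to Jh (psum Jh (\<lambda>k. scl Jh (f k (scl Jh a x)) (v k))) (scl Jh a (K x))"
      by simp
    from J.converges_to_unique[OF K(2)[OF J.scl_closed[OF x]] this psum_J]
    show "K (scl Jh a x) = scl Jh a (K x)" using K(1) x J.scl_closed by simp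
  qed (use K in auto)
  define U where "U x = add Jh x (K x)" for x
  have U: "isomorphism Jh Jh U"
    unfolding U_def by (rule J.perturbation_of_identity[OF K_op K(3)])
  then have U_op: "operator Jh Jh U" and U_inj: "inj_on U (carr Jh)"
    by (auto simp: isomorphism_def bij_betw_def)
  define N where "N = U ` P ` carr Jh"
  have "complemented Jh N"
    unfolding N_def by (rule complemented_isomorphic_image[OF J.normed_space_axioms U P PP])
  moreover have N: "lin_subspace Jh N"
    unfolding N_def
    by (intro lin_subspace_image[OF J.normed_space_axioms J.normed_space_axioms U_op]
        lin_subspace_image[OF J.normed_space_axioms J.normed_space_axioms P]) (simp add: lin_subspace_def)
  moreover have "N \<subseteq> M"
  proof
    fix u assume "u \<in> N"
    then obtain y where y: "y \<in> carr Jh" "P y = y" "u = U y" unfolding N_def using PP P_Jh by blast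
    let ?c = "\<lambda>k. f k y"
    have head: "psum Jh (\<lambda>k. scl Jh (?c k) (z k)) n = synth \<kappa> z (\<lambda>k. if k < n then ?c k else 0)" for n
      by (rule psum_synth[OF zf disj])
    have summable: "summable (\<lambda>k. (norm (?c k))\<^sup>2)"
      by (rule summableI_nonneg_bounded[of _ "(16 * nrm Jh y)\<^sup>2"]) (use f_sum[OF y(1)] in auto)
    define t where "t n = sqrt (\<Sum>k. (norm (?c (k + n)))\<^sup>2)" for n
    have "(\<lambda>n. \<Sum>k. (norm (?c (k + n)))\<^sup>2) \<longlonglongrightarrow> 0"
      by (rule suminf_exist_split2[OF summable])
    from tendsto_mult_left[OF tendsto_real_sqrt[OF this], of 3]
    have t0: "(\<lambda>n. 3 * t n) \<longlonglongrightarrow> 0" by (simp add: t_def)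
    \<comment> \<open>The remainder of the series \<open>\<Sum> f k y z k\<close> is of the form \<open>synth\<close> again, with the first \<open>n\<close>
      coefficients removed, so it is controlled by the remainder of \<open>\<Sum> (norm (f k y))\<^sup>2\<close>.\<close>
    have tail: "nrm Jh (vdiff Jh (psum Jh (\<lambda>k. scl Jh (?c k) (z k)) n) y) \<le> 3 * t n" for n
    proof -
      let ?a = "\<lambda>k. if k < n then 0 else - ?c k"
      have "vdiff Jh (psum Jh (\<lambda>k. scl Jh (?c k) (z k)) n) (P y) = synth \<kappa> z ?a"
        unfolding head P_def using zf
        by (auto simp: synth_def Jh_app vdiff_def X.scl_scl simp flip: X.scl_add_left intro!: ext)
      moreover have "nrm Jh (synth \<kappa> z ?a) \<le> 3 * t n"
      proof (rule synth_Jh(2)[where z = z and \<kappa> = \<kappa>, OF z disj])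
        have sum_n: "summable (\<lambda>k. (norm (?c (k + n)))\<^sup>2)"
          by (rule summable_ignore_initial_segment[OF summable])
        have t2: "(t n)\<^sup>2 = (\<Sum>k. (norm (?c (k + n)))\<^sup>2)"
          unfolding t_def by (rule real_sqrt_pow2) (rule suminf_nonneg[OF sum_n], simp)
        fix L
        have "(\<Sum>j<L. (norm (?a j))\<^sup>2) \<le> (\<Sum>j<n + L. (norm (?a j))\<^sup>2)"
          by (rule sum_mono2) auto
        also have "\<dots> = (\<Sum>j<L. (norm (?c (j + n)))\<^sup>2)"
          by (induction L) (simp_all add: add.commute)
        also have "\<dots> \<le> (\<Sum>k. (norm (?c (k + n)))\<^sup>2)" by (rule sum_le_suminf[OF sum_n]) auto
        finally show "(\<Sum>j<L. (norm (?a j))\<^sup>2) \<le> (t n)\<^sup>2" by (simp only: t2)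
      next
        show "0 \<le> t n"
          unfolding t_def
          by (intro real_sqrt_ge_zero suminf_nonneg summable_ignore_initial_segment[OF summable]) simp
      qed
      ultimately show ?thesis using y(2) by simp
    qed
    have "converges_to Jh (psum Jh (\<lambda>k. scl Jh (?c k) (z k))) y"
      unfolding converges_to_def
    proof (rule Lim_null_comparison[OF _ t0])
      show "\<forall>\<^sub>F n in sequentially. norm (nrm Jh (vdiff Jh (psum Jh (\<lambda>k. scl Jh (?c k) (z k)) n) y)) \<le> 3 * t n"
        using tail z y(1) by (simp add: J.nrm_nonneg)
    qed
    then have "converges_to Jh (\<lambda>n. add Jh (psum Jh (\<lambda>k. scl Jh (?c k) (z k)) n)
        (psum Jh (\<lambda>k. scl Jh (?c k) (v k)) n)) (U y)"
      unfolding U_def by (rule J.converges_to_add) (use K y z v in auto)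
    moreover have "add Jh (psum Jh (\<lambda>k. scl Jh (?c k) (z k)) n) (psum Jh (\<lambda>k. scl Jh (?c k) (v k)) n)
        = psum Jh (\<lambda>k. scl Jh (?c k) (w k)) n" for n
      using z v wJ by (simp add: v_def flip: J.psum_add J.scl_add_right)
    ultimately have "converges_to Jh (psum Jh (\<lambda>k. scl Jh (?c k) (w k))) (U y)" by simp
    then show "u \<in> M"
      unfolding y(3)
      by (rule M'(2)) (use w y U_op lin_subspaceD[OF M'(1)] lin_subspace_psum[OF M'(1)] in
          \<open>auto simp: operatorD\<close>)
  qed
  moreover have "\<not> finite_dim (subsp Jh N)"
  proof
    assume "finite_dim (subsp Jh N)"
    then obtain n where n: "\<And>u. (\<And>j. u j \<in> N) \<Longrightarrow>
        \<exists>a. (\<exists>j<n. a j \<noteq> 0) \<and> psum Jh (\<lambda>j. scl Jh (a j) (u j)) n = zer Jh"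
      using finite_dim_dependent[OF normed_space_subsp[OF J.normed_space_axioms N]] by (simp; metis)
    have "U (z j) \<in> N" for j unfolding N_def using Pz z by (metis imageI)
    from n[of "\<lambda>j. U (z j)", OF this] obtain a k where a: "k < n" "a k \<noteq> 0"
      "psum Jh (\<lambda>j. scl Jh (a j) (U (z j))) n = zer Jh" by blast
    define y where "y = psum Jh (\<lambda>j. scl Jh (a j) (z j)) n"
    have y: "y \<in> carr Jh" using z by (simp add: y_def)
    have "U y = psum Jh (\<lambda>j. U (scl Jh (a j) (z j))) n"
      unfolding y_def by (rule operator_psum[OF J.normed_space_axioms J.normed_space_axioms U_op]) (use z in simp)
    also have "\<dots> = zer Jh" using a(3) z by (simp add: operatorD(3)[OF U_op])
    also have "\<dots> = U (zer Jh)" using operator_zer[OF J.normed_space_axioms J.normed_space_axioms U_op] by simp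
    finally have y0: "y = zer Jh" using U_inj y J.zer_closed by (simp add: inj_on_eq_iff)
    have "y = synth \<kappa> z (\<lambda>j. if j < n then a j else 0)"
      unfolding y_def by (rule psum_synth[OF zf disj])
    then have "a k = f k (zer Jh)" using f_synth[of k "\<lambda>j. if j < n then a j else 0"] y0 a(1) by simp
    also have "\<dots> = 0" using f(2)[of "zer Jh" k 0] by simp
    finally show False using a(2) by simp
  qed
  ultimately show ?thesis by blast
qed

section \<open>Vectors with small truncation close to the null sequences\<close>

text \<open>The vector \<open>e j\<close> is almost invisible to \<open>trunc (m j)\<close> and half visible to
  \<open>trunc (m (Suc j))\<close>. Applying \<open>trunc (m (Suc j))\<close> to \<open>x\<close> therefore bounds the \<open>j\<close>-th coefficient
  by the earlier ones, up to a small error from the later ones. The resulting bounds grow like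
  \<open>3 ^ j\<close>, and the weights \<open>\<eta> / (4 6 ^ j)\<close> are chosen to absorb this growth.\<close>

lemma coefficient_bounds:
  assumes e: "\<And>j. e j \<in> carr Jh" "\<And>j. nrm Jh (e j) = 1"
    and m: "\<And>j. m j \<le> m (Suc j)"
    and small: "\<And>j. nrm Jh (trunc (m j) (e j)) \<le> \<eta> / (4 * 6 ^ j)"
    and large: "\<And>j. 1 / 2 < nrm Jh (trunc (m (Suc j)) (e j))"
    and \<eta>: "0 < \<eta>" "\<eta> \<le> 1 / 2"
    and x: "x = psum Jh (\<lambda>j. scl Jh (a j) (e j)) n"
  shows "nrm Jh (trunc (m 0) x) \<le> 2 * \<eta> * nrm Jh x"
    and "\<lbrakk>x = zer Jh; j < n\<rbrakk> \<Longrightarrow> a j = 0"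
proof -
  define A where "A j = norm (a j)" for j
  define \<delta> where "\<delta> j = \<eta> / (4 * 6 ^ j)" for j :: nat
  define \<tau> where "\<tau> = (\<Sum>j<n. A j * \<delta> j)"
  have A: "0 \<le> A j" for j by (simp add: A_def)
  have \<delta>: "0 \<le> \<delta> j" for j using \<eta> by (simp add: \<delta>_def)
  have xJ: "x \<in> carr Jh" using e by (simp add: x)
  have mono: "i \<le> j \<Longrightarrow> m i \<le> m j" for i j by (rule lift_Suc_mono_le[of m]) (use m in auto)
  have trunc_x: "trunc k x = psum Jh (\<lambda>j. scl Jh (a j) (trunc k (e j))) n" for k
    unfolding x using operator_psum[OF J.normed_space_axioms J.normed_space_axioms trunc_operator, of "\<lambda>j. scl Jh (a j) (e j)"] e
    by (simp add: trunc_scl)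
  have earlier: "nrm Jh (trunc (m i) (e j)) \<le> \<delta> j" if "i \<le> j" for i j
    using nrm_trunc_mono[OF mono[OF that] e(1)[of j]] small[of j] by (simp add: \<delta>_def)
  \<comment> \<open>The growth bounds involve the error \<open>\<tau>\<close>, which they bound in turn by \<open>\<eta> b\<close>; because of
    \<open>\<eta> \<le> 1/2\<close> the term \<open>\<tau>\<close> on the right can be absorbed.\<close>
  define b where "b = nrm Jh x + \<tau>"
  have "A j \<le> 2 * b + 2 * (\<Sum>i<j. A i)" if j: "j < n" for j
  proof -
    let ?v = "\<lambda>i. scl Jh (a i) (trunc (m (Suc j)) (e i))"
    have v: "?v i \<in> carr Jh" "nrm Jh (?v i) = A i * nrm Jh (trunc (m (Suc j)) (e i))" for i
      using trunc_Jh(1)[OF e(1)] by (simp_all add: A_def J.nrm_scl)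
    have v_le: "nrm Jh (?v i) \<le> (if i < j then A i else 0) + A i * \<delta> i" if "i \<noteq> j" for i
    proof (cases "i < j")
      case True
      have "nrm Jh (?v i) \<le> A i * 1"
        unfolding v(2) using trunc_Jh(2)[OF e(1), of "m (Suc j)" i] e(2) A by (intro mult_left_mono) auto
      moreover have "0 \<le> A i * \<delta> i" using A \<delta> by simp
      ultimately show ?thesis using True by simp
    next
      case False
      then have "nrm Jh (?v i) \<le> A i * \<delta> i"
        unfolding v(2) using that A by (intro mult_left_mono earlier) auto
      with False show ?thesis by simp
    qed
    have "A j * (1 / 2) \<le> nrm Jh (?v j)"
      unfolding v(2) using large[of j] A by (intro mult_left_mono) auto
    also have "\<dots> \<le> nrm Jh (trunc (m (Suc j)) x) + (\<Sum>i\<in>{..<n} - {j}. nrm Jh (?v i))"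
      unfolding trunc_x by (rule J.nrm_psum_ge[OF v(1) j])
    also have "\<dots> \<le> nrm Jh x + (\<Sum>i\<in>{..<n}. (if i < j then A i else 0) + A i * \<delta> i)"
    proof (rule add_mono[OF trunc_Jh(2)[OF xJ]])
      have "(\<Sum>i\<in>{..<n} - {j}. nrm Jh (?v i)) \<le> (\<Sum>i\<in>{..<n} - {j}. (if i < j then A i else 0) + A i * \<delta> i)"
        by (rule sum_mono) (use v_le in auto)
      also have "\<dots> \<le> (\<Sum>i\<in>{..<n}. (if i < j then A i else 0) + A i * \<delta> i)"
        by (rule sum_mono2) (use A \<delta> in auto)
      finally show "(\<Sum>i\<in>{..<n} - {j}. nrm Jh (?v i)) \<le> (\<Sum>i\<in>{..<n}. (if i < j then A i else 0) + A i * \<delta> i)" .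
    qed
    also have "(\<Sum>i\<in>{..<n}. (if i < j then A i else 0) + A i * \<delta> i) = (\<Sum>i<j. A i) + \<tau>"
    proof -
      have "(\<Sum>i\<in>{..<n}. if i < j then A i else 0) = (\<Sum>i<j. A i)"
        by (rule sum.mono_neutral_cong_right) (use j in auto)
      then show ?thesis by (simp add: sum.distrib \<tau>_def)
    qed
    finally show ?thesis by (simp add: b_def)
  qed
  then have growth: "A j \<le> 2 * 3 ^ j * b" if "j < n" for j
    using geometric_growth[of n A b j] that by blast
  have b: "0 \<le> b" using xJ A \<delta> by (simp add: b_def \<tau>_def J.nrm_nonneg sum_nonneg)
  have "\<tau> \<le> (\<Sum>j<n. b * \<eta> / 2 * (1 / 2) ^ j)"
    unfolding \<tau>_def
  proof (rule sum_mono)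
    fix j assume "j \<in> {..<n}"
    then have "A j * \<delta> j \<le> 2 * 3 ^ j * b * \<delta> j" using growth \<delta> by (intro mult_right_mono) auto
    also have "\<dots> = b * \<eta> / 2 * (1 / 2) ^ j"
    proof -
      have "(6 :: real) ^ j = 3 ^ j * 2 ^ j" by (simp flip: power_mult_distrib)
      then show ?thesis by (simp add: \<delta>_def power_divide field_simps)
    qed
    finally show "A j * \<delta> j \<le> b * \<eta> / 2 * (1 / 2) ^ j" .
  qed
  also have "\<dots> = b * \<eta> / 2 * (\<Sum>j<n. (1 / 2) ^ j)" by (simp add: sum_distrib_left)
  also have "\<dots> \<le> b * \<eta> / 2 * 2"
    by (rule mult_left_mono[OF sum_half_powers_le]) (use b \<eta> in simp)
  finally have "\<tau> \<le> \<eta> * nrm Jh x + \<eta> * \<tau>" by (simp add: b_def algebra_simps)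
  moreover have "0 \<le> \<tau>" using A \<delta> by (simp add: \<tau>_def sum_nonneg)
  moreover from this have "\<eta> * \<tau> \<le> 1 / 2 * \<tau>" using \<eta> by (intro mult_right_mono) auto
  ultimately have \<tau>: "\<tau> \<le> 2 * \<eta> * nrm Jh x" by simp
  have "nrm Jh (trunc (m 0) x) \<le> (\<Sum>j<n. nrm Jh (scl Jh (a j) (trunc (m 0) (e j))))"
    unfolding trunc_x by (rule J.nrm_psum_le) (use trunc_Jh e in simp)
  also have "\<dots> \<le> \<tau>"
    unfolding \<tau>_def
  proof (rule sum_mono)
    fix j
    have "nrm Jh (scl Jh (a j) (trunc (m 0) (e j))) = A j * nrm Jh (trunc (m 0) (e j))"
      using trunc_Jh(1)[OF e(1)] by (simp add: A_def J.nrm_scl)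
    also have "\<dots> \<le> A j * \<delta> j" using earlier[of 0 j] A by (intro mult_left_mono) auto
    finally show "nrm Jh (scl Jh (a j) (trunc (m 0) (e j))) \<le> A j * \<delta> j" .
  qed
  finally show "nrm Jh (trunc (m 0) x) \<le> 2 * \<eta> * nrm Jh x" using \<tau> by simp
  show "a j = 0" if "x = zer Jh" "j < n"
  proof -
    have "b = 0" using that(1) \<tau> \<open>0 \<le> \<tau>\<close> by (simp add: b_def)
    with growth[OF that(2)] A[of j] show ?thesis by (simp add: A_def)
  qed
qed

text \<open>The vectors of the preceding lemma span an infinite-dimensional subspace on which
  \<open>trunc n\<close> is small. The bound persists on its closure, and there strict singularity
  supplies a vector on which \<open>T\<close> is small as well.\<close>

lemma small_vectors:
  assumes M: "closed_subspace Jh M" and T: "strictly_singular Jh F T"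
    and flat: "\<And>m d. 0 < d \<Longrightarrow> \<exists>x\<in>M. nrm Jh x = 1 \<and> nrm Jh (trunc m x) < d"
    and \<epsilon>: "0 < \<epsilon>"
  shows "\<exists>x\<in>M. nrm Jh (trunc n x) \<le> \<epsilon> * nrm Jh x \<and> nrm F (T x) < \<epsilon> * nrm Jh x"
proof -
  define \<eta> where "\<eta> = min \<epsilon> 1 / 2"
  have \<eta>: "0 < \<eta>" "\<eta> \<le> 1 / 2" "2 * \<eta> \<le> \<epsilon>" using \<epsilon> by (auto simp: \<eta>_def)
  define \<delta> where "\<delta> j = \<eta> / (4 * 6 ^ j)" for j :: nat
  have \<delta>: "0 < \<delta> j" for j using \<eta> by (simp add: \<delta>_def)
  note MJ = lin_subspaceD(1)[OF J.closed_subspaceD(1)[OF M]]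
  \<comment> \<open>The pairs \<open>em j = (e j, m j)\<close> are chosen successively.\<close>
  have "\<exists>em. \<forall>j. (fst (em j) \<in> M \<and> nrm Jh (fst (em j)) = 1 \<and> nrm Jh (trunc (snd (em j)) (fst (em j))) < \<delta> j
      \<and> (j = 0 \<longrightarrow> snd (em j) = n)) \<and>
      (snd (em j) \<le> snd (em (Suc j)) \<and> 1 / 2 < nrm Jh (trunc (snd (em (Suc j))) (fst (em j))))"
  proof (rule dependent_nat_choice)
    obtain x where "x \<in> M" "nrm Jh x = 1" "nrm Jh (trunc n x) < \<delta> 0" using flat[OF \<delta>] by blast
    then show "\<exists>em. fst em \<in> M \<and> nrm Jh (fst em) = 1 \<and> nrm Jh (trunc (snd em) (fst em)) < \<delta> 0
      \<and> (0 = (0::nat) \<longrightarrow> snd em = n)" by (intro exI[of _ "(x, n)"]) simp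
    fix em j
    assume em: "fst em \<in> M \<and> nrm Jh (fst em) = 1 \<and> nrm Jh (trunc (snd em) (fst em)) < \<delta> j
      \<and> (j = 0 \<longrightarrow> snd em = n)"
    obtain m' where m': "snd em \<le> m'" "1 / 2 < nrm Jh (trunc m' (fst em))"
      using nrm_trunc_large[of "fst em" "1 / 2" "snd em"] em MJ by auto
    obtain x where "x \<in> M" "nrm Jh x = 1" "nrm Jh (trunc m' x) < \<delta> (Suc j)" using flat[OF \<delta>] by blast
    with m' show "\<exists>em'. (fst em' \<in> M \<and> nrm Jh (fst em') = 1 \<and>
        nrm Jh (trunc (snd em') (fst em')) < \<delta> (Suc j) \<and> (Suc j = 0 \<longrightarrow> snd em' = n)) \<and>
        snd em \<le> snd em' \<and> 1 / 2 < nrm Jh (trunc (snd em') (fst em))"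
      by (intro exI[of _ "(x, m')"]) simp
  qed
  then obtain em where em: "\<And>j. fst (em j) \<in> M" "\<And>j. nrm Jh (fst (em j)) = 1"
    "\<And>j. nrm Jh (trunc (snd (em j)) (fst (em j))) < \<delta> j" "snd (em 0) = n"
    "\<And>j. snd (em j) \<le> snd (em (Suc j))" "\<And>j. 1 / 2 < nrm Jh (trunc (snd (em (Suc j))) (fst (em j)))"
    by blast
  define e where "e j = fst (em j)" for j
  have e: "e j \<in> M" "e j \<in> carr Jh" for j using em(1) MJ by (auto simp: e_def)
  have coeff: "nrm Jh (trunc n x) \<le> 2 * \<eta> * nrm Jh x" "\<lbrakk>x = zer Jh; j < N\<rbrakk> \<Longrightarrow> a j = 0"
    if "x = psum Jh (\<lambda>j. scl Jh (a j) (e j)) N" for x a N j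
  proof -
    have 1: "nrm Jh (e j) = 1" "snd (em j) \<le> snd (em (Suc j))"
      "nrm Jh (trunc (snd (em j)) (e j)) \<le> \<eta> / (4 * 6 ^ j)"
      "1 / 2 < nrm Jh (trunc (snd (em (Suc j))) (e j))" for j
      using em(2,5,6)[of j] less_imp_le[OF em(3)[of j]] by (simp_all add: e_def \<delta>_def)
    note c = coefficient_bounds[of e "\<lambda>j. snd (em j)", OF e(2) 1(1,2,3,4) \<eta>(1,2) that]
    show "nrm Jh (trunc n x) \<le> 2 * \<eta> * nrm Jh x" using c(1) em(4) by simp
    show "a j = 0" if "x = zer Jh" "j < N" using c(2) that by blast
  qed
  define S where "S = {psum Jh (\<lambda>j. scl Jh (a j) (e j)) N | a N. True}"
  have S: "lin_subspace Jh S"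
    unfolding lin_subspace_def
  proof (intro conjI ballI allI)
    show "S \<subseteq> carr Jh" using e by (auto simp: S_def)
    show "zer Jh \<in> S" unfolding S_def by (intro CollectI exI[of _ 0] exI[of _ "\<lambda>_. 0"]) simp
    fix x assume "x \<in> S"
    then obtain a N where x: "x = psum Jh (\<lambda>j. scl Jh (a j) (e j)) N" by (auto simp: S_def)
    show "scl Jh c x \<in> S" for c
      unfolding S_def
      by (intro CollectI exI[of _ N] exI[of _ "\<lambda>j. c * a j"]) (simp add: x e J.scl_scl flip: J.psum_scl)
    fix y assume "y \<in> S"
    then obtain b K where y: "y = psum Jh (\<lambda>j. scl Jh (b j) (e j)) K" by (auto simp: S_def)
    define L where "L = max N K"
    have pad: "psum Jh (\<lambda>j. scl Jh (c j) (e j)) k = psum Jh (\<lambda>j. scl Jh (if j < k then c j else 0) (e j)) L"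
      if "k \<le> L" for c k
    proof -
      have "(\<lambda>j. scl Jh (if j < k then c j else 0) (e j)) = (\<lambda>j. if j < k then scl Jh (c j) (e j) else zer Jh)"
        using e by auto
      then show ?thesis using J.psum_pad[OF that, of "\<lambda>j. scl Jh (c j) (e j)"] e by simp
    qed
    have "add Jh x y = psum Jh (\<lambda>j. scl Jh ((if j < N then a j else 0) + (if j < K then b j else 0)) (e j)) L"
      unfolding x y using pad[of N a] pad[of K b] e by (simp add: L_def J.scl_add_left flip: J.psum_add)
    then show "add Jh x y \<in> S" unfolding S_def by (intro CollectI exI conjI TrueI)
  qed
  have SM: "S \<subseteq> M"
    using lin_subspace_psum[OF J.closed_subspaceD(1)[OF M]] lin_subspaceD(4)[OF J.closed_subspaceD(1)[OF M]] e
    by (auto simp: S_def)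
  obtain W where W: "closed_subspace Jh W" "S \<subseteq> W"
    "\<And>x d. \<lbrakk>x \<in> W; 0 < d\<rbrakk> \<Longrightarrow> \<exists>y\<in>S. nrm Jh (vdiff Jh x y) < d"
    using J.closure_subspace[OF S] by metis
  note W' = J.closed_subspaceD[OF W(1)]
  have infinite: "\<not> finite_dim (subsp Jh W)"
  proof
    assume "finite_dim (subsp Jh W)"
    then obtain N where N: "\<And>u. (\<And>j. u j \<in> W) \<Longrightarrow>
        \<exists>a. (\<exists>j<N. a j \<noteq> 0) \<and> psum Jh (\<lambda>j. scl Jh (a j) (u j)) N = zer Jh"
      using finite_dim_dependent[OF normed_space_subsp[OF J.normed_space_axioms W'(1)]] by (simp; metis)
    have "e k \<in> S" for k
    proof -
      have "psum Jh (\<lambda>j. scl Jh (of_bool (j = k)) (e j)) (Suc k) = e k"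
        using J.psum_single[of "\<lambda>j. scl Jh (of_bool (j = k)) (e j)" k "Suc k"] e by (simp add: J.scl_one)
      then show ?thesis unfolding S_def by (intro CollectI exI conjI TrueI) (rule sym)
    qed
    then have eW: "e j \<in> W" for j using W(2) by blast
    obtain a j where "j < N" "a j \<noteq> 0" "psum Jh (\<lambda>j. scl Jh (a j) (e j)) N = zer Jh"
      using N[of e, OF eW] by blast
    with coeff(2)[OF refl, of a N j] show False by simp
  qed
  obtain x where x: "x \<in> W" "nrm F (T x) < \<epsilon> * nrm Jh x"
    by (rule strictly_singular_small[OF J.normed_space_axioms T W(1) infinite \<epsilon>])
  have xJ: "x \<in> carr Jh" using lin_subspaceD(1)[OF W'(1) x(1)] .
  have "x \<in> M"
    by (rule J.closed_subspace_near[OF M xJ]) (use W(3)[OF x(1)] SM in blast)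
  moreover have "nrm Jh (trunc n x) \<le> \<epsilon> * nrm Jh x"
  proof (rule field_le_epsilon)
    fix d :: real assume d: "0 < d"
    then have "0 < d / (1 + \<epsilon>)" using \<epsilon> by simp
    then obtain y where y: "y \<in> S" "nrm Jh (vdiff Jh x y) < d / (1 + \<epsilon>)" using W(3)[OF x(1)] by blast
    have yJ: "y \<in> carr Jh" using y(1) lin_subspaceD(1)[OF S] by blast
    let ?r = "nrm Jh (vdiff Jh x y)"
    have "nrm Jh (trunc n x) \<le> nrm Jh (trunc n y) + nrm Jh (trunc n (vdiff Jh x y))"
      unfolding trunc_vdiff using xJ yJ by (intro J.nrm_le_vdiff trunc_Jh)
    also have "\<dots> \<le> 2 * \<eta> * nrm Jh y + ?r"
      using coeff(1)[of y] y(1) trunc_Jh(2)[of "vdiff Jh x y" n] xJ yJ by (intro add_mono) (auto simp: S_def)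
    also have "\<dots> \<le> \<epsilon> * nrm Jh y + ?r"
      using \<eta>(3) yJ by (simp add: mult_right_mono J.nrm_nonneg)
    also have "\<dots> \<le> \<epsilon> * (nrm Jh x + ?r) + ?r"
      using J.nrm_le_vdiff[OF yJ xJ] J.nrm_vdiff_commute[OF xJ yJ] \<epsilon> by simp
    also have "\<dots> = \<epsilon> * nrm Jh x + (1 + \<epsilon>) * ?r" by (simp add: algebra_simps)
    also have "(1 + \<epsilon>) * ?r \<le> d" using y(2) \<epsilon> by (simp add: pos_less_divide_eq mult.commute less_imp_le)
    finally show "nrm Jh (trunc n x) \<le> \<epsilon> * nrm Jh x + d" by simp
  qed
  ultimately show ?thesis using x(2) by blast
qed

lemma quotient_nrm_small:
  assumes "x \<in> carr Jh" "nrm (quotient_space Jh (Jset X \<phi>)) (qmap Jh (Jset X \<phi>) x) < r"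
  obtains y where "y \<in> Jset X \<phi>" "nrm Jh (vdiff Jh x y) < r" 
proof -
  note Js = lin_subspaceD[OF Jset_subspace]
  have ne: "nrm Jh ` qmap Jh (Jset X \<phi>) x \<noteq> {}" using Js(2) by (auto simp: qmap_def)
  have "bdd_below (nrm Jh ` qmap Jh (Jset X \<phi>) x)"
    by (rule bdd_belowI2[of _ 0]) (use assms(1) Js(1) in \<open>auto simp: qmap_def J.nrm_nonneg\<close>)
  with assms(2) ne obtain u where "u \<in> nrm Jh ` qmap Jh (Jset X \<phi>) x" "u < r"
    by (auto simp: quotient_space_def cInf_less_iff)
  then obtain k where k: "k \<in> Jset X \<phi>" "nrm Jh (add Jh x k) < r" by (auto simp: qmap_def)
  have "vdiff Jh x (scl Jh (-1) k) = add Jh x k"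
    using assms(1) Js(1)[OF k(1)] by (simp add: vdiff_def J.scl_scl J.scl_one)
  with k show ?thesis using that[of "scl Jh (-1) k"] Js(4) by simp
qed

lemma small_vectors_near_Jset:
  assumes M: "closed_subspace Jh M"
    and T: "strictly_singular Jh (quotient_space Jh (Jset X \<phi>)) (qmap Jh (Jset X \<phi>))"
    and flat: "\<And>m d. 0 < d \<Longrightarrow> \<exists>x\<in>M. nrm Jh x = 1 \<and> nrm Jh (trunc m x) < d"
    and \<epsilon>: "0 < \<epsilon>"
  obtains x y where "x \<in> M" "nrm Jh x = 1" "nrm Jh (trunc n x) \<le> \<epsilon>" "y \<in> Jset X \<phi>"
    "nrm Jh (vdiff Jh x y) \<le> \<epsilon>"
proof -
  obtain u where u: "u \<in> M" "nrm Jh (trunc n u) \<le> \<epsilon> * nrm Jh u"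
    "nrm (quotient_space Jh (Jset X \<phi>)) (qmap Jh (Jset X \<phi>) u) < \<epsilon> * nrm Jh u"
    using small_vectors[OF M T flat \<epsilon>] by blast
  note M' = lin_subspaceD[OF J.closed_subspaceD(1)[OF M]]
  have uJ: "u \<in> carr Jh" using M' u by blast
  obtain k where k: "k \<in> Jset X \<phi>" "nrm Jh (vdiff Jh u k) < \<epsilon> * nrm Jh u"
    by (rule quotient_nrm_small[OF uJ u(3)])
  have kJ: "k \<in> carr Jh" using k(1) by (simp add: Jset_def)
  have "0 < \<epsilon> * nrm Jh u" using k(2) J.nrm_nonneg[OF J.vdiff_closed[OF uJ kJ]] by linarith
  then have pos: "0 < nrm Jh u" using \<epsilon> by (simp add: zero_less_mult_iff)
  define c :: 'k where "c = of_real (1 / nrm Jh u)"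
  have c: "norm c = 1 / nrm Jh u" using pos by (simp add: c_def norm_divide)
  show ?thesis
  proof (rule that[of "scl Jh c u" "scl Jh c k"])
    show "nrm Jh (scl Jh c u) = 1" using uJ pos by (simp add: J.nrm_scl c)
    show "nrm Jh (trunc n (scl Jh c u)) \<le> \<epsilon>"
      using u(2) pos trunc_Jh(1)[OF uJ] by (simp add: trunc_scl J.nrm_scl c field_simps)
    show "nrm Jh (vdiff Jh (scl Jh c u) (scl Jh c k)) \<le> \<epsilon>"
      using k(2) pos uJ kJ by (simp add: J.nrm_scl c field_simps flip: J.scl_vdiff)
  qed (use M' u k lin_subspaceD(4)[OF Jset_subspace] in auto)
qed

section \<open>The two cases\<close>

text \<open>Cut out of an approximant \<open>y \<in> J\<close> of a unit vector with small truncation the part \<open>z\<close> between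
  \<open>g\<close> and some large \<open>m\<close>. A list that nearly norms \<open>z\<close> yields a large chain: if the final
  coordinate carries most of \<open>full z ps\<close>, then the single jump from \<open>g\<close>, where \<open>z\<close> vanishes,
  to that coordinate is large.\<close>

lemma block_step:
  assumes M: "lin_subspace Jh M"
    and small: "\<And>n e. 0 < e \<Longrightarrow> \<exists>x\<in>M. \<exists>y\<in>Jset X \<phi>. nrm Jh x = 1 \<and> nrm Jh (trunc n x) \<le> e \<and>
      nrm Jh (vdiff Jh x y) \<le> e"
    and \<epsilon>: "0 < \<epsilon>"
  shows "\<exists>w z S g'. g < g' \<and> w \<in> M \<and> z \<in> carr Jh \<and> nrm Jh z \<le> 2 \<and>
    (\<forall>n. n \<le> g \<or> g' \<le> n \<longrightarrow> z n = zer (X n)) \<and> index_list S \<and> (\<forall>n\<in>set S. g \<le> n \<and> n < g') \<and>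
    1 / 8 \<le> chain z S \<and> nrm Jh (vdiff Jh w z) \<le> \<epsilon>"
proof -
  define d where "d = min \<epsilon> (1 / 2) / 4"
  have d: "0 < d" "4 * d \<le> \<epsilon>" "4 * d \<le> 1 / 2" using \<epsilon> by (auto simp: d_def)
  obtain x y where xy: "x \<in> M" "y \<in> Jset X \<phi>" "nrm Jh x = 1" "nrm Jh (trunc g x) \<le> d"
    "nrm Jh (vdiff Jh x y) \<le> d" using small[OF d(1)] by blast
  have xJ: "x \<in> carr Jh" and yJ: "y \<in> carr Jh" using xy M by (auto simp: lin_subspace_def Jset_def)
  obtain m where m: "g < m" "nrm Jh (vdiff Jh y (trunc m y)) \<le> d" by (rule Jset_trunc_tendsto[OF xy(2) d(1)])
  define z where "z = vdiff Jh (trunc m y) (trunc g y)"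
  have tJ: "trunc k y \<in> carr Jh" for k by (rule trunc_Jh(1)[OF yJ])
  have zJ: "z \<in> carr Jh" using tJ by (simp add: z_def)
  have z_supp: "z n = zer (X n)" if "n \<le> g \<or> Suc m \<le> n" for n
    using that m(1) yJ by (auto simp: z_def Jh_app trunc_def)
  have "nrm Jh (trunc g y) \<le> nrm Jh (trunc g x) + nrm Jh (trunc g (vdiff Jh y x))"
    unfolding trunc_vdiff using xJ yJ by (intro J.nrm_le_vdiff trunc_Jh)
  also have "\<dots> \<le> d + d"
    using xy(4,5) trunc_Jh(2)[OF J.vdiff_closed[OF yJ xJ], of g] J.nrm_vdiff_commute[OF xJ yJ] by simp
  finally have "nrm Jh (vdiff Jh (trunc m y) z) \<le> 2 * d" using tJ by (simp add: z_def)
  then have xz: "nrm Jh (vdiff Jh x z) \<le> 4 * d"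
    using J.nrm_vdiff_triangle[OF xJ yJ zJ] J.nrm_vdiff_triangle[OF yJ tJ[of m] zJ] xy(5) m(2) by linarith
  have "nrm Jh z \<le> nrm Jh x + nrm Jh (vdiff Jh z x)" by (rule J.nrm_le_vdiff[OF zJ xJ])
  then have z2: "nrm Jh z \<le> 2" using xz d(3) xy(3) J.nrm_vdiff_commute[OF xJ zJ] by simp
  have z1: "1 / 2 \<le> nrm Jh z" using J.nrm_le_vdiff[OF xJ zJ] xz d(3) xy(3) by simp
  \<comment> \<open>As \<open>1/8 < (nrm z)\<^sup>2\<close>, some list has \<open>full z ps > 1/4\<close>; then the chain or the square of
    the last coordinate is at least \<open>1/8\<close>.\<close>
  obtain ps where ps: "index_list ps" "ps \<noteq> []" "2 * (sqrt (1 / 8))\<^sup>2 < full z ps"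
  proof (rule norming_list[OF zJ])
    have "sqrt (1 / 8) < 1 / 2" by (rule real_less_lsqrt) (simp_all add: power2_eq_square)
    then show "sqrt (1 / 8) < nrm Jh z" using z1 by simp
  qed auto
  have zf: "z \<in> fam" using zJ by simp
  have "\<exists>S. index_list S \<and> (\<forall>n\<in>set S. g \<le> n) \<and> 1 / 8 \<le> chain z S"
  proof (cases "1 / 8 \<le> chain z ps")
    case True
    let ?S = "g # filter (\<lambda>n. g < n) ps"
    have "chain z ps \<le> chain z ?S" by (rule chain_prefix_zer[OF zf _ ps(1)]) (use z_supp in auto)
    with True ps(1) show ?thesis by (intro exI[of _ ?S]) (auto simp: sorted_wrt_filter)
  next
    case False
    let ?q = "last ps"
    have big: "1 / 8 \<le> (nrm (X ?q) (z ?q))\<^sup>2" using ps(3) False by (simp add: full_def)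
    have "g < ?q"
    proof (rule ccontr)
      assume "\<not> g < ?q"
      then have "z ?q = zer (X ?q)" using z_supp by simp
      with big show False by simp
    qed
    moreover from this have "nrm (X ?q) (jump g ?q z) = nrm (X ?q) (z ?q)"
      using zf z_supp by (simp add: nrm_jump_from_zer)
    ultimately show ?thesis using big by (intro exI[of _ "[g, ?q]"]) simp
  qed
  then obtain S where S: "index_list S" "\<And>n. n \<in> set S \<Longrightarrow> g \<le> n" "1 / 8 \<le> chain z S" by blast
  define g' where "g' = max (Suc m) (Suc (Max (set S)))"
  have "n < g'" if "n \<in> set S" for n using that by (simp add: g'_def less_Suc_eq_le max.coboundedI2)
  moreover have "z n = zer (X n)" if "n \<le> g \<or> g' \<le> n" for n
  proof -
    have "Suc m \<le> g'" by (simp add: g'_def)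
    then show ?thesis using z_supp[of n] that by linarith
  qed
  moreover have "g < g'" using m(1) by (simp add: g'_def)
  moreover have "nrm Jh (vdiff Jh x z) \<le> \<epsilon>" using xz d(2) by simp
  ultimately show ?thesis using xy(1) zJ z2 S by (intro exI[of _ x] exI[of _ z] exI[of _ S] exI[of _ g']) simp
qed

lemma complemented_of_flat:
  assumes M: "closed_subspace Jh M"
    and small: "\<And>n e. 0 < e \<Longrightarrow> \<exists>x\<in>M. \<exists>y\<in>Jset X \<phi>. nrm Jh x = 1 \<and> nrm Jh (trunc n x) \<le> e \<and>
      nrm Jh (vdiff Jh x y) \<le> e"
  shows "\<exists>N\<subseteq>M. lin_subspace Jh N \<and> \<not> finite_dim (subsp Jh N) \<and> complemented Jh N"
proof -
  \<comment> \<open>A state consists of a block and the right end of its interval, where the next interval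
    starts. The state with number 0 serves only to provide the first left end.\<close>
  define Q where "Q k g s \<longleftrightarrow> (case s of (w, z, S, g') \<Rightarrow> g < g' \<and> w \<in> M \<and> z \<in> carr Jh \<and> nrm Jh z \<le> 2 \<and>
    (\<forall>n. n \<le> g \<or> g' \<le> n \<longrightarrow> z n = zer (X n)) \<and> index_list S \<and> (\<forall>n\<in>set S. g \<le> n \<and> n < g') \<and>
    1 / 8 \<le> chain z S \<and> nrm Jh (vdiff Jh w z) \<le> (1 / 2) ^ k / 64)" for k g s
  have step: "\<exists>s. Q k g s" for k g
  proof -
    obtain w z S g' where "g < g' \<and> w \<in> M \<and> z \<in> carr Jh \<and> nrm Jh z \<le> 2 \<and>
      (\<forall>n. n \<le> g \<or> g' \<le> n \<longrightarrow> z n = zer (X n)) \<and> index_list S \<and> (\<forall>n\<in>set S. g \<le> n \<and> n < g') \<and>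
      1 / 8 \<le> chain z S \<and> nrm Jh (vdiff Jh w z) \<le> (1 / 2) ^ k / 64"
      using block_step[OF J.closed_subspaceD(1)[OF M] small, of "(1 / 2) ^ k / 64" g] by auto
    then have "Q k g (w, z, S, g')" unfolding Q_def prod.case .
    then show ?thesis ..
  qed
  have "\<exists>s. \<forall>k. True \<and> Q (Suc k) (snd (snd (snd (s k)))) (s (Suc k))"
    by (rule dependent_nat_choice) (use step in auto)
  then obtain s where s: "\<And>k. Q (Suc k) (snd (snd (snd (s k)))) (s (Suc k))" by blast
  define w z S g where "w k = fst (s (Suc k))" and "z k = fst (snd (s (Suc k)))"
    and "S k = fst (snd (snd (s (Suc k))))" and "g k = snd (snd (snd (s k)))" for k
  have Q: "g k < g (Suc k) \<and> w k \<in> M \<and> z k \<in> carr Jh \<and> nrm Jh (z k) \<le> 2 \<and>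
    (\<forall>n. n \<le> g k \<or> g (Suc k) \<le> n \<longrightarrow> z k n = zer (X n)) \<and> index_list (S k) \<and>
    (\<forall>n\<in>set (S k). g k \<le> n \<and> n < g (Suc k)) \<and>
    1 / 8 \<le> chain (z k) (S k) \<and> nrm Jh (vdiff Jh (w k) (z k)) \<le> (1 / 2) ^ Suc k / 64" for k
  proof -
    obtain a b c d where eq: "s (Suc k) = (a, b, c, d)" by (rule prod_cases4)
    have "Q (Suc k) (g k) (a, b, c, d)" using s[of k] by (simp only: eq g_def)
    then show ?thesis
      unfolding Q_def prod.case using eq by (simp add: w_def z_def S_def g_def)
  qed
  have pow: "(1 / 2) ^ Suc k / 64 \<le> (1 / 2 :: real) ^ k / 64" for k by simp
  show ?thesis
  proof (rule complemented_of_blocks[OF M, of g w z S])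
    show "nrm Jh (vdiff Jh (w k) (z k)) \<le> (1 / 2) ^ k / 64" for k
      using Q[of k] pow[of k] by linarith
  qed (use Q in auto)
qed

text \<open>Subprojectivity of \<open>J\<close> is applied to the image of \<open>M\<close> under \<open>trunc m\<close>, which is closed
  because \<open>M\<close> is complete and \<open>trunc m\<close> is bounded below on it.\<close>

lemma complemented_of_bounded_below:
  assumes M: "closed_subspace Jh M" "\<not> finite_dim (subsp Jh M)"
    and sub: "subprojective (Jsum X \<phi>)"
    and c: "0 < c" "\<And>x. x \<in> M \<Longrightarrow> c * nrm Jh x \<le> nrm Jh (trunc m x)"
  shows "\<exists>N\<subseteq>M. lin_subspace Jh N \<and> \<not> finite_dim (subsp Jh N) \<and> complemented Jh N"
proof -
  let ?J = "subsp Jh (Jset X \<phi>)"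
  let ?T = "trunc m"
  let ?R = "?T ` M"
  let ?V = "inv_into M ?T"
  note nJ = J.normed_space_axioms
  interpret JS: normed_space ?J by (rule normed_space_subsp[OF nJ Jset_subspace])
  note M' = J.closed_subspaceD[OF M(1)] and MD = lin_subspaceD[OF J.closed_subspaceD(1)[OF M(1)]]
  have R: "lin_subspace Jh ?R" by (rule lin_subspace_image[OF nJ nJ trunc_operator M'(1)])
  have RJ: "?R \<subseteq> Jset X \<phi>" using trunc_Jset MD(1) by blast
  have "isomorphism (subsp Jh M) (subsp Jh ?R) ?T"
    by (rule bounded_below_isomorphism[OF nJ M'(1) trunc_operator c])
  then have inj: "inj_on ?T M" and V: "operator (subsp Jh ?R) (subsp Jh M) ?V"
    by (simp_all add: isomorphism_def bij_betw_def)
  have VT: "?V (?T x) = x" if "x \<in> M" for x by (rule inv_into_f_f[OF inj that])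
  have TV: "?T (?V r) = r" "?V r \<in> M" if "r \<in> ?R" for r
    using that by (auto simp: f_inv_into_f intro: inv_into_into)
  have "closed_subspace ?J ?R"
  proof (rule JS.closed_subspaceI)
    show "lin_subspace ?J ?R" using R RJ by (simp add: lin_subspace_subsp[OF Jset_subspace])
    fix s l assume sl: "converges_to ?J s l" "\<And>n. s n \<in> ?R" "l \<in> carr ?J"
    have sl': "converges_to Jh s l" using sl(1) by (simp add: converges_to_def)
    have lJ: "l \<in> carr Jh" using sl(3) by (simp add: Jset_def)
    have sJ: "s n \<in> carr Jh" for n using sl(2) lin_subspaceD(1)[OF R] by blast
    define y where "y n = ?V (s n)" for n
    have y: "y n \<in> M" "?T (y n) = s n" for n using TV[OF sl(2)] by (simp_all add: y_def)
    have yJ: "y n \<in> carr Jh" for n using y(1) MD(1) by blast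
    have "\<exists>l\<in>carr Jh. converges_to Jh y l"
    proof (rule J.Cauchy_converges[OF yJ])
      fix e :: real assume e: "0 < e"
      have "\<forall>\<^sub>F n in sequentially. nrm Jh (vdiff Jh (s n) l) < c * e / 2"
        by (rule order_tendstoD(2)[OF sl'[unfolded converges_to_def]]) (use c e in simp)
      then obtain N where N: "\<And>n. N \<le> n \<Longrightarrow> nrm Jh (vdiff Jh (s n) l) < c * e / 2"
        by (auto simp: eventually_sequentially)
      have "nrm Jh (vdiff Jh (y i) (y j)) < e" if "N \<le> i" "N \<le> j" for i j
      proof -
        have "c * nrm Jh (vdiff Jh (y i) (y j)) \<le> nrm Jh (vdiff Jh (s i) (s j))"
          using c(2)[OF MD(5)[OF y(1) y(1)], of i j] by (simp add: trunc_vdiff y)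
        also have "\<dots> < c * e"
          using J.nrm_vdiff_triangle[OF sJ lJ sJ, of i j] J.nrm_vdiff_commute[OF lJ sJ, of j] N[OF that(1)] N[OF that(2)]
          by linarith
        finally show ?thesis using c(1) by simp
      qed
      then show "\<exists>N. \<forall>i\<ge>N. \<forall>j\<ge>N. nrm Jh (vdiff Jh (y i) (y j)) < e" by blast
    qed
    then obtain y0 where y0: "y0 \<in> carr Jh" "converges_to Jh y y0" by blast
    have "y0 \<in> M" by (rule M'(2)[OF y0(2) y(1) y0(1)])
    moreover have "converges_to Jh s (?T y0)"
      using J.converges_to_operator[OF nJ trunc_operator y0(2) yJ y0(1), of m] by (simp add: y(2))
    then have "l = ?T y0" by (rule J.converges_to_unique[OF sl' _ sJ lJ]) (rule trunc_Jh(1)[OF y0(1)])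
    ultimately show "l \<in> ?R" by blast
  qed
  moreover have "\<not> finite_dim (subsp ?J ?R)"
  proof
    assume "finite_dim (subsp ?J ?R)"
    then have "finite_dim (subsp Jh ?R)" by simp
    then have "finite_dim (subsp Jh M)"
    proof (rule finite_dim_image[where T = ?V])
      show "?V ` carr (subsp Jh ?R) = carr (subsp Jh M)" using TV(2) VT by force
    qed (simp_all only: operatorD[OF V] normed_space_subsp[OF nJ R] normed_space_subsp[OF nJ M'(1)])
    with M(2) show False by blast
  qed
  ultimately obtain N' where N': "N' \<subseteq> ?R" "\<not> finite_dim (subsp ?J N')" "complemented ?J N'"
    using sub unfolding subprojective_def Jsum_def by blast
  then obtain Q where Q: "operator ?J ?J Q" "\<And>x. x \<in> Jset X \<phi> \<Longrightarrow> Q (Q x) = Q x" "Q ` Jset X \<phi> = N'"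
    by (auto simp: complemented_def)
  define P where "P x = ?V (Q (?T x))" for x
  have QR: "Q (?T x) \<in> ?R" if "x \<in> carr Jh" for x using Q(3) N'(1) trunc_Jset[OF that] by blast
  have "operator Jh ?J ?T" by (rule operator_into_subsp[OF trunc_operator]) (rule trunc_Jset)
  from operator_comp[OF nJ JS.normed_space_axioms this Q(1)]
  have "operator Jh Jh (\<lambda>x. Q (?T x))"
    by (rule operator_from_subsp) (auto simp: Jset_def)
  then have "operator Jh (subsp Jh ?R) (\<lambda>x. Q (?T x))" by (rule operator_into_subsp) (rule QR)
  from operator_comp[OF nJ normed_space_subsp[OF nJ R] this V]
  have P: "operator Jh Jh P"
    unfolding P_def by (rule operator_from_subsp) (rule subsetI, rule MD(1))
  have PP: "P (P x) = P x" if x: "x \<in> carr Jh" for x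
    unfolding P_def TV(1)[OF QR[OF x]] using Q(2) trunc_Jset[OF x] by simp
  define N where "N = P ` carr Jh"
  have "complemented Jh N" using P PP unfolding complemented_def N_def by blast
  moreover have N: "lin_subspace Jh N"
    unfolding N_def by (rule lin_subspace_image[OF nJ nJ P]) (simp add: lin_subspace_def)
  moreover have "N \<subseteq> M" using TV(2)[OF QR] by (auto simp: N_def P_def)
  moreover have "\<not> finite_dim (subsp Jh N)"
  proof
    assume fin: "finite_dim (subsp Jh N)"
    have N'J: "lin_subspace Jh N'"
    proof -
      have "lin_subspace ?J (Q ` Jset X \<phi>)"
        by (rule lin_subspace_image[OF JS.normed_space_axioms JS.normed_space_axioms Q(1)])
          (simp add: lin_subspace_def lin_subspaceD[OF Jset_subspace])
      then show ?thesis using N'(1) RJ by (simp add: Q(3) lin_subspace_subsp[OF Jset_subspace])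
    qed
    have TN: "?T ` N = N'"
    proof
      show "?T ` N \<subseteq> N'" using TV(1)[OF QR] Q(3) trunc_Jset by (auto simp: N_def P_def)
      show "N' \<subseteq> ?T ` N"
      proof
        fix r assume r: "r \<in> N'"
        then obtain u where "u \<in> Jset X \<phi>" "r = Q u" using Q(3) by blast
        then have Qr: "Q r = r" using Q(2) by simp
        obtain x where x: "x \<in> M" "r = ?T x" using r N'(1) by blast
        have "?T (P x) = r" using TV(1)[OF QR[of x]] MD(1)[OF x(1)] x(2) Qr by (simp add: P_def)
        then show "r \<in> ?T ` N" using MD(1)[OF x(1)] unfolding N_def by blast
      qed
    qed
    have "finite_dim (subsp Jh N')"
      by (rule finite_dim_image[where T = ?T, OF fin normed_space_subsp[OF nJ N'J] _ _
            normed_space_subsp[OF nJ N]])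
        (simp_all add: trunc_add trunc_scl TN)
    with N'(2) show False by simp
  qed
  ultimately show ?thesis by blast
qed

end

lemma op_norm_le_one_contraction:
  assumes E: "normed_space E" and T: "operator E F T" and le: "op_norm E F T \<le> 1" and x: "x \<in> carr E"
  shows "nrm F (T x) \<le> nrm E x"
proof (rule field_le_epsilon)
  fix e :: real assume e: "0 < e"
  let ?S = "{C. 0 \<le> C \<and> (\<forall>x\<in>carr E. nrm F (T x) \<le> C * nrm E x)}"
  have nn: "0 \<le> nrm E x" by (rule normed_space.nrm_nonneg[OF E x])
  define d where "d = e / (nrm E x + 1)"
  have d: "0 < d" "d * nrm E x \<le> e" using e nn by (simp_all add: d_def field_simps)
  obtain C where "0 < C" "\<And>x. x \<in> carr E \<Longrightarrow> nrm F (T x) \<le> C * nrm E x"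
    using operator_bound[OF E T] by metis
  then have "C \<in> ?S" by simp
  then have ne: "?S \<noteq> {}" by blast
  have "Inf ?S < 1 + d" using le d(1) by (simp add: op_norm_def)
  then obtain B where B: "B \<in> ?S" "B < 1 + d" using cInf_lessD[OF ne] by blast
  then have "nrm F (T x) \<le> B * nrm E x" using x by blast
  also have "\<dots> \<le> (1 + d) * nrm E x" using B(2) nn by (intro mult_right_mono) auto
  also have "\<dots> \<le> nrm E x + e" using d(2) by (simp add: algebra_simps)
  finally show "nrm F (T x) \<le> nrm E x + e" .
qed

theorem proposition5p6:
  fixes X :: "nat \<Rightarrow> ('k::{real_normed_field,banach}, 'a) nspace"
    and \<phi> :: "nat \<Rightarrow> 'a \<Rightarrow> 'a"
  assumes "\<And>n. banach_space (X n)"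
    and "carr (X 0) = {zer (X 0)}"
    and "\<And>n. operator (X n) (X (Suc n)) (\<phi> n)"
    and "\<And>n. op_norm (X n) (X (Suc n)) (\<phi> n) \<le> 1"
    and "subprojective (Jsum X \<phi>)"
    and "strictly_singular (Jhat X \<phi>) (quotient_space (Jhat X \<phi>) (Jset X \<phi>))
           (qmap (Jhat X \<phi>) (Jset X \<phi>))"
  shows "subprojective (Jhat X \<phi>)"
proof -
  interpret jsum X \<phi>
  proof (rule jsum.intro)
    show "nrm (X (Suc n)) (\<phi> n x) \<le> nrm (X n) x" if "x \<in> carr (X n)" for n x
      using op_norm_le_one_contraction[OF _ assms(3,4) that] assms(1) by (simp add: banach_space_def)
  qed (rule assms)+
  show ?thesis
    unfolding subprojective_def
  proof (intro allI impI)
    fix M assume M: "closed_subspace Jh M \<and> \<not> finite_dim (subsp Jh M)"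
    note MD = lin_subspaceD[OF J.closed_subspaceD(1)[OF conjunct1[OF M]]]
    show "\<exists>N\<subseteq>M. lin_subspace Jh N \<and> \<not> finite_dim (subsp Jh N) \<and> complemented Jh N"
    proof (cases "\<exists>m c. 0 < c \<and> (\<forall>x\<in>M. c * nrm Jh x \<le> nrm Jh (trunc m x))")
      case True
      then obtain m c where "0 < c" "\<And>x. x \<in> M \<Longrightarrow> c * nrm Jh x \<le> nrm Jh (trunc m x)" by blast
      then show ?thesis using complemented_of_bounded_below M assms(5) by blast
    next
      case False
      have flat: "\<exists>x\<in>M. nrm Jh x = 1 \<and> nrm Jh (trunc m x) < d" if d: "0 < d" for m d
      proof -
        have "\<not> (\<forall>x\<in>M. d * nrm Jh x \<le> nrm Jh (trunc m x))" using False d by blast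
        then obtain u where u: "u \<in> M" "nrm Jh (trunc m u) < d * nrm Jh u" by (auto simp: not_le)
        have uJ: "u \<in> carr Jh" using u(1) MD(1) by blast
        have "0 < d * nrm Jh u" using u(2) J.nrm_nonneg[OF trunc_Jh(1)[OF uJ], of m] by linarith
        then have pos: "0 < nrm Jh u" using d by (simp add: zero_less_mult_iff)
        define c :: 'k where "c = of_real (1 / nrm Jh u)"
        have c: "norm c = 1 / nrm Jh u" using pos by (simp add: c_def norm_divide)
        have "nrm Jh (scl Jh c u) = 1" using uJ pos by (simp add: J.nrm_scl c)
        moreover have "nrm Jh (trunc m (scl Jh c u)) < d"
          using u(2) pos trunc_Jh(1)[OF uJ] by (simp add: trunc_scl J.nrm_scl c field_simps)
        ultimately show ?thesis using MD(4)[OF u(1)] by blast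
      qed
      show ?thesis
      proof (rule complemented_of_flat[OF conjunct1[OF M]])
        fix n and e :: real assume e: "0 < e"
        obtain x y where "x \<in> M" "nrm Jh x = 1" "nrm Jh (trunc n x) \<le> e" "y \<in> Jset X \<phi>"
          "nrm Jh (vdiff Jh x y) \<le> e"
          using small_vectors_near_Jset[OF conjunct1[OF M] assms(6) flat e] by blast
        then show "\<exists>x\<in>M. \<exists>y\<in>Jset X \<phi>. nrm Jh x = 1 \<and> nrm Jh (trunc n x) \<le> e \<and>
            nrm Jh (vdiff Jh x y) \<le> e" by blast
      qed
    qed
  qed
qed

end
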